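(* Let $\Psi\in\mathcal N_\dagger$, that is $\Psi\in\overline{\mathcal N}$ with $\Psi(0)<0$, and suppose $|\mathfrak a_+|=\infty$ and $-\mathfrak u_+\notin\mathbb N$. Then $-\Psi(0)>0$ and $$-\Psi(0)\sum_{k=1}^\infty\frac{\prod_{j=1}^{k-1}\Psi(j)}{k!}x^k$$ is the asymptotic expansion of $F_\Psi$ at zero, in the sense that for any $N\in\mathbb N$, $$F_\Psi(x)+\Psi(0)\sum_{k=1}^N\frac{\prod_{j=1}^{k-1}\Psi(j)}{k!}x^k=o(x^N)\quad\text{as }x\to0.$$ The asymptotic expansion cannot be a convergent series for any $x>0$ unless $\phi_+(z)=\phi_+(\infty)\in(0,\infty)$, or $\phi_+(z)=\phi_+(0)+\mathtt d_+z$ with $\mathtt d_+>0$ and $\phi_-(\infty)<\infty$. In the first case it converges for $x<\frac1{\phi_+(\infty)\mathtt d_-}$ and diverges for $x>\frac1{\phi_+(\infty)\mathtt d_-}$; in the second case it converges for $x<\frac1{\phi_-(\infty)\mathtt d_+}$ and diverges for $x>\frac1{\phi_-(\infty)\mathtt d_+}$.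
   Context: $\mathbb N=\{0,1,2,\dots\}$; $\prod_{j=1}^0=1$; $\frac10=\infty$. $\overline{\mathcal N}$: functions $\Psi(z)=\frac{\sigma^2}{2}z^2+\gamma z+\int_{-\infty}^\infty(e^{zr}-1-zr\mathbb I_{\{|r|<1\}})\Pi(dr)+\Psi(0)$, $z\in i\mathbb R$, with $\Psi(0)\le0$, $\sigma^2\ge0$, $\gamma\in\mathbb R$, $\int(1\wedge r^2)\Pi(dr)<\infty$. Each $\Psi\in\overline{\mathcal N}$, $\Psi\not\equiv0$, factors (Wiener-Hopf) as $\Psi(z)=-\phi_+(-z)\phi_-(z)$, where $\phi_\pm$ are Bernstein functions, $\phi_\pm(z)=\phi_\pm(0)+\mathtt d_\pm z+\int_0^\infty(1-e^{-zy})\mu_\pm(dy)$ with $\phi_\pm(0),\mathtt d_\pm\ge0$, $\int(1\wedge y)\mu_\pm(dy)<\infty$, $\phi_\pm\not\equiv0$, unique up to $(c\phi_+,c^{-1}\phi_-)$, $c>0$. $\phi_\pm(\infty)=\lim_{u\to\infty}\phi_\pm(u)$. $\mathfrak a_+=\inf\{u<0:\phi_+\text{ extends holomorphically to }\Re z>u\}\in[-\infty,0]$ ($\inf\emptyset=0$), $\mathfrak u_+=\sup\{u\in[\mathfrak a_+,0]:\phi_+(u)=0\}$ ($\sup\emptyset=-\infty$). For positive integers $j$, $\Psi(j)=-\phi_+(-j)\phi_-(j)$ (analytic extension). $\xi$ is the Lévy process with $\mathbb E[e^{z\xi_t}]=e^{\Psi(z)t}$, killed (sent to $+\infty$) at an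 independent exponential time $\mathbf e_q$ of rate $q=-\Psi(0)$; $I_\Psi=\int_0^{\mathbf e_q}e^{-\xi_s}ds$ and $F_\Psi(x)=\mathbb P(I_\Psi\le x)$. *)

theory Defs
  imports "HOL-Probability.Probability" "HOL-Complex_Analysis.Complex_Analysis"
begin

definition levy_measure :: "real measure \<Rightarrow> bool" where
  "levy_measure \<nu> \<longleftrightarrow> sets \<nu> = sets borel \<and> emeasure \<nu> {0} = 0 \<and>
     (\<integral>\<^sup>+ r. ennreal (min 1 (r\<^sup>2)) \<partial>\<nu>) < \<infinity>"

(* The class written N-bar in the literature.  Its elements are functions on the imaginary
   axis; the values of \<Psi> elsewhere are irrelevant. *)
definition levy_exponents :: "(complex \<Rightarrow> complex) set" where
  "levy_exponents = {\<Psi>. Im (\<Psi> 0) = 0 \<and> Re (\<Psi> 0) \<le> 0 \<and>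
     (\<exists>\<sigma>2 \<gamma> \<nu>. \<sigma>2 \<ge> 0 \<and> levy_measure \<nu> \<and>
        (\<forall>z. Re z = 0 \<longrightarrow>
           \<Psi> z = complex_of_real (\<sigma>2 / 2) * z\<^sup>2 + complex_of_real \<gamma> * z
             + (\<integral>r. (exp (z * complex_of_real r) - 1
                      - (if \<bar>r\<bar> < 1 then z * complex_of_real r else 0)) \<partial>\<nu>)
             + \<Psi> 0))}"

definition killed_levy_exponents :: "(complex \<Rightarrow> complex) set" where
  "killed_levy_exponents = {\<Psi> \<in> levy_exponents. Re (\<Psi> 0) < 0}"

(* \<phi> is a function on the closed right half-plane with drift d and a measure \<mu> living
   on (0,\<infinity>). *)
definition bernstein_repr :: "(complex \<Rightarrow> complex) \<Rightarrow> real \<Rightarrow> real measure \<Rightarrow> bool" where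
  "bernstein_repr \<phi> d \<mu> \<longleftrightarrow>
     Im (\<phi> 0) = 0 \<and> Re (\<phi> 0) \<ge> 0 \<and> d \<ge> 0 \<and>
     sets \<mu> = sets borel \<and> emeasure \<mu> {..0} = 0 \<and>
     (\<integral>\<^sup>+ y. ennreal (min 1 y) \<partial>\<mu>) < \<infinity> \<and>
     (\<forall>z. Re z \<ge> 0 \<longrightarrow>
        \<phi> z = \<phi> 0 + complex_of_real d * z
          + (\<integral>y. (1 - exp (- z * complex_of_real y)) \<partial>\<mu>))"

definition bernstein :: "(complex \<Rightarrow> complex) \<Rightarrow> bool" where
  "bernstein \<phi> \<longleftrightarrow> (\<exists>d \<mu>. bernstein_repr \<phi> d \<mu>)"

definition wiener_hopf ::
  "(complex \<Rightarrow> complex) \<Rightarrow> (complex \<Rightarrow> complex) \<Rightarrow> (complex \<Rightarrow> complex) \<Rightarrow> bool" where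
  "wiener_hopf \<Psi> \<phi>p \<phi>m \<longleftrightarrow>
     bernstein \<phi>p \<and> bernstein \<phi>m \<and>
     (\<exists>z. Re z \<ge> 0 \<and> \<phi>p z \<noteq> 0) \<and> (\<exists>z. Re z \<ge> 0 \<and> \<phi>m z \<noteq> 0) \<and>
     (\<forall>z. Re z = 0 \<longrightarrow> \<Psi> z = - \<phi>p (- z) * \<phi>m z)"

(* \<phi>(\<infinity>), possibly infinite; \<phi> is real on the positive half-line. *)
definition bernstein_at_infinity :: "(complex \<Rightarrow> complex) \<Rightarrow> ereal" where
  "bernstein_at_infinity \<phi> = Lim at_top (\<lambda>u::real. ereal (Re (\<phi> (complex_of_real u))))"

definition holomorphic_extension ::
  "(complex \<Rightarrow> complex) \<Rightarrow> real \<Rightarrow> (complex \<Rightarrow> complex) \<Rightarrow> bool" where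
  "holomorphic_extension \<phi> u g \<longleftrightarrow>
     g holomorphic_on {z. Re z > u} \<and> (\<forall>z. Re z \<ge> 0 \<longrightarrow> g z = \<phi> z)"

definition holo_abscissa :: "(complex \<Rightarrow> complex) \<Rightarrow> ereal" where
  "holo_abscissa \<phi> =
     (let S = {ereal u | u. u < 0 \<and> (\<exists>g. holomorphic_extension \<phi> u g)}
      in if S = {} then 0 else Inf S)"

(* The extension of \<phi> to Re z > holo_abscissa \<phi>; by the identity theorem the value does
   not depend on u and g. *)
definition bernstein_ext :: "(complex \<Rightarrow> complex) \<Rightarrow> complex \<Rightarrow> complex" where
  "bernstein_ext \<phi> z =
     (if Re z \<ge> 0 then \<phi> z
      else (THE w. \<exists>u g. u < 0 \<and> u < Re z \<and> holomorphic_extension \<phi> u g \<and> w = g z))"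

(* The supremum of the real zeros of \<phi> in [holo_abscissa \<phi>, 0]; Sup {} = -\<infinity> in ereal.
   At the left end point, if finite, \<phi>(u) is the limit from the right, which may be -\<infinity>;
   hence the zero is expressed by convergence to 0. *)
definition bernstein_zero :: "(complex \<Rightarrow> complex) \<Rightarrow> ereal" where
  "bernstein_zero \<phi> =
     Sup {ereal u | u. holo_abscissa \<phi> \<le> ereal u \<and> u \<le> 0 \<and>
       (if holo_abscissa \<phi> < ereal u then bernstein_ext \<phi> (complex_of_real u) = 0
        else ((\<lambda>x. bernstein_ext \<phi> (complex_of_real x)) \<longlongrightarrow> 0) (at_right u))}"

(* Analytic extension of \<Psi> to 0 < Re z < - holo_abscissa \<phi>p; it is the same for all
   Wiener-Hopf factorisations (c \<phi>p, \<phi>m / c) of \<Psi>. *)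
definition exponent_ext ::
  "(complex \<Rightarrow> complex) \<Rightarrow> (complex \<Rightarrow> complex) \<Rightarrow> complex \<Rightarrow> complex" where
  "exponent_ext \<phi>p \<phi>m z = - bernstein_ext \<phi>p (- z) * \<phi>m z"

definition expansion_coeff ::
  "(complex \<Rightarrow> complex) \<Rightarrow> (complex \<Rightarrow> complex) \<Rightarrow> nat \<Rightarrow> complex" where
  "expansion_coeff \<phi>p \<phi>m k = (\<Prod>j\<in>{1..<k}. exponent_ext \<phi>p \<phi>m (of_nat j)) / fact k"

definition expansion_converges ::
  "(complex \<Rightarrow> complex) \<Rightarrow> (complex \<Rightarrow> complex) \<Rightarrow> (complex \<Rightarrow> complex) \<Rightarrow> real \<Rightarrow> bool" where
  "expansion_converges \<Psi> \<phi>p \<phi>m x \<longleftrightarrow>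
     summable (\<lambda>k. - \<Psi> 0 * (expansion_coeff \<phi>p \<phi>m (Suc k) * complex_of_real x ^ Suc k))"

(* \<phi>(z) = \<phi>(\<infinity>) \<in> (0,\<infinity>) *)
definition bernstein_constant :: "(complex \<Rightarrow> complex) \<Rightarrow> bool" where
  "bernstein_constant \<phi> \<longleftrightarrow>
     0 < bernstein_at_infinity \<phi> \<and> bernstein_at_infinity \<phi> < \<infinity> \<and>
     (\<forall>z. Re z \<ge> 0 \<longrightarrow> \<phi> z = complex_of_real (real_of_ereal (bernstein_at_infinity \<phi>)))"

definition bernstein_affine :: "(complex \<Rightarrow> complex) \<Rightarrow> real \<Rightarrow> bool" where
  "bernstein_affine \<phi> d \<longleftrightarrow> d > 0 \<and> (\<forall>z. Re z \<ge> 0 \<longrightarrow> \<phi> z = \<phi> 0 + complex_of_real d * z)"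

definition cadlag :: "(real \<Rightarrow> real) \<Rightarrow> bool" where
  "cadlag f \<longleftrightarrow> (\<forall>t\<ge>0. continuous (at_right t) f) \<and> (\<forall>t>0. \<exists>l. (f \<longlongrightarrow> l) (at_left t))"

(* Time index t \<ge> 0. *)
definition levy_process :: "'a measure \<Rightarrow> (real \<Rightarrow> 'a \<Rightarrow> real) \<Rightarrow> bool" where
  "levy_process M \<xi> \<longleftrightarrow>
     prob_space M \<and>
     (\<forall>t\<ge>0. \<xi> t \<in> borel_measurable M) \<and>
     (AE \<omega> in M. \<xi> 0 \<omega> = 0) \<and>
     (\<forall>\<omega>\<in>space M. cadlag (\<lambda>t. \<xi> t \<omega>)) \<and>
     (\<forall>s\<ge>0. \<forall>h\<ge>0. distr M borel (\<lambda>\<omega>. \<xi> (s + h) \<omega> - \<xi> s \<omega>) = distr M borel (\<xi> h)) \<and>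
     (\<forall>n. \<forall>t::nat \<Rightarrow> real. 0 \<le> t 0 \<and> (\<forall>i<n. t i \<le> t (Suc i)) \<longrightarrow>
        prob_space.indep_vars M (\<lambda>_. borel) (\<lambda>i \<omega>. \<xi> (t (Suc i)) \<omega> - \<xi> (t i) \<omega>) {..<n})"

(* \<xi> is the unkilled process and T the killing time, of rate - \<Psi>(0).  The killed process
   equals \<xi> before T and +\<infinity> from T on; since exp(z \<cdot> (+\<infinity>)) is read as 0, its
   characteristic exponent is the \<Psi> below, killing term included. *)
definition killed_levy_process ::
  "'a measure \<Rightarrow> (real \<Rightarrow> 'a \<Rightarrow> real) \<Rightarrow> ('a \<Rightarrow> real) \<Rightarrow> (complex \<Rightarrow> complex) \<Rightarrow> bool" where
  "killed_levy_process M \<xi> T \<Psi> \<longleftrightarrow>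
     levy_process M \<xi> \<and>
     distributed M lborel T (\<lambda>t. ennreal (exponential_density (- Re (\<Psi> 0)) t)) \<and>
     prob_space.indep_set M
       (sets (vimage_algebra (space M) (\<lambda>\<omega>. \<lambda>t\<in>{0..}. \<xi> t \<omega>) (Pi\<^sub>M {0..} (\<lambda>_. borel))))
       (sets (vimage_algebra (space M) T borel)) \<and>
     (\<forall>t\<ge>0. \<forall>z. Re z = 0 \<longrightarrow>
        (\<integral>\<omega>. (if t < T \<omega> then exp (z * complex_of_real (\<xi> t \<omega>)) else 0) \<partial>M)
          = exp (\<Psi> z * complex_of_real t))"

definition exp_functional :: "(real \<Rightarrow> 'a \<Rightarrow> real) \<Rightarrow> ('a \<Rightarrow> real) \<Rightarrow> 'a \<Rightarrow> real" where
  "exp_functional \<xi> T \<omega> = (LINT s:{0..T \<omega>}|lborel. exp (- \<xi> s \<omega>))"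

definition exp_functional_cdf ::
  "'a measure \<Rightarrow> (real \<Rightarrow> 'a \<Rightarrow> real) \<Rightarrow> ('a \<Rightarrow> real) \<Rightarrow> real \<Rightarrow> real" where
  "exp_functional_cdf M \<xi> T = cdf (distr M borel (exp_functional \<xi> T))"

end

theory Submission
  imports Defs
begin

text \<open>Write \<open>q = - \<Psi>(0)\<close>, let \<open>\<xi>\<close> be the process before killing and
\<open>A(t) = \<integral>\<^sub>0\<^sup>t exp (- \<xi>(s)) ds\<close>.  The killing time is exponential and independent of \<open>\<xi>\<close>, hence
\<open>F(x) = \<integral>\<^sub>0\<^sup>\<infinity> q exp (- q t) P(A(t) \<le> x) dt\<close>.  The proof avoids Mellin inversion; it reads the
coefficients off a system of differential equations in time.  Let \<open>(y)\<^sub>+\<close> denote the positive part and put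
\<open>m\<^sub>k(t) = exp (- q t) E[exp (k \<xi>(t)) ((x - A(t))\<^sub>+)\<^sup>k]\<close>.
Since \<open>exp (\<xi>(t)) (x - A(t))\<close> is a generalised Ornstein-Uhlenbeck process started at \<open>x\<close>,
\<open>m\<^sub>k' = \<Psi>(k) m\<^sub>k - k m\<^sub>k\<^sub>-\<^sub>1\<close> with \<open>m\<^sub>k(0) = x\<^sup>k\<close>, at least in integrated form.  Integrating over \<open>[0,1]\<close> and
writing \<open>M\<^sub>k\<close> for the integral of \<open>m\<^sub>k\<close> gives
\<open>k M\<^sub>k\<^sub>-\<^sub>1 = x\<^sup>k - m\<^sub>k(1) + \<Psi>(k) M\<^sub>k\<close>.
Iterating this from \<open>M\<^sub>0\<close> produces exactly the coefficients \<open>\<Psi>(1) \<cdots> \<Psi>(k-1) / k!\<close>.  The errors are harmless: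
\<open>M\<^sub>k = O(x\<^sup>k)\<close>, while \<open>m\<^sub>k(1)\<close> and \<open>P(A(1) \<le> x)\<close> are smaller than every power of \<open>x\<close>, because by convexity
\<open>A(1)\<close> has negative moments of all orders.  Finally \<open>F(x)\<close> differs from \<open>q M\<^sub>0\<close> by at most \<open>P(A(1) \<le> x)\<close>.
A finite time horizon is essential: \<open>\<Psi>(k)\<close> may be positive, and then the integral of \<open>m\<^sub>k\<close> over all times
need not be finite.

All this needs \<open>E[exp (k \<xi>(t))] = exp ((\<Psi>(k) + q) t)\<close>, whereas \<open>\<Psi>\<close> is given only on the imaginary axis.  If
\<open>\<phi>\<^sub>+\<close> is entire, the factorisation extends \<open>\<Psi>\<close> to the closed right half-plane.  Subtracting from
\<open>exp ((\<Psi>(z) + q) t)\<close> the harmless contribution of the event \<open>\<xi>(t) < 0\<close> and pasting along the imaginary axis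
shows that the Laplace transform of the law of \<open>\<xi>(t)\<close> on \<open>[0,\<infinity>)\<close> is entire, and for a positive
measure this forces all exponential moments to exist (\<open>laplace_entire_extension\<close>, a theorem of Landau type).

The same theorem, applied to the Levy measure \<open>\<mu>\<^sub>+\<close> of \<open>\<phi>\<^sub>+\<close>, gives
\<open>- \<phi>\<^sub>+(-j) = - \<phi>\<^sub>+(0) + d\<^sub>+ j + \<integral> (exp (j y) - 1) \<mu>\<^sub>+(dy)\<close>.  The ratio of consecutive terms of the series has
modulus \<open>x \<bar>\<Psi>(j)\<bar> / (j + 1)\<close>, and no \<open>\<Psi>(j)\<close> vanishes, since \<open>- u\<^sub>+\<close> is not a natural number.  If \<open>\<mu>\<^sub>+ \<noteq> 0\<close>
the ratio tends to infinity.  If \<open>\<mu>\<^sub>+ = 0\<close>, then \<open>\<phi>\<^sub>+\<close> is constant or affine, and the limit of the ratio is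
\<open>x \<phi>\<^sub>+(\<infinity>) d\<^sub>-\<close> or \<open>x d\<^sub>+ \<phi>\<^sub>-(\<infinity>)\<close>, respectively.\<close>

section \<open>Laplace transforms of measures on the half-line\<close>

text \<open>The integrability condition of a Bernstein function.  Atoms at \<open>0\<close> are admitted, since this lets finite measures on
\<open>[0,\<infinity>)\<close> be treated by the same lemmas.\<close>

definition subordinator_measure :: "real measure \<Rightarrow> bool" where
  "subordinator_measure \<mu> \<longleftrightarrow> sets \<mu> = sets borel \<and> emeasure \<mu> {..<0} = 0 \<and>
     (\<integral>\<^sup>+ y. ennreal (min 1 y) \<partial>\<mu>) < \<infinity>"

lemma subordinator_measure_AE:
  assumes "subordinator_measure \<mu>"
  shows "AE y in \<mu>. 0 \<le> y"
proof (rule AE_I[where N = "{..<0}"])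
  show "{x \<in> space \<mu>. \<not> 0 \<le> x} \<subseteq> {..<0}" by auto
qed (use assms in \<open>auto simp: subordinator_measure_def\<close>)

lemma subordinator_measure_sets:
  "subordinator_measure \<mu> \<Longrightarrow> sets \<mu> = sets borel"
  by (simp add: subordinator_measure_def)

lemma integrable_min:
  assumes "subordinator_measure \<mu>"
  shows "integrable \<mu> (\<lambda>y. min 1 y)"
proof -
  note [measurable_cong] = subordinator_measure_sets[OF assms]
  have "(\<integral>\<^sup>+ y. ennreal (norm (min 1 y)) \<partial>\<mu>) = (\<integral>\<^sup>+ y. ennreal (min 1 y) \<partial>\<mu>)"
    by (rule nn_integral_cong_AE, use subordinator_measure_AE[OF assms] in eventually_elim) auto
  then show ?thesis
    using assms by (intro integrableI_bounded) (auto simp: subordinator_measure_def)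
qed

lemma norm_exp_diff_le:
  fixes a b :: complex
  assumes "Re a \<le> c" "Re b \<le> c"
  shows "norm (exp a - exp b) \<le> exp c * norm (a - b)"
proof (rule field_differentiable_bound[where S = "{z. Re z \<le> c}" and f' = exp])
  show "convex {z. Re z \<le> c}" by (rule convex_halfspace_Re_le)
qed (use assms in \<open>auto intro!: derivative_eq_intros\<close>)

text \<open>The kernel is at most \<open>2\<close> and at most \<open>\<bar>z\<bar> y\<close>, so it is dominated by the integrable function \<open>min 1 y\<close>,
locally uniformly in \<open>z\<close>.\<close>

lemma norm_one_minus_exp_le:
  assumes "Re z \<ge> 0" "0 \<le> y"
  shows "norm (1 - exp (- z * complex_of_real y)) \<le> (2 + norm z) * min 1 y"
proof -
  have r: "Re (- z * complex_of_real y) \<le> 0" using assms by simp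
  have "norm (exp 0 - exp (- z * complex_of_real y)) \<le> exp 0 * norm (0 - (- z * complex_of_real y))"
    using r by (intro norm_exp_diff_le) auto
  then have 1: "norm (1 - exp (- z * complex_of_real y)) \<le> norm z * y"
    using assms by (simp add: norm_mult)
  have "norm (exp (- z * complex_of_real y)) \<le> 1" using r by (subst norm_exp_eq_Re) simp
  then have 2: "norm (1 - exp (- z * complex_of_real y)) \<le> 2"
    using norm_triangle_ineq4[of 1 "exp (- z * complex_of_real y)"] unfolding norm_one by linarith
  show ?thesis
  proof (cases "y \<le> 1")
    case True then show ?thesis using 1 assms by (simp add: distrib_right)
  next
    case False then show ?thesis using 2 by (simp add: add_increasing2)
  qed
qed

lemma integrable_one_minus_exp:
  assumes "subordinator_measure \<mu>" "Re z \<ge> 0"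
  shows "integrable \<mu> (\<lambda>y. 1 - exp (- z * complex_of_real y))"
proof (rule Bochner_Integration.integrable_bound)
  note [measurable_cong] = subordinator_measure_sets[OF assms(1)]
  show "integrable \<mu> (\<lambda>y. (2 + norm z) * min 1 y)"
    using integrable_min[OF assms(1)] by simp
  show "(\<lambda>y. 1 - exp (- z * complex_of_real y)) \<in> borel_measurable \<mu>" by measurable
  show "AE y in \<mu>. norm (1 - exp (- z * complex_of_real y)) \<le> norm ((2 + norm z) * min 1 y)"
    using subordinator_measure_AE[OF assms(1)]
  proof eventually_elim
    case (elim y)
    then show ?case using norm_one_minus_exp_le[OF assms(2) elim] by simp
  qed
qed

lemma continuous_on_bernstein_integral:
  assumes "subordinator_measure \<mu>"
  shows "continuous_on {z. Re z \<ge> 0} (\<lambda>z. \<integral>y. (1 - exp (- z * complex_of_real y)) \<partial>\<mu>)"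
  unfolding continuous_on_sequentially comp_def
proof safe
  note [measurable_cong] = subordinator_measure_sets[OF assms(1)]
  fix X :: "nat \<Rightarrow> complex" and a
  assume X: "\<forall>n. X n \<in> {z. 0 \<le> Re z}" and lim: "X \<longlonglongrightarrow> a" and a: "0 \<le> Re a"
  from lim have "bounded (range X)" by (rule convergent_imp_bounded)
  then obtain B where B: "norm (X n) \<le> B" for n by (auto simp: bounded_iff)
  show "(\<lambda>n. \<integral>y. (1 - exp (- X n * complex_of_real y)) \<partial>\<mu>) \<longlonglongrightarrow>
        (\<integral>y. (1 - exp (- a * complex_of_real y)) \<partial>\<mu>)"
  proof (rule integral_dominated_convergence[where w = "\<lambda>y. (2 + B) * min 1 y"])
    show "AE y in \<mu>. (\<lambda>n. 1 - exp (- X n * complex_of_real y)) \<longlonglongrightarrow> 1 - exp (- a * complex_of_real y)"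
      by (intro AE_I2 tendsto_intros lim)
    fix n
    show "AE y in \<mu>. norm (1 - exp (- X n * complex_of_real y)) \<le> (2 + B) * min 1 y"
      using subordinator_measure_AE[OF assms(1)]
    proof eventually_elim
      case (elim y)
      have "norm (1 - exp (- X n * complex_of_real y)) \<le> (2 + norm (X n)) * min 1 y"
        using norm_one_minus_exp_le[of "X n", OF _ elim] X by simp
      also have "\<dots> \<le> (2 + B) * min 1 y" using B[of n] elim by (intro mult_right_mono) auto
      finally show ?case .
    qed
  qed (use integrable_min[OF assms(1)] in simp_all)
qed

text \<open>Differentiation under the integral.  For \<open>\<bar>h\<bar> < Re z / 2\<close> the difference quotients are bounded by
\<open>y exp (- c y)\<close> with \<open>c = Re z / 2\<close>, which is at most a multiple of \<open>min 1 y\<close>.\<close>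

lemma holomorphic_on_bernstein_integral:
  assumes "subordinator_measure \<mu>"
  shows "(\<lambda>z. \<integral>y. (1 - exp (- z * complex_of_real y)) \<partial>\<mu>) holomorphic_on {z. Re z > 0}"
proof -
  note [measurable_cong] = subordinator_measure_sets[OF assms(1)]
  let ?f = "\<lambda>z. \<integral>y. (1 - exp (- z * complex_of_real y)) \<partial>\<mu>"
  have "(?f has_field_derivative (\<integral>y. complex_of_real y * exp (- z * complex_of_real y) \<partial>\<mu>)) (at z)"
    if z: "Re z > 0" for z
  proof -
    define c where "c = Re z / 2"
    have c: "c > 0" using z by (simp add: c_def)
    have eq: "at (0::complex) = at 0 within ball 0 c" using c by (simp add: at_within_open[of 0 "ball 0 c"])
    have "((\<lambda>h. (?f (z + h) - ?f z) / h) \<longlongrightarrow> (\<integral>y. complex_of_real y * exp (- z * complex_of_real y) \<partial>\<mu>)) (at 0)"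
      unfolding eq tendsto_at_iff_sequentially comp_def
    proof safe
      fix X :: "nat \<Rightarrow> complex"
      assume X: "\<forall>n. X n \<in> ball 0 c - {0}" and lim: "X \<longlonglongrightarrow> 0"
      have X': "norm (X n) < c" "X n \<noteq> 0" for n using X[rule_format, of n] by auto
      have re: "Re (z + X n) \<ge> c" for n
        using X'(1)[of n] abs_Re_le_cmod[of "X n"] unfolding c_def plus_complex.sel by linarith
      have int: "integrable \<mu> (\<lambda>y. 1 - exp (- (z + X n) * complex_of_real y))" for n
        using re[of n] c by (intro integrable_one_minus_exp[OF assms]) linarith
      have int0: "integrable \<mu> (\<lambda>y. 1 - exp (- z * complex_of_real y))"
        using z by (intro integrable_one_minus_exp[OF assms]) linarith
      have "(\<lambda>n. \<integral>y. (exp (- z * complex_of_real y) - exp (- (z + X n) * complex_of_real y)) / X n \<partial>\<mu>)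
          \<longlonglongrightarrow> (\<integral>y. complex_of_real y * exp (- z * complex_of_real y) \<partial>\<mu>)"
      proof (rule integral_dominated_convergence[where w = "\<lambda>y. (1 + 1 / c) * min 1 y"])
        show "AE y in \<mu>. (\<lambda>n. (exp (- z * complex_of_real y) - exp (- (z + X n) * complex_of_real y)) / X n)
            \<longlonglongrightarrow> complex_of_real y * exp (- z * complex_of_real y)"
        proof (rule AE_I2)
          fix y
          have "((\<lambda>h. - exp (- (z + h) * complex_of_real y)) has_field_derivative
                complex_of_real y * exp (- z * complex_of_real y)) (at 0)"
            by (auto intro!: derivative_eq_intros)
          then have "((\<lambda>h. (- exp (- (z + h) * complex_of_real y) - (- exp (- z * complex_of_real y))) / h)
             \<longlongrightarrow> complex_of_real y * exp (- z * complex_of_real y)) (at 0)"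
            by (simp add: has_field_derivative_iff)
          then have "(\<lambda>n. (- exp (- (z + X n) * complex_of_real y) - (- exp (- z * complex_of_real y))) / X n)
             \<longlonglongrightarrow> complex_of_real y * exp (- z * complex_of_real y)"
            using X' lim unfolding tendsto_at_iff_sequentially comp_def by auto
          then show "(\<lambda>n. (exp (- z * complex_of_real y) - exp (- (z + X n) * complex_of_real y)) / X n)
            \<longlonglongrightarrow> complex_of_real y * exp (- z * complex_of_real y)"
            by (simp only: minus_diff_eq diff_minus_eq_add add.commute[of "- exp _" "exp _"] diff_conv_add_uminus[symmetric])
        qed
        fix n
        show "AE y in \<mu>. norm ((exp (- z * complex_of_real y) - exp (- (z + X n) * complex_of_real y)) / X n)
             \<le> (1 + 1 / c) * min 1 y"
          using subordinator_measure_AE[OF assms(1)]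
        proof eventually_elim
          case (elim y)
          have "norm (exp (- z * complex_of_real y) - exp (- (z + X n) * complex_of_real y))
             \<le> exp (- (c * y)) * norm (- z * complex_of_real y - (- (z + X n) * complex_of_real y))"
            using re[of n] z elim mult_right_mono[OF re[of n] elim] mult_right_mono[of c "Re z" y]
            by (intro norm_exp_diff_le) (simp_all add: algebra_simps c_def)
          also have "norm (- z * complex_of_real y - (- (z + X n) * complex_of_real y)) = norm (X n) * y"
          proof -
            have "- z * complex_of_real y - (- (z + X n) * complex_of_real y) = X n * complex_of_real y"
              by (simp add: algebra_simps)
            then show ?thesis using elim by (simp add: norm_mult)
          qed
          finally have "norm ((exp (- z * complex_of_real y) - exp (- (z + X n) * complex_of_real y)) / X n)
              \<le> y * exp (- (c * y))"
            using X'(2)[of n] by (simp add: norm_divide field_simps)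
          also have "\<dots> \<le> (1 + 1 / c) * min 1 y"
          proof -
            have 1: "y * exp (- (c * y)) \<le> y" using elim c by (simp add: mult_left_le)
            have "c * y \<le> exp (c * y)" using exp_ge_add_one_self[of "c * y"] by linarith
            then have 2: "y * exp (- (c * y)) \<le> 1 / c" using c by (simp add: exp_minus field_simps)
            show ?thesis
            proof (cases "y \<le> 1")
              case True
              have "y \<le> (1 + 1 / c) * y" using elim c by (simp add: distrib_right)
              then show ?thesis using 1 True by simp
            next
              case False
              then show ?thesis using 2 by simp
            qed
          qed
          finally show ?case .
        qed
      qed (use integrable_min[OF assms(1)] in simp_all)
      moreover have "(\<integral>y. (exp (- z * complex_of_real y) - exp (- (z + X n) * complex_of_real y)) / X n \<partial>\<mu>)
          = (?f (z + X n) - ?f z) / X n" for n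
      proof -
        have "?f (z + X n) - ?f z = (\<integral>y. (exp (- z * complex_of_real y) - exp (- (z + X n) * complex_of_real y)) \<partial>\<mu>)"
          by (subst Bochner_Integration.integral_diff[OF int int0, symmetric]) simp
        then show ?thesis by simp
      qed
      ultimately show "(\<lambda>n. (?f (z + X n) - ?f z) / X n)
         \<longlonglongrightarrow> (\<integral>y. complex_of_real y * exp (- z * complex_of_real y) \<partial>\<mu>)" by (simp only:)
    qed
    then show ?thesis unfolding DERIV_def .
  qed
  then show ?thesis
    unfolding holomorphic_on_def field_differentiable_def
    by (blast intro: has_field_derivative_at_within)
qed

lemma power_exp_le_fact:
  fixes y :: real
  assumes "0 \<le> y"
  shows "\<bar>y ^ n * exp (- y) / fact n\<bar> \<le> 1"
proof -
  have "(\<lambda>n. y ^ n /\<^sub>R fact n) sums exp y" by (rule exp_converges)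
  then have "sum (\<lambda>n. y ^ n /\<^sub>R fact n) {n} \<le> exp y"
    using assms by (intro sum_le_suminf[of "\<lambda>n. y ^ n /\<^sub>R fact n", simplified sums_unique[symmetric], THEN order_trans])
      (auto simp: sums_iff)
  then show ?thesis using assms by (simp add: exp_minus field_simps)
qed

text \<open>Expansion of the Laplace transform about the point \<open>1\<close>, in the variable \<open>w = 1 - z\<close>.  The sign is chosen so that
all coefficients are nonnegative: absolute convergence of the series at \<open>w\<close> is then the same as
finiteness of the exponential moment of order \<open>\<bar>w\<bar> - 1\<close>.\<close>

lemma laplace_power_series:
  fixes w :: complex
  assumes fin: "finite_measure \<rho>" and sets[measurable_cong]: "sets \<rho> = sets borel"
    and nonneg: "AE y in \<rho>. 0 \<le> y"
    and sm: "summable (\<lambda>n. (\<integral>y. y ^ n * exp (- y) / fact n \<partial>\<rho>) * norm w ^ n)"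
  shows "integrable \<rho> (\<lambda>y. exp ((w - 1) * complex_of_real y))"
    and "(\<lambda>n. complex_of_real (\<integral>y. y ^ n * exp (- y) / fact n \<partial>\<rho>) * w ^ n) sums
           (\<integral>y. exp ((w - 1) * complex_of_real y) \<partial>\<rho>)"
proof -
  interpret finite_measure \<rho> by (rule fin)
  let ?b = "\<lambda>n y. y ^ n * exp (- y) / fact n :: real"
  have b: "norm (?b n y) \<le> 1" if "0 \<le> y" for n y
    using power_exp_le_fact[OF that] by simp
  have int: "integrable \<rho> (?b n)" for n
    by (rule integrable_const_bound[where B = 1]) (use nonneg b in \<open>auto elim!: eventually_mono intro!: borel_measurable_divide borel_measurable_times borel_measurable_power\<close>)
  define f where "f n y = complex_of_real (?b n y) * w ^ n" for n y
  have fsums: "(\<lambda>n. f n y) sums exp ((w - 1) * complex_of_real y)" for y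
  proof -
    have "(\<lambda>n. exp (- complex_of_real y) * ((w * complex_of_real y) ^ n /\<^sub>R fact n)) sums
        (exp (- complex_of_real y) * exp (w * complex_of_real y))"
      by (intro sums_mult exp_converges)
    also have "exp (- complex_of_real y) * exp (w * complex_of_real y) = exp ((w - 1) * complex_of_real y)"
      by (simp add: exp_add[symmetric] algebra_simps)
    also have "(\<lambda>n. exp (- complex_of_real y) * ((w * complex_of_real y) ^ n /\<^sub>R fact n)) = (\<lambda>n. f n y)"
      by (auto simp: f_def fun_eq_iff scaleR_conv_of_real power_mult_distrib exp_of_real[symmetric] field_simps)
    finally show ?thesis .
  qed
  have intf: "integrable \<rho> (f n)" for n
    unfolding f_def by (intro integrable_mult_left integrable_of_real int)
  have "summable (\<lambda>n. norm (f n y))" for y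
  proof -
    have "summable (\<lambda>n. exp (- y) * norm ((w * complex_of_real y) ^ n /\<^sub>R fact n))"
      by (intro summable_mult summable_norm_exp)
    also have "(\<lambda>n. exp (- y) * norm ((w * complex_of_real y) ^ n /\<^sub>R fact n)) = (\<lambda>n. norm (f n y))"
      by (auto simp: f_def fun_eq_iff norm_mult norm_divide norm_power power_mult_distrib abs_mult power_abs field_simps)
    finally show ?thesis .
  qed
  then have 1: "AE y in \<rho>. summable (\<lambda>n. norm (f n y))" by simp
  have "(\<integral>y. norm (f n y) \<partial>\<rho>) = (\<integral>y. ?b n y \<partial>\<rho>) * norm w ^ n" for n
  proof -
    have "(\<integral>y. norm (f n y) \<partial>\<rho>) = (\<integral>y. ?b n y * norm w ^ n \<partial>\<rho>)"
    proof (rule integral_cong_AE)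
      show "AE y in \<rho>. norm (f n y) = ?b n y * norm w ^ n"
        using nonneg by eventually_elim (simp add: f_def norm_divide norm_mult norm_power)
    qed (simp_all add: f_def)
    then show ?thesis by simp
  qed
  then have 2: "summable (\<lambda>n. \<integral>y. norm (f n y) \<partial>\<rho>)" using sm by simp
  have S: "(\<Sum>n. f n y) = exp ((w - 1) * complex_of_real y)" for y using fsums by (simp add: sums_iff)
  show "integrable \<rho> (\<lambda>y. exp ((w - 1) * complex_of_real y))"
    using integrable_suminf[OF intf 1 2] by (simp add: S)
  have "(\<integral>y. f n y \<partial>\<rho>) = complex_of_real (\<integral>y. ?b n y \<partial>\<rho>) * w ^ n" for n
    unfolding f_def by (simp only: integral_mult_left_zero integral_complex_of_real)
  then show "(\<lambda>n. complex_of_real (\<integral>y. ?b n y \<partial>\<rho>) * w ^ n) sums (\<integral>y. exp ((w - 1) * complex_of_real y) \<partial>\<rho>)"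
    using sums_integral[OF intf 1 2] by (simp add: S)
qed

text \<open>Landau's argument for positive measures: the Taylor series at \<open>1\<close> of an entire continuation converges
everywhere, in particular at large positive \<open>w\<close>, where its nonnegative terms sum to an exponential moment.\<close>

lemma laplace_entire_extension:
  assumes fin: "finite_measure \<rho>" and sets[measurable_cong]: "sets \<rho> = sets borel"
    and nonneg: "AE y in \<rho>. 0 \<le> y"
    and hol: "g holomorphic_on UNIV"
    and eq: "\<And>z. Re z > 0 \<Longrightarrow> g z = (\<integral>y. exp (- z * complex_of_real y) \<partial>\<rho>)"
  shows "integrable \<rho> (\<lambda>y. exp (- z * complex_of_real y))"
    and "g z = (\<integral>y. exp (- z * complex_of_real y) \<partial>\<rho>)"
proof -
  interpret finite_measure \<rho> by (rule fin)
  define a where "a n = (\<integral>y. y ^ n * exp (- y) / fact n \<partial>\<rho>)" for n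
  \<comment> \<open>The change of variable \<open>w = 1 - z\<close> moves the centre \<open>1\<close> of the expansion to the origin.\<close>
  define G where "G w = g (1 - w)" for w
  have holG: "G holomorphic_on A" for A
    unfolding G_def using holomorphic_on_compose_gen[OF _ hol, of "\<lambda>w. 1 - w" A]
    by (simp add: o_def holomorphic_on_diff)
  have a_bound: "\<bar>a n\<bar> \<le> measure \<rho> (space \<rho>)" for n
  proof -
    have int: "integrable \<rho> (\<lambda>y. y ^ n * exp (- y) / fact n)"
      by (rule integrable_const_bound[where B = 1]) (use nonneg power_exp_le_fact in \<open>auto elim!: eventually_mono\<close>)
    have "norm (a n) \<le> (\<integral>y. norm (y ^ n * exp (- y) / fact n) \<partial>\<rho>)"
      unfolding a_def by (rule integral_norm_bound)
    also have "\<dots> \<le> (\<integral>y. 1 \<partial>\<rho>)"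
      by (intro integral_mono_AE integrable_norm int integrable_const)
        (use nonneg power_exp_le_fact in \<open>auto elim!: eventually_mono simp: abs_mult\<close>)
    finally show ?thesis by simp
  qed
  have small: "summable (\<lambda>n. a n * norm w ^ n)" if "norm w < 1" for w :: complex
  proof (rule summable_comparison_test)
    show "\<exists>N. \<forall>n\<ge>N. norm (a n * norm w ^ n) \<le> measure \<rho> (space \<rho>) * norm w ^ n"
      using a_bound by (intro exI[of _ 0]) (auto simp: abs_mult intro!: mult_right_mono)
    show "summable (\<lambda>n. measure \<rho> (space \<rho>) * norm w ^ n)"
      using that by (intro summable_mult summable_geometric) simp
  qed
  have sumsG: "(\<lambda>n. complex_of_real (a n) * w ^ n) sums G w" if "norm w < 1" for w
  proof -
    have "Re (1 - w) > 0" using that complex_Re_le_cmod[of w] by simp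
    then have "G w = (\<integral>y. exp ((w - 1) * complex_of_real y) \<partial>\<rho>)" by (simp add: G_def eq)
    then show ?thesis
      using laplace_power_series(2)[OF fin sets nonneg small[OF that, unfolded a_def], folded a_def] by simp
  qed
  define F where "F = Abs_fps (\<lambda>n. complex_of_real (a n))"
  have "ereal (norm (1/2 :: complex)) \<le> fps_conv_radius F"
    unfolding fps_conv_radius_def F_def
    using sumsG[of "1/2"] by (intro conv_radius_geI) (auto simp: sums_iff)
  then have "fps_conv_radius F > 0" by (auto simp: less_le_trans[of 0 "ereal (1/2)"])
  moreover have "eventually (\<lambda>w. eval_fps F w = G w) (nhds 0)"
  proof -
    have "eventually (\<lambda>w. w \<in> ball (0::complex) 1) (nhds 0)" by (intro eventually_nhds_in_open) auto
    then show ?thesis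
      by eventually_elim (use sumsG in \<open>auto simp: eval_fps_def F_def sums_iff\<close>)
  qed
  ultimately have "G has_fps_expansion F" by (auto simp: has_fps_expansion_def)
  then have sums: "(\<lambda>n. complex_of_real (a n) * w ^ n) sums G w" for w
    using has_fps_expansion_imp_sums_complex[of G F \<infinity> w, OF _ holG] by (simp add: F_def)
  have "summable (\<lambda>n. complex_of_real (a n) * complex_of_real (norm w) ^ n)" for w :: complex
    using sums by (auto simp: sums_iff)
  then have "summable (\<lambda>n. complex_of_real (a n * norm w ^ n))" for w :: complex by simp
  then have sm: "summable (\<lambda>n. a n * norm w ^ n)" for w :: complex
    using summable_of_real_iff by blast
  have z: "- z = (1 - z) - 1" by simp
  show "integrable \<rho> (\<lambda>y. exp (- z * complex_of_real y))"
    unfolding z using laplace_power_series(1)[OF fin sets nonneg sm[unfolded a_def]] .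
  show "g z = (\<integral>y. exp (- z * complex_of_real y) \<partial>\<rho>)"
    using laplace_power_series(2)[OF fin sets nonneg sm[unfolded a_def], of "1 - z", folded a_def]
      sums[of "1 - z"] by (simp add: G_def sums_iff)
qed

lemma finite_measure_subordinator:
  assumes "finite_measure \<rho>" "sets \<rho> = sets borel" "AE y in \<rho>. 0 \<le> y"
  shows "subordinator_measure \<rho>"
  unfolding subordinator_measure_def
proof (intro conjI)
  interpret finite_measure \<rho> by fact
  show "sets \<rho> = sets borel" by fact
  have "{x \<in> space \<rho>. \<not> 0 \<le> x} = {..<0}" using sets_eq_imp_space_eq[OF assms(2)] by auto
  then show "emeasure \<rho> {..<0} = 0"
    using assms(2,3) by (subst (asm) AE_iff_measurable[of "{..<0}"]) auto
  have "(\<integral>\<^sup>+ y. ennreal (min 1 y) \<partial>\<rho>) \<le> (\<integral>\<^sup>+ y. 1 \<partial>\<rho>)"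
    by (intro nn_integral_mono) (simp add: ennreal_leI min.coboundedI1 flip: ennreal_1)
  also have "\<dots> < \<infinity>" by (simp add: less_top[symmetric])
  finally show "(\<integral>\<^sup>+ y. ennreal (min 1 y) \<partial>\<rho>) < \<infinity>" .
qed

text \<open>For a finite measure the transform of \<open>exp\<close> is the total mass minus the transform of \<open>1 - exp\<close>, so the
results on Bernstein integrals carry over.\<close>

lemma laplace_transform_regular:
  assumes "finite_measure \<rho>" "sets \<rho> = sets borel" "AE y in \<rho>. 0 \<le> y"
  shows "(\<lambda>z. \<integral>y. exp (- z * complex_of_real y) \<partial>\<rho>) holomorphic_on {z. Re z > 0}"
    and "continuous_on {z. Re z \<ge> 0} (\<lambda>z. \<integral>y. exp (- z * complex_of_real y) \<partial>\<rho>)"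
    and "Re z \<ge> 0 \<Longrightarrow> integrable \<rho> (\<lambda>y. exp (- z * complex_of_real y))"
proof -
  interpret finite_measure \<rho> by fact
  note sub = finite_measure_subordinator[OF assms]
  let ?m = "complex_of_real (measure \<rho> (space \<rho>))"
  let ?K = "\<lambda>z. \<integral>y. (1 - exp (- z * complex_of_real y)) \<partial>\<rho>"
  have int: "integrable \<rho> (\<lambda>y. exp (- z * complex_of_real y))" if "Re z \<ge> 0" for z
    using Bochner_Integration.integrable_diff[OF integrable_const[of 1] integrable_one_minus_exp[OF sub that]] by simp
  then show "Re z \<ge> 0 \<Longrightarrow> integrable \<rho> (\<lambda>y. exp (- z * complex_of_real y))" .
  have eq: "(\<integral>y. exp (- z * complex_of_real y) \<partial>\<rho>) = ?m - ?K z" if "Re z \<ge> 0" for z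
    by (subst Bochner_Integration.integral_diff[OF _ int[OF that]]) (simp_all add: scaleR_conv_of_real)
  have "(\<lambda>z. ?m - ?K z) holomorphic_on {z. Re z > 0}"
    by (intro holomorphic_intros holomorphic_on_bernstein_integral sub)
  then show "(\<lambda>z. \<integral>y. exp (- z * complex_of_real y) \<partial>\<rho>) holomorphic_on {z. Re z > 0}"
    by (rule holomorphic_transform) (rule eq[symmetric], simp)
  have "continuous_on {z. Re z \<ge> 0} (\<lambda>z. ?m - ?K z)"
    by (intro continuous_intros continuous_on_bernstein_integral sub)
  then show "continuous_on {z. Re z \<ge> 0} (\<lambda>z. \<integral>y. exp (- z * complex_of_real y) \<partial>\<rho>)"
    by (rule continuous_on_eq) (rule eq[symmetric], simp)
qed

text \<open>A characteristic function with a continuous extension to the closed right half-plane that is holomorphic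
inside yields all positive exponential moments.  The left part of the measure has a transform that is regular on
the right half-plane anyway; what remains of \<open>G\<close> continues the transform of the right part to an entire
function.\<close>

lemma exponential_moments_of_analytic_extension:
  assumes fin: "finite_measure \<rho>" and sets: "sets \<rho> = sets borel"
    and hol: "G holomorphic_on {z. Re z > 0}" and cont: "continuous_on {z. Re z \<ge> 0} G"
    and eq: "\<And>z. Re z = 0 \<Longrightarrow> (\<integral>x. exp (z * complex_of_real x) \<partial>\<rho>) = G z"
    and z: "Re z \<ge> 0"
  shows "integrable \<rho> (\<lambda>x. exp (z * complex_of_real x))"
    and "(\<integral>x. exp (z * complex_of_real x) \<partial>\<rho>) = G z"
proof -
  interpret finite_measure \<rho> by (rule fin)
  note [measurable_cong] = sets
  \<comment> \<open>The law on \<open>[0,\<infinity>)\<close>, and the reflection of the law on \<open>(-\<infinity>,0)\<close>.\<close>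
  define \<rho>p where "\<rho>p = density \<rho> (indicator {0..})"
  define \<rho>n where "\<rho>n = density \<rho> (indicator {..<0})"
  define \<rho>m where "\<rho>m = distr \<rho>n borel uminus"
  have [measurable_cong, simp]: "sets \<rho>p = sets borel" "sets \<rho>n = sets borel" "sets \<rho>m = sets borel"
    by (simp_all add: \<rho>p_def \<rho>n_def \<rho>m_def sets)
  have finp: "finite_measure \<rho>p" and finn: "finite_measure \<rho>n"
    unfolding \<rho>p_def \<rho>n_def by (intro finite_measure_restricted; simp)+
  have finm: "finite_measure \<rho>m"
    unfolding \<rho>m_def by (intro finite_measure.finite_measure_distr[OF finn]) measurable
  have nnp: "AE y in \<rho>p. 0 \<le> y"
    unfolding \<rho>p_def by (subst AE_density) (auto simp: indicator_def split: if_splits)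
  have "AE y in \<rho>n. 0 \<le> - y"
    unfolding \<rho>n_def by (subst AE_density) (auto simp: indicator_def split: if_splits)
  then have nnm: "AE y in \<rho>m. 0 \<le> y"
    unfolding \<rho>m_def by (subst AE_distr_iff) auto
  let ?Lp = "\<lambda>z. \<integral>y. exp (- z * complex_of_real y) \<partial>\<rho>p"
  let ?Lm = "\<lambda>z. \<integral>y. exp (- z * complex_of_real y) \<partial>\<rho>m"
  note P = laplace_transform_regular[OF finp \<open>sets \<rho>p = sets borel\<close> nnp]
  note N = laplace_transform_regular[OF finm \<open>sets \<rho>m = sets borel\<close> nnm]
  have ind: "density \<rho> (indicator A) = density \<rho> (\<lambda>x. ennreal (indicator A x))" for A
    by (simp add: ennreal_indicator)
  have Lp: "?Lp w = (\<integral>x. indicator {0..} x *\<^sub>R exp (- w * complex_of_real x) \<partial>\<rho>)" for w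
    unfolding \<rho>p_def ind by (subst integral_density) auto
  have ip: "integrable \<rho>p (\<lambda>y. exp (- w * complex_of_real y)) \<longleftrightarrow>
      integrable \<rho> (\<lambda>x. indicator {0..} x *\<^sub>R exp (- w * complex_of_real x))" for w
    unfolding \<rho>p_def ind by (subst integrable_density) auto
  have Lm: "?Lm w = (\<integral>x. indicator {..<0} x *\<^sub>R exp (w * complex_of_real x) \<partial>\<rho>)" for w
    unfolding \<rho>m_def \<rho>n_def ind by (subst integral_distr, simp, simp, subst integral_density) auto
  have im: "integrable \<rho>m (\<lambda>y. exp (- w * complex_of_real y)) \<longleftrightarrow>
      integrable \<rho> (\<lambda>x. indicator {..<0} x *\<^sub>R exp (w * complex_of_real x))" for w
    unfolding \<rho>m_def \<rho>n_def ind
    by (subst integrable_distr_eq, simp, simp, subst integrable_density) auto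
  have split: "exp (w * complex_of_real x) = indicator {0..} x *\<^sub>R exp (w * complex_of_real x) +
      indicator {..<0} x *\<^sub>R exp (w * complex_of_real x)" for w x
    by (auto simp: indicator_def)
  have sum: "integrable \<rho> (\<lambda>x. exp (w * complex_of_real x)) \<and>
      (\<integral>x. exp (w * complex_of_real x) \<partial>\<rho>) = ?Lp (- w) + ?Lm w"
    if "integrable \<rho>p (\<lambda>y. exp (- (- w) * complex_of_real y))" "integrable \<rho>m (\<lambda>y. exp (- w * complex_of_real y))" for w
    using that unfolding ip im Lp Lm
    by (subst (1 2) split) (simp add: Bochner_Integration.integral_add)
  \<comment> \<open>On the imaginary axis both branches agree, since there \<open>G\<close> is the sum of the two partial transforms.\<close>
  define H where "H w = (if Re w \<le> 0 then ?Lp (- w) else G w - ?Lm w)" for w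
  have holp: "(\<lambda>w. ?Lp (- w)) holomorphic_on {w. Re w < 0}"
    using holomorphic_on_compose_gen[of "\<lambda>w. - w" "{w. Re w < 0}" ?Lp "{z. Re z > 0}",
        OF holomorphic_on_minus[OF holomorphic_on_ident] P(1)]
    by (simp add: o_def image_subset_iff)
  have contp: "continuous_on {w. Re w \<le> 0} (\<lambda>w. ?Lp (- w))"
  proof -
    have "continuous_on {w. Re w \<le> 0} (?Lp \<circ> (\<lambda>w. - w))"
      by (intro continuous_on_compose continuous_on_subset[OF P(2)] continuous_intros) auto
    then show ?thesis by (simp only: o_def)
  qed
  have "H holomorphic_on UNIV"
  proof (rule holomorphic_on_paste_across_line[of UNIV 1 _ 0])
    show "H holomorphic_on UNIV \<inter> {z. 1 \<bullet> z < 0}"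
      by (rule holomorphic_transform[OF holomorphic_on_subset[OF holp]]) (auto simp: H_def)
    have "(\<lambda>w. G w - ?Lm w) holomorphic_on {z. Re z > 0}"
      by (intro holomorphic_intros hol N(1))
    then show "H holomorphic_on UNIV \<inter> {z. 0 < 1 \<bullet> z}"
      by (rule holomorphic_transform[OF holomorphic_on_subset]) (auto simp: H_def)
    have "continuous_on ({w. Re w \<le> 0} \<union> {w. 0 \<le> Re w}) H"
      unfolding H_def
    proof (rule continuous_on_If)
      show "continuous_on {w. 0 \<le> Re w} (\<lambda>w. G w - ?Lm w)"
        by (intro continuous_intros cont N(2))
      show "?Lp (- w) = G w - ?Lm w" if "w \<in> {w. Re w \<le> 0}" "\<not> Re w \<le> 0" for w using that by simp
      show "?Lp (- w) = G w - ?Lm w" if "w \<in> {w. 0 \<le> Re w}" "Re w \<le> 0" for w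
        using sum[of w] P(3)[of "- w"] N(3)[of w] eq[of w] that by (simp add: algebra_simps)
      show "continuous_on {w. Re w \<le> 0} (\<lambda>w. ?Lp (- w))" by (rule contp)
    qed (auto intro!: closed_halfspace_Re_le closed_halfspace_Re_ge)
    moreover have "{w. Re w \<le> 0} \<union> {w. 0 \<le> Re w} = UNIV" by auto
    ultimately show "continuous_on UNIV H" by simp
  qed auto
  then have "(\<lambda>w. H (- w)) holomorphic_on UNIV"
    using holomorphic_on_compose_gen[of "\<lambda>w. - w" UNIV H UNIV, OF holomorphic_on_minus[OF holomorphic_on_ident]]
    by (simp add: o_def)
  moreover have "H (- w) = ?Lp w" if "Re w > 0" for w using that by (simp add: H_def)
  ultimately have
    L: "integrable \<rho>p (\<lambda>y. exp (- w * complex_of_real y))" "H (- w) = ?Lp w" for w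
    using laplace_entire_extension[OF finp \<open>sets \<rho>p = sets borel\<close> nnp, of "\<lambda>w. H (- w)" w] by blast+
  have S: "integrable \<rho> (\<lambda>x. exp (z * complex_of_real x)) \<and>
      (\<integral>x. exp (z * complex_of_real x) \<partial>\<rho>) = ?Lp (- z) + ?Lm z"
    using L(1) N(3)[OF z] by (rule sum)
  then show "integrable \<rho> (\<lambda>x. exp (z * complex_of_real x))" by simp
  show "(\<integral>x. exp (z * complex_of_real x) \<partial>\<rho>) = G z"
  proof (cases "Re z = 0")
    case True then show ?thesis by (rule eq)
  next
    case False
    then have "H z = G z - ?Lm z" using z by (simp add: H_def)
    moreover have "H z = ?Lp (- z)" using L(2)[of "- z"] by simp
    ultimately have "?Lp (- z) + ?Lm z = G z" by (metis diff_add_cancel)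
    with S show ?thesis by (simp only:)
  qed
qed

section \<open>Bernstein functions and their entire extensions\<close>

lemma bernstein_reprD:
  assumes "bernstein_repr \<phi> d \<mu>"
  shows "Im (\<phi> 0) = 0" "0 \<le> Re (\<phi> 0)" "0 \<le> d" "sets \<mu> = sets borel" "emeasure \<mu> {..0} = 0"
    "(\<integral>\<^sup>+ y. ennreal (min 1 y) \<partial>\<mu>) < \<infinity>" "\<phi> 0 = complex_of_real (Re (\<phi> 0))"
proof -
  have "Im (\<phi> 0) = 0 \<and> 0 \<le> Re (\<phi> 0) \<and> 0 \<le> d \<and> sets \<mu> = sets borel \<and> emeasure \<mu> {..0} = 0 \<and>
    (\<integral>\<^sup>+ y. ennreal (min 1 y) \<partial>\<mu>) < \<infinity>"
    using assms unfolding bernstein_repr_def by - (elim conjE, intro conjI, assumption+)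
  then show im: "Im (\<phi> 0) = 0" and "0 \<le> Re (\<phi> 0)" "0 \<le> d" "sets \<mu> = sets borel" "emeasure \<mu> {..0} = 0"
    "(\<integral>\<^sup>+ y. ennreal (min 1 y) \<partial>\<mu>) < \<infinity>"
    by simp_all
  show "\<phi> 0 = complex_of_real (Re (\<phi> 0))" using im by (simp add: complex_eq_iff)
qed

lemma bernstein_repr_subordinator:
  assumes "bernstein_repr \<phi> d \<mu>"
  shows "subordinator_measure \<mu>"
proof -
  have "emeasure \<mu> {..<0} \<le> emeasure \<mu> {..0}"
    using bernstein_reprD[OF assms] by (intro emeasure_mono) auto
  then show ?thesis using bernstein_reprD[OF assms] by (auto simp: subordinator_measure_def)
qed

lemma bernstein_repr_AE_pos:
  assumes "bernstein_repr \<phi> d \<mu>"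
  shows "AE y in \<mu>. 0 < y"
proof (rule AE_I[where N = "{..0}"])
  show "{x \<in> space \<mu>. \<not> 0 < x} \<subseteq> {..0}" by auto
qed (use bernstein_reprD[OF assms] in auto)

lemma bernstein_repr_eq:
  assumes "bernstein_repr \<phi> d \<mu>" "Re z \<ge> 0"
  shows "\<phi> z = \<phi> 0 + complex_of_real d * z + (\<integral>y. (1 - exp (- z * complex_of_real y)) \<partial>\<mu>)"
  using assms unfolding bernstein_repr_def by blast

lemma bernstein_continuous_on:
  assumes "bernstein_repr \<phi> d \<mu>"
  shows "continuous_on {z. Re z \<ge> 0} \<phi>"
proof -
  have "continuous_on {z. Re z \<ge> 0}
     (\<lambda>z. \<phi> 0 + complex_of_real d * z + (\<integral>y. (1 - exp (- z * complex_of_real y)) \<partial>\<mu>))"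
    by (intro continuous_intros continuous_on_bernstein_integral bernstein_repr_subordinator[OF assms])
  then show ?thesis
    by (subst continuous_on_cong[OF refl bernstein_repr_eq[OF assms]]) auto
qed

lemma bernstein_holomorphic_on:
  assumes "bernstein_repr \<phi> d \<mu>"
  shows "\<phi> holomorphic_on {z. Re z > 0}"
proof -
  have "(\<lambda>z. \<phi> 0 + complex_of_real d * z + (\<integral>y. (1 - exp (- z * complex_of_real y)) \<partial>\<mu>))
     holomorphic_on {z. Re z > 0}"
    by (intro holomorphic_intros holomorphic_on_bernstein_integral bernstein_repr_subordinator[OF assms])
  then show ?thesis
    by (subst holomorphic_cong[OF refl bernstein_repr_eq[OF assms]]) auto
qed

lemma bernstein_of_real:
  assumes "bernstein_repr \<phi> d \<mu>" "u \<ge> 0"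
  shows "\<phi> (complex_of_real u) =
           complex_of_real (Re (\<phi> 0) + d * u + (\<integral>y. (1 - exp (- (u * y))) \<partial>\<mu>))"
    and "integrable \<mu> (\<lambda>y. 1 - exp (- (u * y)))"
proof -
  have eq: "(1 - exp (- complex_of_real u * complex_of_real y)) = complex_of_real (1 - exp (- (u * y)))" for y
    by (simp add: exp_of_real[symmetric])
  have "\<phi> 0 = complex_of_real (Re (\<phi> 0))"
    by (rule bernstein_reprD(7)[OF assms(1)])
  moreover have "(\<integral>y. (1 - exp (- complex_of_real u * complex_of_real y)) \<partial>\<mu>) =
      complex_of_real (\<integral>y. (1 - exp (- (u * y))) \<partial>\<mu>)"
    unfolding eq by (rule integral_complex_of_real)
  ultimately show "\<phi> (complex_of_real u) =
           complex_of_real (Re (\<phi> 0) + d * u + (\<integral>y. (1 - exp (- (u * y))) \<partial>\<mu>))"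
    using bernstein_repr_eq[OF assms(1), of "complex_of_real u"] assms(2) by simp
  have "integrable \<mu> (\<lambda>y. complex_of_real (1 - exp (- (u * y))))"
    using integrable_one_minus_exp[OF bernstein_repr_subordinator[OF assms(1)], of "complex_of_real u"] assms(2)
    unfolding eq by simp
  then show "integrable \<mu> (\<lambda>y. 1 - exp (- (u * y)))"
    using complex_of_real_integrable_eq by blast
qed

lemma bernstein_Re_mono:
  assumes "bernstein_repr \<phi> d \<mu>" "0 \<le> u" "u \<le> v"
  shows "Re (\<phi> (complex_of_real u)) \<le> Re (\<phi> (complex_of_real v))"
proof -
  have "(\<integral>y. (1 - exp (- (u * y))) \<partial>\<mu>) \<le> (\<integral>y. (1 - exp (- (v * y))) \<partial>\<mu>)"
  proof (rule integral_mono_AE)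
    show "AE y in \<mu>. 1 - exp (- (u * y)) \<le> 1 - exp (- (v * y))"
      using bernstein_repr_AE_pos[OF assms(1)] by eventually_elim (use assms in \<open>simp add: mult_right_mono\<close>)
  qed (use bernstein_of_real[OF assms(1)] assms in auto)
  moreover have "d * u \<le> d * v" using bernstein_reprD(3)[OF assms(1)] assms(3) by (rule mult_left_mono[rotated])
  ultimately show ?thesis
    using bernstein_of_real(1)[OF assms(1)] assms by simp
qed

lemma bernstein_at_infinity_tendsto:
  assumes "bernstein_repr \<phi> d \<mu>"
  shows "((\<lambda>u. ereal (Re (\<phi> (complex_of_real u)))) \<longlongrightarrow> bernstein_at_infinity \<phi>) at_top"
proof -
  define f where "f u = ereal (Re (\<phi> (complex_of_real u)))" for u
  have mono: "f u \<le> f v" if "0 \<le> u" "u \<le> v" for u v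
    unfolding f_def using bernstein_Re_mono[OF assms that] by simp
  have "(f \<longlongrightarrow> (SUP u\<in>{0..}. f u)) at_top"
  proof (rule increasing_tendsto)
    show "\<forall>\<^sub>F u in at_top. f u \<le> (SUP u\<in>{0..}. f u)"
      using eventually_ge_at_top[of 0] by eventually_elim (auto intro!: SUP_upper)
    fix x assume "x < (SUP u\<in>{0..}. f u)"
    then obtain u where u: "u \<ge> 0" "x < f u" by (auto simp: less_SUP_iff)
    show "\<forall>\<^sub>F u in at_top. x < f u"
      using eventually_ge_at_top[of u]
      by eventually_elim (use u mono[of u] in \<open>auto intro: less_le_trans\<close>)
  qed
  then have "bernstein_at_infinity \<phi> = (SUP u\<in>{0..}. f u)"
    unfolding bernstein_at_infinity_def f_def by (intro tendsto_Lim) auto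
  with \<open>(f \<longlongrightarrow> (SUP u\<in>{0..}. f u)) at_top\<close> show ?thesis by (simp add: f_def[abs_def])
qed

text \<open>The jump part is \<open>o(k)\<close> by dominated convergence, as \<open>(1 - exp (- k y)) / (k + 1) \<le> min 1 y\<close>.\<close>

lemma bernstein_drift_limit:
  assumes "bernstein_repr \<phi> d \<mu>"
  shows "(\<lambda>k. Re (\<phi> (of_nat k)) / (real k + 1)) \<longlonglongrightarrow> d"
proof -
  note sub = bernstein_repr_subordinator[OF assms]
  note [measurable_cong] = subordinator_measure_sets[OF sub]
  have "(\<lambda>k. \<integral>y. (1 - exp (- (real k * y))) / (real k + 1) \<partial>\<mu>) \<longlonglongrightarrow> (\<integral>y. 0 \<partial>\<mu>)"
  proof (rule integral_dominated_convergence[where w = "\<lambda>y. min 1 y"])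
    show "AE y in \<mu>. (\<lambda>k. (1 - exp (- (real k * y))) / (real k + 1)) \<longlonglongrightarrow> 0"
      using bernstein_repr_AE_pos[OF assms]
    proof eventually_elim
      case (elim y)
      then show ?case by real_asymp
    qed
    fix k
    show "AE y in \<mu>. norm ((1 - exp (- (real k * y))) / (real k + 1)) \<le> min 1 y"
      using bernstein_repr_AE_pos[OF assms]
    proof eventually_elim
      case (elim y)
      have 0: "0 \<le> 1 - exp (- (real k * y))" using elim by simp
      have 1: "1 - exp (- (real k * y)) \<le> real k * y"
        using exp_ge_add_one_self[of "- (real k * y)"] by linarith
      have 2: "1 - exp (- (real k * y)) \<le> 1" by simp
      have "1 - exp (- (real k * y)) \<le> min 1 y * (real k + 1)"
      proof (cases "y \<le> 1")
        case True
        then have "min 1 y * (real k + 1) = real k * y + y" by (simp add: algebra_simps)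
        with 1 elim show ?thesis by linarith
      next
        case False
        then have "min 1 y * (real k + 1) = real k + 1" by simp
        with 2 show ?thesis by linarith
      qed
      then have "(1 - exp (- (real k * y))) / (real k + 1) \<le> min 1 y"
        by (intro pos_divide_le_eq[THEN iffD2]) auto
      moreover have "norm ((1 - exp (- (real k * y))) / (real k + 1)) = (1 - exp (- (real k * y))) / (real k + 1)"
        using 0 by simp
      ultimately show ?case by linarith
    qed
  qed (use integrable_min[OF sub] in simp_all)
  then have 1: "(\<lambda>k. (\<integral>y. (1 - exp (- (real k * y))) \<partial>\<mu>) / (real k + 1)) \<longlonglongrightarrow> 0" by simp
  have 2: "(\<lambda>k. (Re (\<phi> 0) + d * real k) / (real k + 1)) \<longlonglongrightarrow> d" by real_asymp
  have "(\<lambda>k. (Re (\<phi> 0) + d * real k) / (real k + 1) +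
      (\<integral>y. (1 - exp (- (real k * y))) \<partial>\<mu>) / (real k + 1)) \<longlonglongrightarrow> d"
    using tendsto_add[OF 2 1] by simp
  moreover have "Re (\<phi> (of_nat k)) / (real k + 1) = (Re (\<phi> 0) + d * real k) / (real k + 1) +
      (\<integral>y. (1 - exp (- (real k * y))) \<partial>\<mu>) / (real k + 1)" for k
    using bernstein_of_real(1)[OF assms, of "real k"] by (simp add: add_divide_distrib)
  ultimately show ?thesis by simp
qed

text \<open>The definite description in the definition of the extension is justified by the identity theorem on the
common half-plane of two extensions, both of which agree with \<open>\<phi>\<close> on \<open>Re z > 0\<close>.\<close>

lemma bernstein_ext_eq:
  assumes "holomorphic_extension \<phi> u g" "u < 0" "u < Re z"
  shows "bernstein_ext \<phi> z = g z"
proof (cases "Re z \<ge> 0")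
  case True
  then show ?thesis using assms by (simp add: bernstein_ext_def holomorphic_extension_def)
next
  case False
  have uniq: "g' z = g z" if g': "v < 0" "v < Re z" "holomorphic_extension \<phi> v g'" for v g'
  proof (rule analytic_continuation_open[where f = g' and g = g
        and s = "{z. Re z > 0}" and s' = "{z. Re z > max u v}"])
    show "{z::complex. Re z > 0} \<noteq> {}" by (auto intro!: exI[of _ 1])
    show "connected {z. max u v < Re z}"
      by (intro convex_connected convex_halfspace_Re_gt)
    show "g' holomorphic_on {z. max u v < Re z}" "g holomorphic_on {z. max u v < Re z}"
      using g'(3) assms(1) by (auto simp: holomorphic_extension_def elim: holomorphic_on_subset)
    show "g' z = g z" if "z \<in> {z. Re z > 0}" for z
      using that g'(3) assms(1) by (simp add: holomorphic_extension_def)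
    show "open {z. max u v < Re z}" "open {z. Re z > 0}" by (rule open_halfspace_Re_gt)+
  qed (use assms g' in auto)
  have "(THE w. \<exists>u g. u < 0 \<and> u < Re z \<and> holomorphic_extension \<phi> u g \<and> w = g z) = g z"
    using assms uniq by (intro the_equality) blast+
  then show ?thesis using False by (simp add: bernstein_ext_def)
qed

lemma bernstein_ext_entire:
  assumes "\<bar>holo_abscissa \<phi>\<bar> = \<infinity>"
  shows "bernstein_ext \<phi> holomorphic_on UNIV" and "holo_abscissa \<phi> = - \<infinity>"
proof -
  define S where "S = {ereal u | u. u < 0 \<and> (\<exists>g. holomorphic_extension \<phi> u g)}"
  have "S \<noteq> {}" using assms unfolding holo_abscissa_def S_def[symmetric] Let_def by auto
  then have eq: "holo_abscissa \<phi> = Inf S" unfolding holo_abscissa_def S_def[symmetric] Let_def by simp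
  from \<open>S \<noteq> {}\<close> obtain u where "ereal u \<in> S" by (auto simp: S_def)
  then have "Inf S \<le> ereal u" by (rule Inf_lower)
  with assms eq show inf: "holo_abscissa \<phi> = - \<infinity>" by (cases "Inf S") auto
  show "bernstein_ext \<phi> holomorphic_on UNIV"
    unfolding holomorphic_on_def
  proof
    fix z
    have "Inf S < ereal (min (Re z) 0)" using inf eq by simp
    then obtain u g where u: "u < min (Re z) 0" "u < 0" "holomorphic_extension \<phi> u g"
      unfolding Inf_less_iff S_def by auto
    have op: "open {z. u < Re z}" by (rule open_halfspace_Re_gt)
    have "g field_differentiable at z"
      using u op by (auto simp: holomorphic_extension_def intro!: holomorphic_on_imp_differentiable_at)
    moreover have "eventually (\<lambda>w. w \<in> {z. u < Re z}) (nhds z)"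
      using u op by (intro eventually_nhds_in_open) auto
    then have "eventually (\<lambda>w. bernstein_ext \<phi> w = g w) (nhds z)"
      by eventually_elim (use bernstein_ext_eq[OF u(3,2)] in auto)
    ultimately show "bernstein_ext \<phi> field_differentiable at z within UNIV"
      using DERIV_cong_ev[OF refl _ refl, of "bernstein_ext \<phi>" g z]
      unfolding field_differentiable_def by auto
  qed
qed

text \<open>The increment \<open>\<phi>(z + u) - \<phi>(z) - d u\<close> is the Laplace transform of the finite measure
\<open>(1 - exp (- u y)) \<mu>(dy)\<close>.  It is entire together with \<open>\<phi>\<close>, so that measure has all exponential moments; evaluating the
identity at \<open>z = - u\<close> gives the value of \<open>\<phi>\<close> there.\<close>

lemma bernstein_ext_neg:
  assumes rep: "bernstein_repr \<phi> d \<mu>" and inf: "\<bar>holo_abscissa \<phi>\<bar> = \<infinity>" and u: "u \<ge> 0"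
  shows "integrable \<mu> (\<lambda>y. exp (u * y) - 1)"
    and "bernstein_ext \<phi> (- complex_of_real u) =
           complex_of_real (Re (\<phi> 0) - d * u - (\<integral>y. (exp (u * y) - 1) \<partial>\<mu>))"
proof -
  note sub = bernstein_repr_subordinator[OF rep]
  have phi0: "\<phi> 0 = complex_of_real (Re (\<phi> 0))"
    by (rule bernstein_reprD(7)[OF rep])
  note [measurable_cong] = subordinator_measure_sets[OF sub]
  let ?E = "bernstein_ext \<phi>"
  have hol: "?E holomorphic_on A" for A
    using bernstein_ext_entire(1)[OF inf] by (rule holomorphic_on_subset) simp
  define \<rho> where "\<rho> = density \<mu> (\<lambda>y. ennreal (1 - exp (- (u * y))))"
  have nn: "AE y in \<mu>. 0 \<le> 1 - exp (- (u * y))"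
    using subordinator_measure_AE[OF sub] by eventually_elim (use u in simp)
  have setsr [measurable_cong]: "sets \<rho> = sets borel" by (simp add: \<rho>_def subordinator_measure_sets[OF sub])
  have nonneg: "AE y in \<rho>. 0 \<le> y"
    unfolding \<rho>_def by (subst AE_density) (use subordinator_measure_AE[OF sub] in \<open>auto elim: eventually_mono\<close>)
  have fin: "finite_measure \<rho>"
  proof
    have "emeasure \<rho> (space \<rho>) = (\<integral>\<^sup>+y. ennreal (1 - exp (- (u * y))) \<partial>\<mu>)"
      by (simp add: \<rho>_def emeasure_density)
    also have "\<dots> = ennreal (\<integral>y. (1 - exp (- (u * y))) \<partial>\<mu>)"
      using bernstein_of_real(2)[OF rep u] nn by (intro nn_integral_eq_integral)
    finally show "emeasure \<rho> (space \<rho>) \<noteq> \<infinity>" by simp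
  qed
  define g where "g z = ?E (z + complex_of_real u) - ?E z - complex_of_real (d * u)" for z
  have "(\<lambda>z. ?E (z + complex_of_real u)) holomorphic_on UNIV"
    using holomorphic_on_compose_gen[of "\<lambda>z. z + complex_of_real u" UNIV ?E UNIV] hol
    by (simp add: o_def holomorphic_intros)
  then have holg: "g holomorphic_on UNIV"
    unfolding g_def by (intro holomorphic_intros hol)
  have geq: "g z = (\<integral>y. exp (- z * complex_of_real y) \<partial>\<rho>)" if z: "Re z > 0" for z
  proof -
    have ext: "?E w = \<phi> w" if "Re w \<ge> 0" for w using that by (simp add: bernstein_ext_def)
    have z1: "Re (z + complex_of_real u) \<ge> 0" and z2: "Re z \<ge> 0" using z u by auto
    have "g z = (\<integral>y. (1 - exp (- (z + complex_of_real u) * complex_of_real y)) \<partial>\<mu>) -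
                (\<integral>y. (1 - exp (- z * complex_of_real y)) \<partial>\<mu>)"
      unfolding g_def ext[OF z1] ext[OF z2] bernstein_repr_eq[OF rep z1] bernstein_repr_eq[OF rep z2]
      by (simp add: algebra_simps)
    also have "\<dots> = (\<integral>y. ((1 - exp (- (z + complex_of_real u) * complex_of_real y)) -
                (1 - exp (- z * complex_of_real y))) \<partial>\<mu>)"
      by (intro Bochner_Integration.integral_diff[symmetric] integrable_one_minus_exp sub z1 z2)
    also have "\<dots> = (\<integral>y. (1 - exp (- (u * y))) *\<^sub>R exp (- z * complex_of_real y) \<partial>\<mu>)"
      by (intro Bochner_Integration.integral_cong)
        (simp_all add: scaleR_conv_of_real exp_of_real[symmetric] algebra_simps exp_add[symmetric])
    also have "\<dots> = (\<integral>y. exp (- z * complex_of_real y) \<partial>\<rho>)"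
      unfolding \<rho>_def by (intro integral_density[symmetric] nn) measurable
    finally show ?thesis .
  qed
  note L = laplace_entire_extension[OF fin setsr nonneg holg geq, of "- complex_of_real u"]
  have e: "exp (- (- complex_of_real u) * complex_of_real y) = complex_of_real (exp (u * y))" for y
    by (simp add: exp_of_real[symmetric])
  have p: "(1 - exp (- (u * y))) *\<^sub>R exp (u * y) = exp (u * y) - 1" for y
    by (simp add: algebra_simps exp_add[symmetric])
  have "integrable \<rho> (\<lambda>y. exp (u * y))"
    using L(1) unfolding e complex_of_real_integrable_eq .
  then show int: "integrable \<mu> (\<lambda>y. exp (u * y) - 1)"
    unfolding \<rho>_def by (subst (asm) integrable_density) (use nn in \<open>auto simp: p[simplified]\<close>)
  have "?E 0 - ?E (- complex_of_real u) - complex_of_real (d * u) = (\<integral>y. complex_of_real (exp (u * y)) \<partial>\<rho>)"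
    using L(2) unfolding e by (simp add: g_def)
  also have "\<dots> = complex_of_real (\<integral>y. exp (u * y) \<partial>\<rho>)" by (rule integral_complex_of_real)
  also have "(\<integral>y. exp (u * y) \<partial>\<rho>) = (\<integral>y. (exp (u * y) - 1) \<partial>\<mu>)"
    unfolding \<rho>_def by (subst integral_density) (use nn in \<open>auto simp: p[simplified]\<close>)
  finally have "?E (- complex_of_real u) = ?E 0 - complex_of_real (d * u) - complex_of_real (\<integral>y. (exp (u * y) - 1) \<partial>\<mu>)"
    by (simp add: algebra_simps)
  also have "?E 0 = complex_of_real (Re (\<phi> 0))" using phi0 by (simp add: bernstein_ext_def)
  finally show "?E (- complex_of_real u) =
           complex_of_real (Re (\<phi> 0) - d * u - (\<integral>y. (exp (u * y) - 1) \<partial>\<mu>))" by simp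
qed

text \<open>On the negative half-line \<open>\<phi>\<close> increases strictly unless it is constant, and a constant \<open>\<phi>\<close> equals
\<open>\<phi>(0) > 0\<close>.\<close>

lemma bernstein_ext_zero_unique:
  assumes rep: "bernstein_repr \<phi> d \<mu>" and inf: "\<bar>holo_abscissa \<phi>\<bar> = \<infinity>"
    and pos: "Re (\<phi> 0) > 0"
    and u: "0 \<le> u" "u < v"
    and zu: "bernstein_ext \<phi> (- complex_of_real u) = 0"
  shows "bernstein_ext \<phi> (- complex_of_real v) \<noteq> 0"
proof
  note sub = bernstein_repr_subordinator[OF rep]
  note [measurable_cong] = subordinator_measure_sets[OF sub]
  assume zv: "bernstein_ext \<phi> (- complex_of_real v) = 0"
  let ?I = "\<lambda>u. \<integral>y. (exp (u * y) - 1) \<partial>\<mu>"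
  note int = bernstein_ext_neg(1)[OF rep inf]
  have v: "0 \<le> v" using u by simp
  have d: "d \<ge> 0" using bernstein_reprD(3)[OF rep] by simp
  have eu: "Re (\<phi> 0) - d * u - ?I u = 0" and ev: "Re (\<phi> 0) - d * v - ?I v = 0"
    using bernstein_ext_neg(2)[OF rep inf u(1)] bernstein_ext_neg(2)[OF rep inf v] zu zv
    by (metis of_real_eq_0_iff)+
  have diff: "?I v - ?I u = (\<integral>y. (exp (v * y) - exp (u * y)) \<partial>\<mu>)"
    using Bochner_Integration.integral_diff[OF int[OF v] int[OF u(1)]] by simp
  have nn: "AE y in \<mu>. 0 \<le> exp (v * y) - exp (u * y)"
    using bernstein_repr_AE_pos[OF rep] by eventually_elim (use u in simp)
  have "0 \<le> (\<integral>y. (exp (v * y) - exp (u * y)) \<partial>\<mu>)" using nn by (rule integral_nonneg_AE)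
  moreover have sum0: "d * (v - u) + (\<integral>y. (exp (v * y) - exp (u * y)) \<partial>\<mu>) = 0"
    using eu ev diff by (simp add: algebra_simps)
  moreover have "0 \<le> d * (v - u)" using d u by simp
  ultimately have "d * (v - u) = 0" and int0: "(\<integral>y. (exp (v * y) - exp (u * y)) \<partial>\<mu>) = 0" by linarith+
  then have d0: "d = 0" using u by simp
  have "integrable \<mu> (\<lambda>y. exp (v * y) - exp (u * y))"
    using Bochner_Integration.integrable_diff[OF int[OF v] int[OF u(1)]] by simp
  then have "AE y in \<mu>. exp (v * y) - exp (u * y) = 0"
    using int0 integral_nonneg_eq_0_iff_AE nn by blast
  then have "AE y in \<mu>. False"
    using bernstein_repr_AE_pos[OF rep] by eventually_elim (use u in simp)
  then have "?I u = (\<integral>y. 0 \<partial>\<mu>)" 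
  proof (intro integral_cong_AE)
    show "AE y in \<mu>. exp (u * y) - 1 = 0" using \<open>AE y in \<mu>. False\<close> by eventually_elim simp
  qed simp_all
  with eu d0 pos show False by simp
qed

text \<open>A zero at \<open>- j\<close> would be the only zero on the negative half-line, hence equal to the supremum that defines
\<open>bernstein_zero\<close>.\<close>

lemma bernstein_ext_neg_nat_nonzero:
  assumes rep: "bernstein_repr \<phi> d \<mu>" and inf: "\<bar>holo_abscissa \<phi>\<bar> = \<infinity>"
    and pos: "Re (\<phi> 0) > 0"
    and nz: "- bernstein_zero \<phi> \<notin> range (\<lambda>n::nat. ereal (real n))"
  shows "bernstein_ext \<phi> (- of_nat j) \<noteq> 0"
proof
  assume z: "bernstein_ext \<phi> (- of_nat j) = 0"
  have "{ereal u | u. holo_abscissa \<phi> \<le> ereal u \<and> u \<le> 0 \<and>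
       (if holo_abscissa \<phi> < ereal u then bernstein_ext \<phi> (complex_of_real u) = 0
        else ((\<lambda>x. bernstein_ext \<phi> (complex_of_real x)) \<longlongrightarrow> 0) (at_right u))}
     = {ereal (- real j)}" (is "?S = _")
  proof -
    have "?S = {ereal u | u. u \<le> 0 \<and> bernstein_ext \<phi> (complex_of_real u) = 0}"
      using bernstein_ext_entire(2)[OF inf] by auto
    also have "\<dots> = {ereal (- real j)}"
    proof -
      have "u = - real j" if "u \<le> 0" "bernstein_ext \<phi> (complex_of_real u) = 0" for u
        using bernstein_ext_zero_unique[OF rep inf pos, of "- u" "real j"]
          bernstein_ext_zero_unique[OF rep inf pos, of "real j" "- u"] that z
        by (cases u "- real j" rule: linorder_cases) auto
      then show ?thesis using z by auto
    qed
    finally show ?thesis .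
  qed
  then have "bernstein_zero \<phi> = ereal (- real j)" unfolding bernstein_zero_def by simp
  with nz show False by auto
qed

text \<open>Jumps make \<open>- \<phi>(- j)\<close> grow at least quadratically, since \<open>exp w - 1 \<ge> w\<^sup>2 / 2\<close>; the
growth is in fact exponential, but a superlinear bound suffices for the ratio test.\<close>

lemma bernstein_ext_neg_growth:
  assumes rep: "bernstein_repr \<phi> d \<mu>" and inf: "\<bar>holo_abscissa \<phi>\<bar> = \<infinity>"
    and nontrivial: "\<not> (AE y in \<mu>. False)"
  shows "filterlim (\<lambda>j. norm (bernstein_ext \<phi> (- of_nat j)) / (real j + 1)) at_top sequentially"
proof -
  note sub = bernstein_repr_subordinator[OF rep]
  note [measurable_cong] = subordinator_measure_sets[OF sub]
  define C where "C = (\<integral>y. (min 1 y)\<^sup>2 \<partial>\<mu>)"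
  have intC: "integrable \<mu> (\<lambda>y. (min 1 y)\<^sup>2)"
  proof (rule Bochner_Integration.integrable_bound[OF integrable_min[OF sub]])
    show "AE y in \<mu>. norm ((min 1 y)\<^sup>2) \<le> norm (min 1 y)"
      using subordinator_measure_AE[OF sub]
      by eventually_elim (auto simp: power2_eq_square min_def mult_left_le)
  qed measurable
  have "C \<noteq> 0"
  proof
    assume "C = 0"
    then have "AE y in \<mu>. (min 1 y)\<^sup>2 = 0"
      unfolding C_def using integral_nonneg_eq_0_iff_AE[OF intC] by simp
    then have "AE y in \<mu>. False"
      using bernstein_repr_AE_pos[OF rep] by eventually_elim (auto simp: min_def split: if_splits)
    with nontrivial show False by simp
  qed
  moreover have "C \<ge> 0" unfolding C_def by simp
  ultimately have C: "C > 0" by simp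
  have le: "norm (bernstein_ext \<phi> (- of_nat j)) / (real j + 1) \<ge> (real j ^ 2 / 2 * C - Re (\<phi> 0)) / (real j + 1)" for j
  proof -
    have "real j ^ 2 / 2 * C = (\<integral>y. real j ^ 2 / 2 * (min 1 y)\<^sup>2 \<partial>\<mu>)" by (simp add: C_def)
    also have "\<dots> \<le> (\<integral>y. (exp (real j * y) - 1) \<partial>\<mu>)"
    proof (rule integral_mono_AE)
      show "AE y in \<mu>. (real j)\<^sup>2 / 2 * (min 1 y)\<^sup>2 \<le> exp (real j * y) - 1"
        using bernstein_repr_AE_pos[OF rep]
      proof eventually_elim
        case (elim y)
        have "(min 1 y)\<^sup>2 \<le> y\<^sup>2" using elim by (intro power_mono) auto
        then have "(real j)\<^sup>2 / 2 * (min 1 y)\<^sup>2 \<le> (real j * y)\<^sup>2 / 2"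
          by (simp add: power_mult_distrib mult_left_mono)
        also have "\<dots> \<le> exp (real j * y) - 1"
          using exp_lower_Taylor_quadratic[of "real j * y"] mult_nonneg_nonneg[of "real j" y] elim by linarith
        finally show ?case .
      qed
    qed (use intC bernstein_ext_neg(1)[OF rep inf, of "real j"] in auto)
    also have "\<dots> \<le> Re (\<phi> 0) + norm (bernstein_ext \<phi> (- of_nat j))"
    proof -
      have "d * real j \<ge> 0" using bernstein_reprD(3)[OF rep] by simp
      moreover have "norm (bernstein_ext \<phi> (- of_nat j)) =
         \<bar>Re (\<phi> 0) - d * real j - (\<integral>y. (exp (real j * y) - 1) \<partial>\<mu>)\<bar>"
        using bernstein_ext_neg(2)[OF rep inf, of "real j"] by (simp only: of_real_of_nat_eq norm_of_real of_nat_0_le_iff simp_thms)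
      ultimately show ?thesis by linarith
    qed
    finally show ?thesis by (intro divide_right_mono) auto
  qed
  have "filterlim (\<lambda>j. (real j ^ 2 / 2 * C - Re (\<phi> 0)) / (real j + 1)) at_top sequentially"
    using C by real_asymp
  then show ?thesis
    by (rule filterlim_at_top_mono) (use le in auto)
qed

section \<open>Radius of convergence of the expansion\<close>

lemma expansion_term_ratio:
  "expansion_coeff \<phi>p \<phi>m (Suc (Suc k)) * complex_of_real x ^ Suc (Suc k) =
     expansion_coeff \<phi>p \<phi>m (Suc k) * complex_of_real x ^ Suc k *
       (exponent_ext \<phi>p \<phi>m (of_nat (Suc k)) / of_nat (Suc (Suc k)) * complex_of_real x)"
proof -
  have "{1..<Suc (Suc k)} = insert (Suc k) {1..<Suc k}" by auto
  then have "(\<Prod>j\<in>{1..<Suc (Suc k)}. exponent_ext \<phi>p \<phi>m (of_nat j)) =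
      exponent_ext \<phi>p \<phi>m (of_nat (Suc k)) * (\<Prod>j\<in>{1..<Suc k}. exponent_ext \<phi>p \<phi>m (of_nat j))"
    by simp
  moreover have "e * P / (n * f) * (y * p) = P / f * p * (e / n * y)" for e P n f y p :: complex
    by (simp add: mult_ac)
  ultimately show ?thesis
    unfolding expansion_coeff_def fact_Suc[of "Suc k"] power_Suc[of _ "Suc k"] by (simp only:)
qed

lemma norm_expansion_ratio:
  assumes "x > 0"
  shows "norm (exponent_ext \<phi>p \<phi>m (of_nat (Suc k)) / of_nat (Suc (Suc k)) * complex_of_real x) =
    norm (exponent_ext \<phi>p \<phi>m (of_nat (Suc k))) / (real (Suc k) + 1) * x"
proof -
  have "norm (of_nat (Suc (Suc k)) :: complex) = real (Suc (Suc k))" by (rule norm_of_nat)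
  then have "norm (of_nat (Suc (Suc k)) :: complex) = real (Suc k) + 1" by simp
  then show ?thesis using assms by (simp only: norm_mult norm_divide norm_of_real abs_of_pos)
qed

lemma expansion_convergesI:
  assumes lim: "(\<lambda>j. norm (exponent_ext \<phi>p \<phi>m (of_nat j)) / (real j + 1)) \<longlonglongrightarrow> L"
    and x: "x > 0" "x * L < 1"
  shows "expansion_converges \<Psi> \<phi>p \<phi>m x"
proof -
  obtain r where r1: "x * L < r" and r2: "r < 1" using dense[OF x(2)] by blast
  have "(\<lambda>j. norm (exponent_ext \<phi>p \<phi>m (of_nat (Suc j))) / (real (Suc j) + 1) * x) \<longlonglongrightarrow> L * x"
    by (intro tendsto_mult LIMSEQ_Suc[OF lim] tendsto_const)
  then have "eventually (\<lambda>j. norm (exponent_ext \<phi>p \<phi>m (of_nat (Suc j))) / (real (Suc j) + 1) * x < r) sequentially"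
    by (rule order_tendstoD(2)) (use r1 in \<open>simp only: mult.commute[of L x]\<close>)
  then obtain N where N: "\<And>j. j \<ge> N \<Longrightarrow> norm (exponent_ext \<phi>p \<phi>m (of_nat (Suc j))) / (real (Suc j) + 1) * x < r"
    by (auto simp: eventually_sequentially)
  have "summable (\<lambda>k. expansion_coeff \<phi>p \<phi>m (Suc k) * complex_of_real x ^ Suc k)"
  proof (rule summable_ratio_test[OF r2])
    fix k assume "k \<ge> N"
    define t where "t = expansion_coeff \<phi>p \<phi>m (Suc k) * complex_of_real x ^ Suc k"
    have "norm (exponent_ext \<phi>p \<phi>m (of_nat (Suc k)) / of_nat (Suc (Suc k)) * complex_of_real x) \<le> r"
      unfolding norm_expansion_ratio[OF x(1)] using N[OF \<open>k \<ge> N\<close>] by (rule less_imp_le)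
    then have "norm t * norm (exponent_ext \<phi>p \<phi>m (of_nat (Suc k)) / of_nat (Suc (Suc k)) * complex_of_real x)
       \<le> norm t * r" by (rule mult_left_mono) simp
    then show "norm (expansion_coeff \<phi>p \<phi>m (Suc (Suc k)) * complex_of_real x ^ Suc (Suc k)) \<le>
        r * norm (expansion_coeff \<phi>p \<phi>m (Suc k) * complex_of_real x ^ Suc k)"
      unfolding expansion_term_ratio t_def[symmetric] norm_mult[of t] by (simp add: mult.commute)
  qed
  then show ?thesis unfolding expansion_converges_def by (rule summable_mult)
qed

text \<open>If the ratios are eventually at least \<open>1\<close>, the moduli of the terms are eventually nondecreasing and, being nonzero,
do not tend to \<open>0\<close>.\<close>

lemma expansion_not_convergesI:
  assumes ev: "eventually (\<lambda>j. 1 \<le> norm (exponent_ext \<phi>p \<phi>m (of_nat j)) / (real j + 1) * x) sequentially"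
    and nz: "\<And>j. exponent_ext \<phi>p \<phi>m (of_nat j) \<noteq> 0"
    and x: "x > 0" and Psi: "\<Psi> 0 \<noteq> 0"
  shows "\<not> expansion_converges \<Psi> \<phi>p \<phi>m x"
proof
  assume "expansion_converges \<Psi> \<phi>p \<phi>m x"
  define t where "t k = expansion_coeff \<phi>p \<phi>m (Suc k) * complex_of_real x ^ Suc k" for k
  have "summable t"
    using summable_mult_D[of "- \<Psi> 0" t] \<open>expansion_converges \<Psi> \<phi>p \<phi>m x\<close> Psi
    unfolding expansion_converges_def t_def by simp
  then have t0: "t \<longlonglongrightarrow> 0" by (rule summable_LIMSEQ_zero)
  have tnz: "t k \<noteq> 0" for k
    unfolding t_def expansion_coeff_def using nz x by (simp del: fact_Suc of_nat_Suc)
  obtain N where N: "\<And>j. j \<ge> N \<Longrightarrow> 1 \<le> norm (exponent_ext \<phi>p \<phi>m (of_nat j)) / (real j + 1) * x"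
    using ev by (auto simp: eventually_sequentially)
  have step: "norm (t k) \<le> norm (t (Suc k))" if "k \<ge> N" for k
  proof -
    have "1 \<le> norm (exponent_ext \<phi>p \<phi>m (of_nat (Suc k)) / of_nat (Suc (Suc k)) * complex_of_real x)"
      unfolding norm_expansion_ratio[OF x] using N[of "Suc k"] that by (simp only: le_SucI)
    then have "norm (t k) * 1 \<le> norm (t k) *
       norm (exponent_ext \<phi>p \<phi>m (of_nat (Suc k)) / of_nat (Suc (Suc k)) * complex_of_real x)"
      by (rule mult_left_mono) simp
    then show ?thesis unfolding t_def expansion_term_ratio norm_mult by simp
  qed
  have "norm (t N) \<le> norm (t k)" if "k \<ge> N" for k
    using that by (induction k rule: dec_induct) (auto intro: order_trans step)
  then have "norm (t N) \<le> 0"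
    by (intro tendsto_lowerbound[OF tendsto_norm_zero[OF t0] eventually_sequentiallyI]) auto
  with tnz[of N] show False by simp
qed

lemma less_reciprocal_ereal_iff:
  assumes "L \<ge> 0" "x > 0"
  shows "ereal x < 1 / ereal L \<longleftrightarrow> x * L < 1" "ereal x > 1 / ereal L \<longleftrightarrow> x * L > 1"
proof -
  have eq: "1 / ereal L = (if L = 0 then \<infinity> else ereal (1 / L))"
    unfolding divide_ereal_def inverse_ereal.simps by (simp add: inverse_eq_divide)
  show "ereal x < 1 / ereal L \<longleftrightarrow> x * L < 1" "ereal x > 1 / ereal L \<longleftrightarrow> x * L > 1"
    unfolding eq using assms pos_less_divide_eq[of L x 1] pos_divide_less_eq[of L 1 x] by auto
qed

locale killed_factors =
  fixes \<phi>p \<phi>m :: "complex \<Rightarrow> complex" and dp dm :: real and \<mu>p \<mu>m :: "real measure"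
  assumes rep_p: "bernstein_repr \<phi>p dp \<mu>p" and rep_m: "bernstein_repr \<phi>m dm \<mu>m"
    and pos_p: "Re (\<phi>p 0) > 0" and pos_m: "Re (\<phi>m 0) > 0"
    and entire: "\<bar>holo_abscissa \<phi>p\<bar> = \<infinity>"
begin

lemma norm_exponent_ext:
  "norm (exponent_ext \<phi>p \<phi>m (of_nat j)) =
     norm (bernstein_ext \<phi>p (- of_nat j)) * Re (\<phi>m (of_nat j))"
  and Re_phi_m_ge: "Re (\<phi>m (of_nat j)) \<ge> Re (\<phi>m 0)"
proof -
  show ge: "Re (\<phi>m (of_nat j)) \<ge> Re (\<phi>m 0)"
    using bernstein_Re_mono[OF rep_m, of 0 "real j"] by simp
  have "\<phi>m (of_nat j) = complex_of_real (Re (\<phi>m (of_nat j)))"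
    using bernstein_of_real(1)[OF rep_m, of "real j"] by (simp add: complex_eq_iff)
  then have "norm (\<phi>m (of_nat j)) = Re (\<phi>m (of_nat j))"
    using ge pos_m norm_of_real[of "Re (\<phi>m (of_nat j))", where 'a = complex] by simp
  then show "norm (exponent_ext \<phi>p \<phi>m (of_nat j)) =
     norm (bernstein_ext \<phi>p (- of_nat j)) * Re (\<phi>m (of_nat j))"
    by (simp add: exponent_ext_def norm_mult)
qed

lemma phi_m_at_infinity:
  "(\<lambda>j. ereal (Re (\<phi>m (of_nat j)))) \<longlonglongrightarrow> bernstein_at_infinity \<phi>m"
  using filterlim_compose[OF bernstein_at_infinity_tendsto[OF rep_m] filterlim_real_sequentially]
  by simp

lemma affine_ext:
  assumes "\<And>z. Re z \<ge> 0 \<Longrightarrow> \<phi>p z = \<phi>p 0 + complex_of_real d * z"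
  shows "bernstein_ext \<phi>p z = \<phi>p 0 + complex_of_real d * z"
proof -
  have "holomorphic_extension \<phi>p (min (Re z) 0 - 1) (\<lambda>z. \<phi>p 0 + complex_of_real d * z)"
    unfolding holomorphic_extension_def
  proof (intro conjI allI impI)
    show "\<phi>p 0 + complex_of_real d * w = \<phi>p w" if "Re w \<ge> 0" for w by (rule assms[OF that, symmetric])
  qed (intro holomorphic_intros)
  then show ?thesis by (rule bernstein_ext_eq) auto
qed

lemma norm_affine_ext:
  assumes "\<And>z. Re z \<ge> 0 \<Longrightarrow> \<phi>p z = \<phi>p 0 + complex_of_real d * z"
  shows "norm (bernstein_ext \<phi>p (- of_nat j)) = \<bar>Re (\<phi>p 0) - d * real j\<bar>"
proof -
  have "bernstein_ext \<phi>p (- of_nat j) = complex_of_real (Re (\<phi>p 0)) + complex_of_real d * (- of_nat j)"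
    using affine_ext[OF assms, of "- of_nat j"] bernstein_reprD(7)[OF rep_p] by (simp only:)
  also have "\<dots> = complex_of_real (Re (\<phi>p 0) - d * real j)" by simp
  finally show ?thesis by (simp only: norm_of_real)
qed

text \<open>For \<open>\<phi>\<^sub>+ = c\<close> the ratio of consecutive terms has modulus \<open>x c \<phi>\<^sub>-(j) / (j + 1)\<close>, which tends to
\<open>x c d\<^sub>-\<close>.\<close>

lemma constant_factor_radius:
  assumes const: "bernstein_constant \<phi>p" and x: "x > 0"
    and nz: "\<Psi> 0 \<noteq> 0"
  shows "ereal x < 1 / (bernstein_at_infinity \<phi>p * ereal dm) \<Longrightarrow> expansion_converges \<Psi> \<phi>p \<phi>m x"
    and "ereal x > 1 / (bernstein_at_infinity \<phi>p * ereal dm) \<Longrightarrow> \<not> expansion_converges \<Psi> \<phi>p \<phi>m x"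
proof -
  obtain c where c: "bernstein_at_infinity \<phi>p = ereal c" "c > 0"
    using const unfolding bernstein_constant_def by (cases "bernstein_at_infinity \<phi>p") auto
  have cz: "\<phi>p z = complex_of_real c" if "Re z \<ge> 0" for z
    using const that unfolding bernstein_constant_def c by simp
  then have "\<phi>p z = \<phi>p 0 + complex_of_real 0 * z" if "Re z \<ge> 0" for z using that by simp
  then have ext: "bernstein_ext \<phi>p z = complex_of_real c" for z
    using affine_ext[of 0 z] cz[of 0] by simp
  have lim: "(\<lambda>j. norm (exponent_ext \<phi>p \<phi>m (of_nat j)) / (real j + 1)) \<longlonglongrightarrow> c * dm"
    unfolding norm_exponent_ext ext using c tendsto_mult[OF tendsto_const[of c] bernstein_drift_limit[OF rep_m]]
    by simp
  have dm: "dm \<ge> 0" using bernstein_reprD(3)[OF rep_m] .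
  have eq: "bernstein_at_infinity \<phi>p * ereal dm = ereal (c * dm)" using c by simp
  note iff = less_reciprocal_ereal_iff[OF mult_nonneg_nonneg[OF less_imp_le[OF c(2)] dm] x]
  show "expansion_converges \<Psi> \<phi>p \<phi>m x" if "ereal x < 1 / (bernstein_at_infinity \<phi>p * ereal dm)"
    using that unfolding eq iff by (rule expansion_convergesI[OF lim x])
  show "\<not> expansion_converges \<Psi> \<phi>p \<phi>m x" if "ereal x > 1 / (bernstein_at_infinity \<phi>p * ereal dm)"
  proof (rule expansion_not_convergesI[where \<Psi> = \<Psi>, OF _ _ x])
    show "\<Psi> 0 \<noteq> 0" by (rule nz)
    have "(\<lambda>j. norm (exponent_ext \<phi>p \<phi>m (of_nat j)) / (real j + 1) * x) \<longlonglongrightarrow> c * dm * x"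
      by (intro tendsto_mult lim tendsto_const)
    moreover have "c * dm * x > 1" using that unfolding eq iff by (simp add: mult.commute)
    ultimately show "eventually (\<lambda>j. 1 \<le> norm (exponent_ext \<phi>p \<phi>m (of_nat j)) / (real j + 1) * x) sequentially"
      by (auto dest: order_tendstoD(1) elim!: eventually_mono)
    show "exponent_ext \<phi>p \<phi>m (of_nat j) \<noteq> 0" for j
      using norm_exponent_ext[of j] Re_phi_m_ge[of j] pos_m c by (auto simp: ext)
  qed
qed

text \<open>Here \<open>\<bar>\<phi>\<^sub>+(- j)\<bar> / (j + 1)\<close> tends to \<open>d\<^sub>+\<close> and \<open>\<phi>\<^sub>-(j)\<close> to its limit at infinity.\<close>

lemma affine_factor_radius:
  assumes affine: "bernstein_affine \<phi>p dp" and fin: "bernstein_at_infinity \<phi>m < \<infinity>"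
    and x: "x > 0" and nz: "\<Psi> 0 \<noteq> 0"
    and zero: "- bernstein_zero \<phi>p \<notin> range (\<lambda>n::nat. ereal (real n))"
  shows "ereal x < 1 / (bernstein_at_infinity \<phi>m * ereal dp) \<Longrightarrow> expansion_converges \<Psi> \<phi>p \<phi>m x"
    and "ereal x > 1 / (bernstein_at_infinity \<phi>m * ereal dp) \<Longrightarrow> \<not> expansion_converges \<Psi> \<phi>p \<phi>m x"
proof -
  have "ereal (Re (\<phi>m 0)) \<le> bernstein_at_infinity \<phi>m"
    using Re_phi_m_ge by (intro tendsto_lowerbound[OF phi_m_at_infinity]) auto
  then obtain c where c: "bernstein_at_infinity \<phi>m = ereal c" "c > 0"
    using fin pos_m by (cases "bernstein_at_infinity \<phi>m") auto
  have ext: "bernstein_ext \<phi>p z = \<phi>p 0 + complex_of_real dp * z" for z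
    by (rule affine_ext) (rule affine[unfolded bernstein_affine_def, THEN conjunct2, rule_format])
  have normp: "norm (bernstein_ext \<phi>p (- of_nat j)) = \<bar>Re (\<phi>p 0) - dp * real j\<bar>" for j
    by (rule norm_affine_ext) (rule affine[unfolded bernstein_affine_def, THEN conjunct2, rule_format])
  have dp: "dp > 0" by (rule affine[unfolded bernstein_affine_def, THEN conjunct1])
  have lim1: "(\<lambda>j. \<bar>Re (\<phi>p 0) - dp * real j\<bar> / (real j + 1)) \<longlonglongrightarrow> dp"
    using dp by real_asymp
  have lim2: "(\<lambda>j. Re (\<phi>m (of_nat j))) \<longlonglongrightarrow> c"
    using phi_m_at_infinity unfolding c by simp
  have lim: "(\<lambda>j. norm (exponent_ext \<phi>p \<phi>m (of_nat j)) / (real j + 1)) \<longlonglongrightarrow> c * dp"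
  proof -
    have "norm (exponent_ext \<phi>p \<phi>m (of_nat j)) / (real j + 1) =
       Re (\<phi>m (of_nat j)) * (\<bar>Re (\<phi>p 0) - dp * real j\<bar> / (real j + 1))" for j
      unfolding norm_exponent_ext normp by simp
    then show ?thesis using tendsto_mult[OF lim2 lim1] by (simp only:)
  qed
  have eq: "bernstein_at_infinity \<phi>m * ereal dp = ereal (c * dp)" using c by simp
  note iff = less_reciprocal_ereal_iff[OF mult_nonneg_nonneg[OF less_imp_le[OF c(2)] less_imp_le[OF dp]] x]
  show "expansion_converges \<Psi> \<phi>p \<phi>m x" if "ereal x < 1 / (bernstein_at_infinity \<phi>m * ereal dp)"
    using that unfolding eq iff by (rule expansion_convergesI[OF lim x])
  show "\<not> expansion_converges \<Psi> \<phi>p \<phi>m x" if "ereal x > 1 / (bernstein_at_infinity \<phi>m * ereal dp)"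
  proof (rule expansion_not_convergesI[where \<Psi> = \<Psi>, OF _ _ x])
    show "\<Psi> 0 \<noteq> 0" by (rule nz)
    have "(\<lambda>j. norm (exponent_ext \<phi>p \<phi>m (of_nat j)) / (real j + 1) * x) \<longlonglongrightarrow> c * dp * x"
      by (intro tendsto_mult lim tendsto_const)
    moreover have "c * dp * x > 1" using that unfolding eq iff by (simp add: mult.commute)
    ultimately show "eventually (\<lambda>j. 1 \<le> norm (exponent_ext \<phi>p \<phi>m (of_nat j)) / (real j + 1) * x) sequentially"
      by (auto dest: order_tendstoD(1) elim!: eventually_mono)
    show "exponent_ext \<phi>p \<phi>m (of_nat j) \<noteq> 0" for j
      using norm_exponent_ext[of j] Re_phi_m_ge[of j] pos_m
        bernstein_ext_neg_nat_nonzero[OF rep_p entire pos_p zero, of j] by auto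
  qed
qed

text \<open>In every other case \<open>\<bar>\<Psi>(j)\<bar> / (j + 1)\<close> tends to infinity: either \<open>\<mu>\<^sub>+\<close> is nontrivial and
\<open>\<phi>\<^sub>+(- j)\<close> is superlinear, or \<open>\<phi>\<^sub>+\<close> is affine with positive slope and
\<open>\<phi>\<^sub>-\<close> is unbounded.\<close>

lemma convergent_imp_constant_or_affine:
  assumes conv: "expansion_converges \<Psi> \<phi>p \<phi>m x" and x: "x > 0" and nz: "\<Psi> 0 \<noteq> 0"
    and zero: "- bernstein_zero \<phi>p \<notin> range (\<lambda>n::nat. ereal (real n))"
  shows "bernstein_constant \<phi>p \<or> (bernstein_affine \<phi>p dp \<and> bernstein_at_infinity \<phi>m < \<infinity>)"
proof (rule ccontr)
  assume neg: "\<not> ?thesis"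
  have "filterlim (\<lambda>j. norm (exponent_ext \<phi>p \<phi>m (of_nat j)) / (real j + 1)) at_top sequentially"
  proof (cases "AE y in \<mu>p. False")
    case False
    have "filterlim (\<lambda>j. Re (\<phi>m 0) * (norm (bernstein_ext \<phi>p (- of_nat j)) / (real j + 1))) at_top sequentially"
      by (intro filterlim_tendsto_pos_mult_at_top[OF tendsto_const pos_m] bernstein_ext_neg_growth[OF rep_p entire False])
    then show ?thesis
    proof (rule filterlim_at_top_mono, intro always_eventually allI)
      fix j
      have "Re (\<phi>m 0) * (norm (bernstein_ext \<phi>p (- of_nat j)) / (real j + 1)) \<le>
         Re (\<phi>m (of_nat j)) * (norm (bernstein_ext \<phi>p (- of_nat j)) / (real j + 1))"
        by (rule mult_right_mono[OF Re_phi_m_ge]) simp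
      also have "\<dots> = norm (exponent_ext \<phi>p \<phi>m (of_nat j)) / (real j + 1)"
        unfolding norm_exponent_ext by (simp add: mult.commute)
      finally show "Re (\<phi>m 0) * (norm (bernstein_ext \<phi>p (- of_nat j)) / (real j + 1)) \<le>
         norm (exponent_ext \<phi>p \<phi>m (of_nat j)) / (real j + 1)" .
    qed
  next
    case True
    have aff: "\<phi>p z = \<phi>p 0 + complex_of_real dp * z" if "Re z \<ge> 0" for z
    proof -
      have "(\<integral>y. (1 - exp (- z * complex_of_real y)) \<partial>\<mu>p) = (\<integral>y. 0 \<partial>\<mu>p)"
      proof (rule integral_cong_AE)
        show "AE y in \<mu>p. 1 - exp (- z * complex_of_real y) = 0" using True by eventually_elim simp
      qed (use integrable_one_minus_exp[OF bernstein_repr_subordinator[OF rep_p] that] in auto)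
      then show ?thesis using bernstein_repr_eq[OF rep_p that] by simp
    qed
    have "dp \<noteq> 0"
    proof
      assume "dp = 0"
      then have *: "\<phi>p z = \<phi>p 0" if "Re z \<ge> 0" for z using aff[OF that] by simp
      define c where "c = Re (\<phi>p 0)"
      have cz: "\<phi>p z = complex_of_real c" if "Re z \<ge> 0" for z
        unfolding c_def using *[OF that] bernstein_reprD(7)[OF rep_p] by (rule trans)
      have "eventually (\<lambda>u. ereal (Re (\<phi>p (complex_of_real u))) = ereal c) at_top"
        using eventually_ge_at_top[of 0] by eventually_elim (use cz in simp)
      then have "((\<lambda>u. ereal (Re (\<phi>p (complex_of_real u)))) \<longlongrightarrow> ereal c) at_top"
        by (rule tendsto_eventually)
      then have inf: "bernstein_at_infinity \<phi>p = ereal c"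
        by (intro tendsto_unique[OF trivial_limit_at_top_linorder bernstein_at_infinity_tendsto[OF rep_p]])
      have "c > 0" unfolding c_def by (rule pos_p)
      then have "bernstein_constant \<phi>p"
        unfolding bernstein_constant_def inf using cz by simp
      with neg show False by simp
    qed
    then have dp: "dp > 0" using bernstein_reprD(3)[OF rep_p] by simp
    then have "bernstein_affine \<phi>p dp" unfolding bernstein_affine_def using aff by blast
    with neg have "bernstein_at_infinity \<phi>m = \<infinity>" by simp
    then have 2: "filterlim (\<lambda>j. Re (\<phi>m (of_nat j))) at_top sequentially"
      using phi_m_at_infinity by (simp add: tendsto_PInfty_eq_at_top)
    have normp: "norm (bernstein_ext \<phi>p (- of_nat j)) = \<bar>Re (\<phi>p 0) - dp * real j\<bar>" for j
      by (rule norm_affine_ext) (rule aff)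
    have 1: "(\<lambda>j. \<bar>Re (\<phi>p 0) - dp * real j\<bar> / (real j + 1)) \<longlonglongrightarrow> dp"
      using dp by real_asymp
    show ?thesis
      unfolding norm_exponent_ext normp
      using filterlim_tendsto_pos_mult_at_top[OF 1 dp 2] by simp
  qed
  then have "eventually (\<lambda>j. 1 / x \<le> norm (exponent_ext \<phi>p \<phi>m (of_nat j)) / (real j + 1)) sequentially"
    by (simp add: filterlim_at_top)
  then have "eventually (\<lambda>j. 1 \<le> norm (exponent_ext \<phi>p \<phi>m (of_nat j)) / (real j + 1) * x) sequentially"
    by eventually_elim (use x in \<open>simp add: field_simps\<close>)
  moreover have "exponent_ext \<phi>p \<phi>m (of_nat j) \<noteq> 0" for j
    using norm_exponent_ext[of j] Re_phi_m_ge[of j] pos_m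
      bernstein_ext_neg_nat_nonzero[OF rep_p entire pos_p zero, of j] by auto
  ultimately show False using expansion_not_convergesI[of \<phi>p \<phi>m x \<Psi>] x nz conv by blast
qed

end

section \<open>Integrals of cadlag paths\<close>

definition exp_integral :: "(real \<Rightarrow> real) \<Rightarrow> real \<Rightarrow> real" where
  "exp_integral f t = (LINT s:{0..t}|lborel. exp (- f s))"

text \<open>One-sided limits bound the path near each point; the bisection principle \<open>Bolzano\<close> makes the bound uniform on
\<open>[0,t]\<close>.\<close>

lemma cadlag_bounded:
  assumes "cadlag f" "0 \<le> t"
  obtains B where "\<And>s. 0 \<le> s \<Longrightarrow> s \<le> t \<Longrightarrow> \<bar>f s\<bar> \<le> B"
proof -
  define P where "P a b \<longleftrightarrow> (\<exists>B. \<forall>s. 0 \<le> s \<longrightarrow> a \<le> s \<longrightarrow> s \<le> b \<longrightarrow> \<bar>f s\<bar> \<le> B)" for a b :: real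
  have "P 0 t"
  proof (rule Bolzano[OF assms(2), of P])
    fix a b c assume "P a b" "P b c"
    then obtain B C where "\<forall>s. 0 \<le> s \<longrightarrow> a \<le> s \<longrightarrow> s \<le> b \<longrightarrow> \<bar>f s\<bar> \<le> B"
      "\<forall>s. 0 \<le> s \<longrightarrow> b \<le> s \<longrightarrow> s \<le> c \<longrightarrow> \<bar>f s\<bar> \<le> C" unfolding P_def by blast
    then have "\<bar>f s\<bar> \<le> max B C" if "0 \<le> s" "a \<le> s" "s \<le> c" for s
      using that by (cases "s \<le> b") (auto simp: le_max_iff_disj)
    then show "P a c" unfolding P_def by blast
  next
    fix x assume x: "0 \<le> x" "x \<le> t"
    have "(f \<longlongrightarrow> f x) (at_right x)"
      using assms(1) x unfolding cadlag_def continuous_within by blast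
    then have "eventually (\<lambda>y. dist (f y) (f x) < 1) (at_right x)" by (rule tendstoD) simp
    then obtain b where b: "b > x" "\<And>y. x < y \<Longrightarrow> y < b \<Longrightarrow> dist (f y) (f x) < 1"
      unfolding eventually_at_right[OF less_add_one] by blast
    obtain a l where a: "a < x" "\<And>y. a < y \<Longrightarrow> y < x \<Longrightarrow> 0 \<le> y \<Longrightarrow> dist (f y) l < 1"
    proof (cases "x = 0")
      case True
      show ?thesis by (rule that[of "-1"]) (use True in auto)
    next
      case False
      then obtain l where "(f \<longlongrightarrow> l) (at_left x)" using assms(1) x unfolding cadlag_def by force
      then have "eventually (\<lambda>y. dist (f y) l < 1) (at_left x)" by (rule tendstoD) simp
      then obtain a where "a < x" "\<And>y. a < y \<Longrightarrow> y < x \<Longrightarrow> dist (f y) l < 1"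
        unfolding eventually_at_left[OF diff_less[OF zero_less_one]] by (auto simp: eventually_at_left[of "x - 1"])
      then show ?thesis using that by blast
    qed
    have "P u v" if uv: "u \<le> x" "x \<le> v" "v - u < min (b - x) (x - a)" for u v
      unfolding P_def
    proof (intro exI allI impI)
      fix s assume s: "0 \<le> s" "u \<le> s" "s \<le> v"
      consider "s = x" | "x < s" "s < b" | "a < s" "s < x" using s uv by linarith
      then show "\<bar>f s\<bar> \<le> \<bar>f x\<bar> + \<bar>l\<bar> + 1"
        by cases (use a(2)[of s] b(2)[of s] s in \<open>auto simp: dist_real_def\<close>)
    qed
    then show "\<exists>d>0. \<forall>a b. a \<le> x \<and> x \<le> b \<and> b - a < d \<longrightarrow> P a b"
      using a(1) b(1) by (intro exI[of _ "min (b - x) (x - a)"]) auto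
  qed
  then show ?thesis using that unfolding P_def by blast
qed

text \<open>The right end point of the grid cell of \<open>u\<close> lies strictly to the right of \<open>u\<close>, also when \<open>u\<close> is itself a grid
point.  This is what allows right-continuity to be used without any exceptional set.\<close>

lemma grid_bounds:
  fixes u h :: real
  assumes "h > 0" "0 \<le> u"
  shows "u < h * (real (nat \<lfloor>u / h\<rfloor>) + 1)" "h * (real (nat \<lfloor>u / h\<rfloor>) + 1) \<le> u + h"
proof -
  have f: "real (nat \<lfloor>u / h\<rfloor>) = of_int \<lfloor>u / h\<rfloor>" using assms by simp
  have "u / h < of_int \<lfloor>u / h\<rfloor> + 1" by linarith
  then show "u < h * (real (nat \<lfloor>u / h\<rfloor>) + 1)" using assms unfolding f by (simp add: field_simps)
  have "h * of_int \<lfloor>u / h\<rfloor> \<le> h * (u / h)" using assms by (intro mult_left_mono) auto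
  then show "h * (real (nat \<lfloor>u / h\<rfloor>) + 1) \<le> u + h" using assms unfolding f by (simp add: distrib_left)
qed

lemma cadlag_grid_limit:
  assumes "cadlag f" "0 \<le> u" and h: "\<And>n. h n > 0" "h \<longlonglongrightarrow> 0"
  shows "(\<lambda>n. f (h n * (real (nat \<lfloor>u / h n\<rfloor>) + 1))) \<longlonglongrightarrow> f u"
proof -
  have "(f \<longlongrightarrow> f u) (at_right u)"
    using assms unfolding cadlag_def continuous_within by blast
  moreover have "filterlim (\<lambda>n. h n * (real (nat \<lfloor>u / h n\<rfloor>) + 1)) (at_right u) sequentially"
    unfolding filterlim_at
  proof
    show "\<forall>\<^sub>F n in sequentially. h n * (real (nat \<lfloor>u / h n\<rfloor>) + 1) \<in> {u<..} \<and> h n * (real (nat \<lfloor>u / h n\<rfloor>) + 1) \<noteq> u"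
      using grid_bounds(1)[OF h(1) assms(2)] by (intro always_eventually) (auto simp: less_imp_neq[symmetric])
    show "(\<lambda>n. h n * (real (nat \<lfloor>u / h n\<rfloor>) + 1)) \<longlonglongrightarrow> u"
    proof (rule tendsto_sandwich[of "\<lambda>_. u" _ _ "\<lambda>n. u + h n"])
      show "(\<lambda>n. u + h n) \<longlonglongrightarrow> u" using tendsto_add[OF tendsto_const h(2), of u] by simp
    qed (use grid_bounds[OF h(1) assms(2)] in \<open>auto intro!: always_eventually less_imp_le\<close>)
  qed
  ultimately show ?thesis by (rule filterlim_compose)
qed

text \<open>The path is the limit of its values at the right end points of finer and finer grids, which depend on time
through countably many values only.  The clamp \<open>max 0\<close> discards the negative times, which are not part of the process.\<close>

lemma cadlag_joint_measurable:
  fixes \<xi> :: "real \<Rightarrow> 'a \<Rightarrow> real"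
  assumes meas: "\<And>s. s \<ge> 0 \<Longrightarrow> \<xi> s \<in> borel_measurable N"
    and cadlag: "\<And>\<omega>. \<omega> \<in> space N \<Longrightarrow> cadlag (\<lambda>t. \<xi> t \<omega>)"
  shows "(\<lambda>p. \<xi> (max 0 (fst p)) (snd p)) \<in> borel_measurable (borel \<Otimes>\<^sub>M N)"
proof (rule borel_measurable_LIMSEQ_real)
  define h where "h n = 1 / real (Suc n)" for n
  have h: "h n > 0" "h \<longlonglongrightarrow> 0" for n
    unfolding h_def using LIMSEQ_Suc[OF lim_1_over_n] by simp_all
  fix p :: "real \<times> 'a" assume "p \<in> space (borel \<Otimes>\<^sub>M N)"
  then have "snd p \<in> space N" by (auto simp: space_pair_measure)
  show "(\<lambda>n. \<xi> (h n * (real (nat \<lfloor>max 0 (fst p) / h n\<rfloor>) + 1)) (snd p)) \<longlonglongrightarrow> \<xi> (max 0 (fst p)) (snd p)"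
    by (rule cadlag_grid_limit[OF cadlag[OF \<open>snd p \<in> space N\<close>]]) (use h in auto)
next
  fix n
  define h where "h n = 1 / real (Suc n)" for n
  have [measurable]: "(\<lambda>p. \<xi> (h n * (real k + 1)) (snd p)) \<in> borel_measurable (borel \<Otimes>\<^sub>M N)" for k :: nat
    using meas[of "h n * (real k + 1)"] by (intro measurable_compose[OF measurable_snd]) (simp add: h_def)
  have "(\<lambda>p. \<xi> (h n * (real (nat \<lfloor>max 0 (fst p) / h n\<rfloor>) + 1)) (snd p)) \<in> borel_measurable (borel \<Otimes>\<^sub>M N)"
    by (rule measurable_compose_countable[where f = "\<lambda>k p. \<xi> (h n * (real k + 1)) (snd p)"
          and g = "\<lambda>p. nat \<lfloor>max 0 (fst p) / h n\<rfloor>"]) measurable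
  then show "(\<lambda>p. \<xi> (1 / real (Suc n) * (real (nat \<lfloor>max 0 (fst p) / (1 / real (Suc n))\<rfloor>) + 1)) (snd p))
    \<in> borel_measurable (borel \<Otimes>\<^sub>M N)"
    unfolding h_def .
qed

lemma cadlag_measurable:
  assumes "cadlag f"
  shows "(\<lambda>s. f (max 0 s)) \<in> borel_measurable borel"
proof -
  have "(\<lambda>p. f (max 0 (fst p))) \<in> borel_measurable (borel \<Otimes>\<^sub>M count_space {()})"
    using cadlag_joint_measurable[of "\<lambda>s _. f s" "count_space {()}"] assms by simp
  then show ?thesis
    using measurable_compose[of "\<lambda>s. (s, ())" borel "borel \<Otimes>\<^sub>M count_space {()}" "\<lambda>p. f (max 0 (fst p))" borel]
    by simp
qed

lemma exp_integral_clamp: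
  "exp_integral f t = (\<integral>s. indicator {0..t} s * exp (- f (max 0 s)) \<partial>lborel)"
  unfolding exp_integral_def set_lebesgue_integral_def
  by (intro Bochner_Integration.integral_cong) (auto simp: indicator_def max_def)

lemma exp_integral_jointly_measurable:
  fixes \<xi> :: "real \<Rightarrow> 'a \<Rightarrow> real"
  assumes meas: "\<And>s. s \<ge> 0 \<Longrightarrow> \<xi> s \<in> borel_measurable N"
    and cadlag: "\<And>\<omega>. \<omega> \<in> space N \<Longrightarrow> cadlag (\<lambda>t. \<xi> t \<omega>)"
  shows "(\<lambda>p. exp_integral (\<lambda>s. \<xi> s (snd p)) (fst p)) \<in> borel_measurable (borel \<Otimes>\<^sub>M N)"
proof -
  note [measurable] = cadlag_joint_measurable[OF assms, simplified]
  have [measurable]: "(\<lambda>q. \<xi> (max 0 (snd q)) (snd (fst q))) \<in> borel_measurable ((borel \<Otimes>\<^sub>M N) \<Otimes>\<^sub>M lborel)"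
    using measurable_compose[OF _ cadlag_joint_measurable[OF assms],
       of "\<lambda>q. (snd q, snd (fst q))" "(borel \<Otimes>\<^sub>M N) \<Otimes>\<^sub>M lborel"] by simp
  have ind: "indicator {0..t} s = (if 0 \<le> s \<and> s \<le> t then 1 else 0 :: real)" for s t
    by (simp add: indicator_def)
  show ?thesis
    unfolding exp_integral_clamp ind by measurable
qed

lemma cadlag_exp_set_integrable:
  assumes "cadlag f"
  shows "set_integrable lborel {a..b} (\<lambda>s. exp (- f (max 0 s)))"
proof -
  note [measurable] = cadlag_measurable[OF assms]
  obtain B where B: "\<And>s. 0 \<le> s \<Longrightarrow> s \<le> max 0 b \<Longrightarrow> \<bar>f s\<bar> \<le> B"
    using cadlag_bounded[OF assms, of "max 0 b"] by auto
  show ?thesis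
    unfolding set_integrable_def
  proof (rule Bochner_Integration.integrable_bound[where f = "\<lambda>s. indicator {a..b} s *\<^sub>R exp B"])
    show "integrable lborel (\<lambda>s. indicator {a..b} s *\<^sub>R exp B)"
      by (simp add: integrable_indicator_iff emeasure_lborel_Icc_eq)
    show "AE s in lborel. norm (indicator {a..b} s *\<^sub>R exp (- f (max 0 s))) \<le> norm (indicator {a..b} s *\<^sub>R exp B)"
    proof (rule AE_I2)
      fix s
      have "\<bar>f (max 0 s)\<bar> \<le> B" if "s \<le> b" using that by (intro B) auto
      then show "norm (indicator {a..b} s *\<^sub>R exp (- f (max 0 s))) \<le> norm (indicator {a..b} s *\<^sub>R exp B)"
        by (auto simp: indicator_def)
    qed
  qed measurable
qed

lemma exp_integral_HK:
  assumes "cadlag f"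
  shows "(\<lambda>s. exp (- f (max 0 s))) integrable_on {a..b}"
    and "exp_integral f t = integral {0..t} (\<lambda>s. exp (- f (max 0 s)))"
proof -
  show "(\<lambda>s. exp (- f (max 0 s))) integrable_on {a..b}"
    by (rule set_borel_integral_eq_integral(1)[OF cadlag_exp_set_integrable[OF assms]])
  show "exp_integral f t = integral {0..t} (\<lambda>s. exp (- f (max 0 s)))"
    using set_borel_integral_eq_integral(2)[OF cadlag_exp_set_integrable[OF assms], of 0 t]
    unfolding exp_integral_clamp set_lebesgue_integral_def by simp
qed

lemma exp_integral_diff:
  assumes "cadlag f" "0 \<le> s" "s \<le> t"
  shows "exp_integral f t = exp_integral f s + integral {s..t} (\<lambda>u. exp (- f (max 0 u)))"
  unfolding exp_integral_HK(2)[OF assms(1)]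
  by (rule Henstock_Kurzweil_Integration.integral_combine[symmetric]) (use assms exp_integral_HK(1) in auto)

lemma exp_integral_strict_mono:
  assumes "cadlag f" "0 \<le> s" "s < t"
  shows "exp_integral f s < exp_integral f t"
proof -
  obtain B where B: "\<And>u. 0 \<le> u \<Longrightarrow> u \<le> t \<Longrightarrow> \<bar>f u\<bar> \<le> B"
    using cadlag_bounded[OF assms(1), of t] assms by auto
  have "integral {s..t} (\<lambda>u. exp (- B)) \<le> integral {s..t} (\<lambda>u. exp (- f (max 0 u)))"
  proof (rule integral_le)
    show "exp (- B) \<le> exp (- f (max 0 u))" if "u \<in> {s..t}" for u
      using B[of u] that assms by auto
  qed (use exp_integral_HK(1)[OF assms(1)] in auto)
  moreover have "integral {s..t} (\<lambda>u. exp (- B)) = (t - s) * exp (- B)" using assms by simp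
  moreover have "(t - s) * exp (- B) > 0" using assms by simp
  ultimately show ?thesis using exp_integral_diff[OF assms(1,2), of t] assms by linarith
qed

lemma exp_integral_0 [simp]: "cadlag f \<Longrightarrow> exp_integral f 0 = 0"
  by (simp add: exp_integral_HK(2))

lemma exp_integral_mono:
  assumes "cadlag f" "0 \<le> s" "s \<le> t"
  shows "exp_integral f s \<le> exp_integral f t"
  using exp_integral_strict_mono[OF assms(1,2), of t] assms by (cases "s = t") auto

lemma exp_integral_nonneg: "cadlag f \<Longrightarrow> 0 \<le> t \<Longrightarrow> 0 \<le> exp_integral f t"
  using exp_integral_mono[of f 0 t] by simp

lemma exp_integral_continuous_on:
  assumes "cadlag f"
  shows "continuous_on {0..t} (exp_integral f)"
  using indefinite_integral_continuous_1[OF exp_integral_HK(1)[OF assms], of 0 t]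
  by (simp add: exp_integral_HK(2)[OF assms, abs_def])

text \<open>The measure \<open>exp (- f(s)) ds\<close> on \<open>[0,t]\<close> is carried by \<open>s \<mapsto> exp_integral f s\<close> to Lebesgue
measure on \<open>[0, exp_integral f t]\<close>.  The map is continuous and strictly increasing, so it suffices
to compare half-lines.  The usual substitution rules require a continuous derivative, which the
paths do not provide.\<close>

lemma exp_integral_time_change:
  assumes f: "cadlag f" and t: "0 \<le> t" and g[measurable]: "g \<in> borel_measurable borel"
  shows "(\<integral>\<^sup>+s. g (exp_integral f s) * ennreal (exp (- f s)) * indicator {0..t} s \<partial>lborel) =
     (\<integral>\<^sup>+y. g y * indicator {0..exp_integral f t} y \<partial>lborel)"
proof -
  note [measurable] = cadlag_measurable[OF f]
  define E where "E s = exp_integral f (max 0 (min t s))" for s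
  have "continuous_on UNIV E"
    unfolding E_def
    by (rule continuous_on_compose2[OF exp_integral_continuous_on[OF f, of t]])
      (use t in \<open>auto intro!: continuous_intros\<close>)
  then have [measurable]: "E \<in> borel_measurable borel" by (rule borel_measurable_continuous_onI)
  have E: "E s = exp_integral f s" if "0 \<le> s" "s \<le> t" for s using that by (simp add: E_def)
  define \<mu> where "\<mu> = distr (density lborel (\<lambda>s. ennreal (exp (- f (max 0 s))) * indicator {0..t} s)) borel E"
  define \<nu> where "\<nu> = density lborel (indicator {0..exp_integral f t})"
  have piece: "(\<integral>\<^sup>+u. ennreal (exp (- f (max 0 u))) * indicator {s..t} u \<partial>lborel) =
      ennreal (exp_integral f t - exp_integral f s)" if "0 \<le> s" "s \<le> t" for s
  proof -
    have "(\<integral>\<^sup>+u. ennreal (exp (- f (max 0 u))) * indicator {s..t} u \<partial>lborel) =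
       (\<integral>\<^sup>+u. ennreal (indicator {s..t} u *\<^sub>R exp (- f (max 0 u))) \<partial>lborel)"
      by (intro nn_integral_cong) (simp add: indicator_def)
    also have "\<dots> = ennreal (LINT u:{s..t}|lborel. exp (- f (max 0 u)))"
      unfolding set_lebesgue_integral_def
      using cadlag_exp_set_integrable[OF f] unfolding set_integrable_def
      by (intro nn_integral_eq_integral) auto
    also have "(LINT u:{s..t}|lborel. exp (- f (max 0 u))) = integral {s..t} (\<lambda>u. exp (- f (max 0 u)))"
      by (rule set_borel_integral_eq_integral(2)[OF cadlag_exp_set_integrable[OF f]])
    finally show ?thesis using exp_integral_diff[OF f that] by simp
  qed
  have \<mu>: "emeasure \<mu> {y<..} = (\<integral>\<^sup>+s. ennreal (exp (- f (max 0 s))) * indicator {s \<in> {0..t}. y < exp_integral f s} s \<partial>lborel)" for y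
  proof -
    have "emeasure \<mu> {y<..} = (\<integral>\<^sup>+s. ennreal (exp (- f (max 0 s))) * indicator {0..t} s * indicator (E -` {y<..}) s \<partial>lborel)"
      using measurable_sets_borel[OF \<open>E \<in> borel_measurable borel\<close>, of "{y<..}"]
      unfolding \<mu>_def by (simp add: emeasure_distr emeasure_density)
    also have "\<dots> = (\<integral>\<^sup>+s. ennreal (exp (- f (max 0 s))) * indicator {s \<in> {0..t}. y < exp_integral f s} s \<partial>lborel)"
      by (intro nn_integral_cong) (auto simp: indicator_def E)
    finally show ?thesis .
  qed
  have "\<mu> = \<nu>"
  proof (rule measure_eqI_lessThan)
    fix y
    have \<nu>: "emeasure \<nu> {y<..} = emeasure lborel ({0..exp_integral f t} \<inter> {y<..})"
      unfolding \<nu>_def by (rule emeasure_restricted) auto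
    consider "y < 0" | "0 \<le> y" "y < exp_integral f t" | "exp_integral f t \<le> y" by linarith
    then have *: "emeasure \<mu> {y<..} = emeasure \<nu> {y<..} \<and> emeasure \<mu> {y<..} < \<infinity>"
    proof cases
      case 1
      then have "{s \<in> {0..t}. y < exp_integral f s} = {0..t}"
        using less_le_trans[OF 1 exp_integral_nonneg[OF f]] by auto
      moreover have "{0..exp_integral f t} \<inter> {y<..} = {0..exp_integral f t}" using 1 by auto
      ultimately show ?thesis
        unfolding \<mu> \<nu> using piece[of 0] t f exp_integral_nonneg[OF f t] by simp
    next
      case 2
      have "\<exists>s\<ge>0. s \<le> t \<and> exp_integral f s = y"
        by (rule IVT') (use 2 t exp_integral_continuous_on[OF f] exp_integral_0[OF f] in simp_all)
      then obtain \<sigma> where \<sigma>: "0 \<le> \<sigma>" "\<sigma> \<le> t" "exp_integral f \<sigma> = y" by blast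
      have "y < exp_integral f s \<longleftrightarrow> \<sigma> < s" if "0 \<le> s" for s
        using exp_integral_strict_mono[OF f \<sigma>(1), of s] exp_integral_mono[OF f that, of \<sigma>] \<sigma>(3)
        by (cases "\<sigma> < s") auto
      then have "{s \<in> {0..t}. y < exp_integral f s} = {\<sigma><..t}" using \<sigma>(1) by auto
      then have "emeasure \<mu> {y<..} = (\<integral>\<^sup>+u. ennreal (exp (- f (max 0 u))) * indicator {\<sigma>..t} u \<partial>lborel)"
        unfolding \<mu>
      proof (simp only:, intro nn_integral_cong_AE)
        show "AE u in lborel. ennreal (exp (- f (max 0 u))) * indicator {\<sigma><..t} u =
            ennreal (exp (- f (max 0 u))) * indicator {\<sigma>..t} u"
          using AE_lborel_singleton[of \<sigma>] by eventually_elim (auto simp: indicator_def)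
      qed
      moreover have "{0..exp_integral f t} \<inter> {y<..} = {y<..exp_integral f t}" using 2 by auto
      ultimately show ?thesis unfolding \<nu> using piece[OF \<sigma>(1,2)] \<sigma>(3) 2 by simp
    next
      case 3
      have "exp_integral f s \<le> y" if "0 \<le> s" "s \<le> t" for s
        using exp_integral_mono[OF f that] 3 by simp
      then have "{s \<in> {0..t}. y < exp_integral f s} = {}" by (auto simp: not_less)
      moreover have "{0..exp_integral f t} \<inter> {y<..} = {}" using 3 by auto
      ultimately show ?thesis unfolding \<mu> \<nu> by simp
    qed
    then show "emeasure \<mu> {y<..} = emeasure \<nu> {y<..}" "emeasure \<mu> {y<..} < \<infinity>" by auto
  qed (simp_all add: \<mu>_def \<nu>_def)
  have "(\<integral>\<^sup>+s. g (exp_integral f s) * ennreal (exp (- f s)) * indicator {0..t} s \<partial>lborel) =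
    (\<integral>\<^sup>+s. (ennreal (exp (- f (max 0 s))) * indicator {0..t} s) * g (E s) \<partial>lborel)"
    by (intro nn_integral_cong) (auto simp: indicator_def E mult.commute)
  also have "\<dots> = (\<integral>\<^sup>+y. g y \<partial>\<mu>)"
  proof -
    have "(\<integral>\<^sup>+y. g y \<partial>\<mu>) = (\<integral>\<^sup>+s. g (E s) \<partial>density lborel (\<lambda>s. ennreal (exp (- f (max 0 s))) * indicator {0..t} s))"
      unfolding \<mu>_def by (rule nn_integral_distr) simp_all
    also have "\<dots> = (\<integral>\<^sup>+s. (ennreal (exp (- f (max 0 s))) * indicator {0..t} s) * g (E s) \<partial>lborel)"
      by (rule nn_integral_density) simp_all
    finally show ?thesis by (rule sym)
  qed
  also have "\<dots> = (\<integral>\<^sup>+y. g y * indicator {0..exp_integral f t} y \<partial>lborel)"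
  proof -
    have "(\<integral>\<^sup>+y. g y \<partial>\<nu>) = (\<integral>\<^sup>+y. indicator {0..exp_integral f t} y * g y \<partial>lborel)"
      unfolding \<nu>_def by (rule nn_integral_density) simp_all
    then show ?thesis unfolding \<open>\<mu> = \<nu>\<close> by (simp only: mult.commute[of "g _"])
  qed
  finally show ?thesis .
qed

text \<open>The function \<open>((x - a)\<^sub>+)\<^sup>k\<close>, with the convention that for \<open>k = 0\<close> it is the indicator of \<open>a \<le> x\<close>, including the
point \<open>a = x\<close>; its expectation is then a distribution function.\<close>

definition truncated_power :: "nat \<Rightarrow> real \<Rightarrow> real \<Rightarrow> real" where
  "truncated_power k x a = (if a \<le> x then (x - a) ^ k else 0)"

lemma truncated_power_measurable [measurable]: "truncated_power k x \<in> borel_measurable borel"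
  unfolding truncated_power_def by measurable

lemma truncated_power_nonneg: "0 \<le> truncated_power k x a"
  by (simp add: truncated_power_def)

lemma truncated_power_le: "0 \<le> a \<Longrightarrow> 0 \<le> x \<Longrightarrow> truncated_power k x a \<le> x ^ k"
  by (auto simp: truncated_power_def intro!: power_mono)

lemma nn_integral_truncated_power:
  assumes "0 \<le> x" "0 \<le> a"
  shows "(\<integral>\<^sup>+y. ennreal (truncated_power k x y) * indicator {0..a} y \<partial>lborel) =
     ennreal ((x ^ Suc k - truncated_power (Suc k) x a) / Suc k)"
proof -
  have "(\<integral>\<^sup>+y. ennreal (truncated_power k x y) * indicator {0..a} y \<partial>lborel) =
     (\<integral>\<^sup>+y. ennreal ((x - y) ^ k) * indicator {0..min a x} y \<partial>lborel)"
    by (intro nn_integral_cong) (auto simp: indicator_def truncated_power_def)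
  also have "\<dots> = ennreal (- ((x - min a x) ^ Suc k / Suc k) - (- ((x - 0) ^ Suc k / Suc k)))"
  proof (rule nn_integral_FTC_Icc)
    fix y
    have "((\<lambda>y. - ((x - y) ^ Suc k / real (Suc k))) has_real_derivative
       - (real (Suc k) * (x - y) ^ (Suc k - 1) * (0 - 1) / real (Suc k))) (at y)"
      by (intro derivative_eq_intros refl) auto
    moreover have "- (real (Suc k) * (x - y) ^ (Suc k - 1) * (0 - 1) / real (Suc k)) = (x - y) ^ k"
      by (simp del: of_nat_Suc)
    ultimately show "((\<lambda>y. - ((x - y) ^ Suc k / real (Suc k))) has_real_derivative (x - y) ^ k) (at y)" by (simp only:)
  qed (use assms in auto)
  also have "\<dots> = ennreal ((x ^ Suc k - truncated_power (Suc k) x a) / Suc k)"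
    by (simp add: truncated_power_def min_def diff_divide_distrib del: of_nat_Suc)
  finally show ?thesis .
qed

text \<open>The pathwise fundamental theorem for \<open>t \<mapsto> ((x - A(t))\<^sub>+)\<^sup>k\<^sup>+\<^sup>1\<close>.\<close>

lemma truncated_power_path_integral:
  assumes "cadlag f" "0 \<le> t" "0 \<le> x"
  shows "(\<integral>\<^sup>+s. ennreal (truncated_power k x (exp_integral f s) * exp (- f s)) * indicator {0..t} s \<partial>lborel) =
     ennreal ((x ^ Suc k - truncated_power (Suc k) x (exp_integral f t)) / Suc k)"
  using exp_integral_time_change[OF assms(1,2), of "\<lambda>y. ennreal (truncated_power k x y)"]
    nn_integral_truncated_power[OF assms(3) exp_integral_nonneg[OF assms(1,2)], of k]
  by (simp add: ennreal_mult truncated_power_nonneg)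

text \<open>Right-end-point Riemann sums converge because the integrands of the corresponding step functions converge
pointwise, by right-continuity, and boundedly.  These sums involve finitely many increments, for which independence is known.\<close>

lemma exp_integral_Riemann:
  assumes f: "cadlag f" and s: "0 \<le> s"
  shows "(\<lambda>n. \<Sum>i<Suc n. s / real (Suc n) * exp (- f (s / real (Suc n) * (real i + 1)))) \<longlonglongrightarrow> exp_integral f s"
proof (cases "s = 0")
  case True
  then show ?thesis using f by simp
next
  case False
  with s have s: "s > 0" by simp
  define h where "h n = s / real (Suc n)" for n
  have h: "h n > 0" for n using s by (simp add: h_def)
  have h0: "h \<longlonglongrightarrow> 0"
    unfolding h_def using tendsto_mult[OF tendsto_const[of s] LIMSEQ_Suc[OF lim_1_over_n]] by simp
  define r where "r n u = h n * (real (nat \<lfloor>u / h n\<rfloor>) + 1)" for n u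
  have step: "((\<lambda>u. exp (- f (r n u))) has_integral (\<Sum>i<m. h n * exp (- f (h n * (real i + 1))))) {0..h n * real m}" for n m
  proof (induction m)
    case 0
    then show ?case by (simp add: has_integral_refl)
  next
    case (Suc m)
    let ?a = "h n * real m" and ?b = "h n * real (Suc m)"
    have ab: "?a \<le> ?b" using h[of n] by (simp add: mult_left_mono)
    have const: "((\<lambda>u. exp (- f (h n * (real m + 1)))) has_integral h n * exp (- f (h n * (real m + 1)))) {?a..?b}"
      using has_integral_const_real[of "exp (- f (h n * (real m + 1)))" ?a ?b] ab by (simp add: algebra_simps)
    have eq: "exp (- f (r n u)) = exp (- f (h n * (real m + 1)))" if "u \<in> {?a..?b} - {?b}" for u
    proof -
      have "\<lfloor>u / h n\<rfloor> = int m"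
      proof (rule floor_unique)
        show "of_int (int m) \<le> u / h n"
          using that pos_le_divide_eq[OF h[of n], of "real m" u] by (simp add: mult.commute)
        have "u < real (Suc m) * h n" using that by (simp add: mult.commute)
        then show "u / h n < of_int (int m) + 1"
          using pos_divide_less_eq[OF h[of n], of u "real (Suc m)"] by (simp add: add.commute)
      qed
      then show ?thesis by (simp add: r_def)
    qed
    have piece: "((\<lambda>u. exp (- f (r n u))) has_integral h n * exp (- f (h n * (real m + 1)))) {?a..?b}"
      by (rule has_integral_spike_finite[where S = "{?b}", OF _ eq const]) simp_all
    have "((\<lambda>u. exp (- f (r n u))) has_integral
        (\<Sum>i<m. h n * exp (- f (h n * (real i + 1)))) + h n * exp (- f (h n * (real m + 1)))) {0..?b}"
      by (rule has_integral_combine[OF _ ab Suc.IH piece]) (use h[of n] in simp)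
    then show ?case by (simp only: sum.lessThan_Suc)
  qed
  have hs: "h n * real (Suc n) = s" for n by (simp add: h_def)
  have int: "((\<lambda>u. exp (- f (r n u))) has_integral (\<Sum>i<Suc n. h n * exp (- f (h n * (real i + 1))))) {0..s}" for n
    using step[of n "Suc n"] unfolding hs .
  obtain B where B: "\<And>u. 0 \<le> u \<Longrightarrow> u \<le> 2 * s \<Longrightarrow> \<bar>f u\<bar> \<le> B"
    using cadlag_bounded[OF f, of "2 * s"] s by auto
  have "(\<lambda>n. integral {0..s} (\<lambda>u. exp (- f (r n u)))) \<longlonglongrightarrow> integral {0..s} (\<lambda>u. exp (- f (max 0 u)))"
  proof (rule dominated_convergence(2)[where h = "\<lambda>_. exp B"])
    show "(\<lambda>u. exp (- f (r n u))) integrable_on {0..s}" for n by (rule has_integral_integrable[OF int])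
    show "(\<lambda>_. exp B) integrable_on {0..s}"
      by (rule has_integral_integrable[OF has_integral_const_real])
    fix u assume u: "u \<in> {0..s}"
    show "norm (exp (- f (r n u))) \<le> exp B" for n
    proof -
      have "h n \<le> s" using s by (simp add: h_def pos_divide_le_eq distrib_left)
      then have "0 \<le> r n u" "r n u \<le> 2 * s"
        using grid_bounds[OF h[of n], of u] u h[of n] unfolding r_def by auto
      then show ?thesis using B[of "r n u"] by simp
    qed
    show "(\<lambda>n. exp (- f (r n u))) \<longlonglongrightarrow> exp (- f (max 0 u))"
    proof (intro tendsto_exp tendsto_minus)
      have "0 \<le> u" "max 0 u = u" using u by auto
      then show "(\<lambda>n. f (r n u)) \<longlonglongrightarrow> f (max 0 u)"
        unfolding r_def using cadlag_grid_limit[OF f _ h h0, of u] by (simp only:)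
    qed
  qed
  then show ?thesis
    unfolding integral_unique[OF int] exp_integral_HK(2)[OF f] h_def .
qed

section \<open>Levy processes with exponential moments\<close>

lemma levy_processD:
  assumes "levy_process M \<xi>"
  shows "prob_space M" "\<And>t. 0 \<le> t \<Longrightarrow> \<xi> t \<in> borel_measurable M" "AE \<omega> in M. \<xi> 0 \<omega> = 0"
    "\<And>\<omega>. \<omega> \<in> space M \<Longrightarrow> cadlag (\<lambda>t. \<xi> t \<omega>)"
    "\<And>s h. 0 \<le> s \<Longrightarrow> 0 \<le> h \<Longrightarrow> distr M borel (\<lambda>\<omega>. \<xi> (s + h) \<omega> - \<xi> s \<omega>) = distr M borel (\<xi> h)"
    "\<And>n t. 0 \<le> t 0 \<Longrightarrow> (\<And>i. i < n \<Longrightarrow> t i \<le> t (Suc i)) \<Longrightarrow>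
        prob_space.indep_vars M (\<lambda>_. borel) (\<lambda>i \<omega>. \<xi> (t (Suc i)) \<omega> - \<xi> (t i) \<omega>) {..<n::nat}"
  using assms unfolding levy_process_def by blast+

text \<open>The moment recursion uses the unkilled process only through its exponential moments of natural order, so it is
developed without reference to \<open>\<Psi>\<close>.\<close>

locale levy_exp_moments = prob_space M for M :: "'a measure" +
  fixes \<xi> :: "real \<Rightarrow> 'a \<Rightarrow> real" and \<kappa> :: "nat \<Rightarrow> real"
  assumes levy: "levy_process M \<xi>"
    and moment_integrable: "\<And>k t. 0 \<le> t \<Longrightarrow> integrable M (\<lambda>\<omega>. exp (real k * \<xi> t \<omega>))"
    and moment: "\<And>k t. 0 \<le> t \<Longrightarrow> (\<integral>\<omega>. exp (real k * \<xi> t \<omega>) \<partial>M) = exp (\<kappa> k * t)"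
begin

abbreviation A :: "real \<Rightarrow> 'a \<Rightarrow> real" where
  "A t \<omega> \<equiv> exp_integral (\<lambda>s. \<xi> s \<omega>) t"

lemmas xi_measurable = levy_processD(2)[OF levy]
lemmas xi_cadlag = levy_processD(4)[OF levy]

lemma A_jointly_measurable [measurable]:
  "(\<lambda>p. A (fst p) (snd p)) \<in> borel_measurable (borel \<Otimes>\<^sub>M M)"
  by (rule exp_integral_jointly_measurable[OF xi_measurable xi_cadlag])

lemma A_measurable [measurable]: "(\<lambda>\<omega>. A t \<omega>) \<in> borel_measurable M"
  using measurable_compose[of "\<lambda>\<omega>. (t, \<omega>)" M "borel \<Otimes>\<^sub>M M", OF _ A_jointly_measurable] by simp

lemma A_nonneg: "\<omega> \<in> space M \<Longrightarrow> 0 \<le> t \<Longrightarrow> 0 \<le> A t \<omega>"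
  by (rule exp_integral_nonneg[OF xi_cadlag])

lemma increment_moment:
  assumes "0 \<le> s" "s \<le> t"
  shows "integrable M (\<lambda>\<omega>. exp (real k * (\<xi> t \<omega> - \<xi> s \<omega>)))"
    and "(\<integral>\<omega>. exp (real k * (\<xi> t \<omega> - \<xi> s \<omega>)) \<partial>M) = exp (\<kappa> k * (t - s))"
proof -
  have ts: "0 \<le> t - s" "0 \<le> t" using assms by simp_all
  note [measurable] = xi_measurable[OF assms(1)] xi_measurable[OF ts(1)] xi_measurable[OF ts(2)]
  have D: "distr M borel (\<lambda>\<omega>. \<xi> t \<omega> - \<xi> s \<omega>) = distr M borel (\<xi> (t - s))"
    using levy_processD(5)[OF levy assms(1) ts(1)] by simp
  have "integrable (distr M borel (\<xi> (t - s))) (\<lambda>x. exp (real k * x))"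
    by (subst integrable_distr_eq) (simp_all add: moment_integrable[OF ts(1)])
  then show "integrable M (\<lambda>\<omega>. exp (real k * (\<xi> t \<omega> - \<xi> s \<omega>)))"
    unfolding D[symmetric] by (subst (asm) integrable_distr_eq) simp_all
  have "(\<integral>\<omega>. exp (real k * (\<xi> t \<omega> - \<xi> s \<omega>)) \<partial>M) = (\<integral>x. exp (real k * x) \<partial>distr M borel (\<lambda>\<omega>. \<xi> t \<omega> - \<xi> s \<omega>))"
    by (subst integral_distr) simp_all
  also have "\<dots> = (\<integral>\<omega>. exp (real k * \<xi> (t - s) \<omega>) \<partial>M)"
    unfolding D by (subst integral_distr) simp_all
  finally show "(\<integral>\<omega>. exp (real k * (\<xi> t \<omega> - \<xi> s \<omega>)) \<partial>M) = exp (\<kappa> k * (t - s))"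
    by (simp add: moment[OF ts(1)])
qed

text \<open>A functional of the increments over the grid of mesh \<open>s / (n + 1)\<close> that approximates
\<open>exp (b \<xi>(s)) h(A(s))\<close>.  Subtracting \<open>\<xi>(0)\<close>, which vanishes almost surely, makes it an exact function of increments.\<close>

definition grid_functional :: "nat \<Rightarrow> (real \<Rightarrow> real) \<Rightarrow> real \<Rightarrow> nat \<Rightarrow> 'a \<Rightarrow> real" where
  "grid_functional b h s n \<omega> = exp (real b * (\<xi> s \<omega> - \<xi> 0 \<omega>)) *
     h (\<Sum>i<Suc n. s / real (Suc n) * exp (- (\<xi> (s / real (Suc n) * (real i + 1)) \<omega> - \<xi> 0 \<omega>)))"

text \<open>The grid points in \<open>[0,s]\<close> followed by \<open>t\<close> form one increasing sequence of times: the last increment is independent of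
all the others, and hence of every function of them.\<close>

lemma indep_increment_grid:
  assumes st: "0 \<le> s" "s \<le> t" and [measurable]: "h \<in> borel_measurable borel"
  shows "indep_var borel (\<lambda>\<omega>. exp (real k * (\<xi> t \<omega> - \<xi> s \<omega>))) borel (grid_functional b h s n)"
proof -
  define N where "N = Suc n"
  \<comment> \<open>The grid points \<open>0, s/N, \<dots>, s\<close> have the indices \<open>0, \<dots>, N\<close>; index \<open>N + 1\<close> is the time \<open>t\<close>.\<close>
  define \<tau> where "\<tau> i = (if i \<le> N then s / real N * real i else t)" for i
  have N: "N > 0" by (simp add: N_def)
  have \<tau>0: "\<tau> 0 = 0" and \<tau>N: "\<tau> N = s" and \<tau>S: "\<tau> (Suc N) = t"
    using N by (simp_all add: \<tau>_def)
  have mono: "\<tau> i \<le> \<tau> (Suc i)" if "i < Suc N" for i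
  proof (cases "i = N")
    case True
    then show ?thesis using st \<tau>N \<tau>S by simp
  next
    case False
    then have "i < N" using that by simp
    then show ?thesis using st unfolding \<tau>_def by (simp add: mult_left_mono divide_right_mono)
  qed
  define X where "X i \<omega> = \<xi> (\<tau> (Suc i)) \<omega> - \<xi> (\<tau> i) \<omega>" for i \<omega>
  have "indep_vars (\<lambda>_. borel) X {..<Suc N}"
    unfolding X_def using mono \<tau>0 by (intro levy_processD(6)[OF levy]) simp_all
  then have "indep_var (PiM {N} (\<lambda>_. borel)) (\<lambda>\<omega>. restrict (\<lambda>i. X i \<omega>) {N})
      (PiM {..<N} (\<lambda>_. borel)) (\<lambda>\<omega>. restrict (\<lambda>i. X i \<omega>) {..<N})"
    by (rule indep_var_restrict) auto
  moreover have [measurable]: "(\<lambda>x. exp (real k * x N)) \<in> borel_measurable (PiM {N} (\<lambda>_. borel))"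
    by measurable
  moreover define G where "G y = exp (real b * (\<Sum>j<N. y j)) *
      h (\<Sum>i<N. s / real N * exp (- (\<Sum>j<Suc i. y j)))" for y :: "nat \<Rightarrow> real"
  have "(\<lambda>y. \<Sum>j<m. y j) \<in> borel_measurable (PiM {..<N} (\<lambda>_. borel :: real measure))" if "m \<le> N" for m
    using that by (intro borel_measurable_sum measurable_component_singleton) auto
  then have "G \<in> borel_measurable (PiM {..<N} (\<lambda>_. borel))"
    unfolding G_def
    by (intro borel_measurable_times measurable_compose[OF _ assms(3)] borel_measurable_sum borel_measurable_const
       borel_measurable_exp borel_measurable_uminus) auto
  ultimately have "indep_var borel ((\<lambda>x. exp (real k * x N)) \<circ> (\<lambda>\<omega>. restrict (\<lambda>i. X i \<omega>) {N}))
      borel (G \<circ> (\<lambda>\<omega>. restrict (\<lambda>i. X i \<omega>) {..<N}))"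
    by (intro indep_var_compose)
  moreover have "(\<lambda>x. exp (real k * x N)) \<circ> (\<lambda>\<omega>. restrict (\<lambda>i. X i \<omega>) {N}) =
      (\<lambda>\<omega>. exp (real k * (\<xi> t \<omega> - \<xi> s \<omega>)))"
    by (simp add: fun_eq_iff X_def \<tau>N \<tau>S)
  moreover have "G \<circ> (\<lambda>\<omega>. restrict (\<lambda>i. X i \<omega>) {..<N}) = grid_functional b h s n"
  proof
    fix \<omega>
    have tel: "(\<Sum>j<m. restrict (\<lambda>i. X i \<omega>) {..<N} j) = \<xi> (\<tau> m) \<omega> - \<xi> 0 \<omega>" if "m \<le> N" for m
    proof -
      have "(\<Sum>j<m. restrict (\<lambda>i. X i \<omega>) {..<N} j) = (\<Sum>j<m. \<xi> (\<tau> (Suc j)) \<omega> - \<xi> (\<tau> j) \<omega>)"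
        using that by (intro sum.cong) (auto simp: X_def)
      also have "\<dots> = \<xi> (\<tau> m) \<omega> - \<xi> (\<tau> 0) \<omega>" by (rule sum_lessThan_telescope)
      finally show ?thesis by (simp only: \<tau>0)
    qed
    have "(\<Sum>i<N. s / real N * exp (- (\<Sum>j<Suc i. restrict (\<lambda>i. X i \<omega>) {..<N} j))) =
        (\<Sum>i<N. s / real N * exp (- (\<xi> (s / real N * (real i + 1)) \<omega> - \<xi> 0 \<omega>)))"
    proof (rule sum.cong[OF refl])
      fix i assume "i \<in> {..<N}"
      then have i: "Suc i \<le> N" by simp
      then have "\<tau> (Suc i) = s / real N * (real i + 1)" unfolding \<tau>_def by (simp add: add.commute)
      then show "s / real N * exp (- (\<Sum>j<Suc i. restrict (\<lambda>i. X i \<omega>) {..<N} j)) =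
         s / real N * exp (- (\<xi> (s / real N * (real i + 1)) \<omega> - \<xi> 0 \<omega>))"
        using tel[OF i] by (simp only:)
    qed
    moreover have "(\<Sum>j<N. restrict (\<lambda>i. X i \<omega>) {..<N} j) = \<xi> s \<omega> - \<xi> 0 \<omega>"
      using tel[OF order_refl] by (simp only: \<tau>N)
    ultimately show "(G \<circ> (\<lambda>\<omega>. restrict (\<lambda>i. X i \<omega>) {..<N})) \<omega> = grid_functional b h s n \<omega>"
      unfolding G_def grid_functional_def N_def[symmetric] comp_def by (simp only:)
  qed
  ultimately show ?thesis by simp
qed

lemma grid_functional_AE:
  assumes "0 \<le> s" and cont: "continuous_on UNIV h"
  shows "AE \<omega> in M. (\<lambda>n. grid_functional b h s n \<omega>) \<longlonglongrightarrow> exp (real b * \<xi> s \<omega>) * h (A s \<omega>)"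
  using levy_processD(3)[OF levy] AE_space
proof eventually_elim
  case (elim \<omega>)
  have "(\<lambda>n. h (\<Sum>i<Suc n. s / real (Suc n) * exp (- \<xi> (s / real (Suc n) * (real i + 1)) \<omega>))) \<longlonglongrightarrow> h (A s \<omega>)"
    by (rule continuous_on_tendsto_compose[OF cont exp_integral_Riemann[OF xi_cadlag[OF elim(2)] assms(1)]]) auto
  then show ?case
    unfolding grid_functional_def elim(1) diff_0_right by (intro tendsto_mult tendsto_const)
qed

text \<open>Independence of \<open>\<xi>(t) - \<xi>(s)\<close> from the pair \<open>(\<xi>(s), A(s))\<close>, in the form of a product formula,
obtained from the grids by dominated convergence.\<close>

lemma increment_factor_continuous:
  assumes st: "0 \<le> s" "s \<le> t" and cont: "continuous_on UNIV h" and bound: "\<And>a. \<bar>h a\<bar> \<le> C"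
  shows "(\<integral>\<omega>. exp (real k * (\<xi> t \<omega> - \<xi> s \<omega>)) * (exp (real b * \<xi> s \<omega>) * h (A s \<omega>)) \<partial>M) =
     exp (\<kappa> k * (t - s)) * (\<integral>\<omega>. exp (real b * \<xi> s \<omega>) * h (A s \<omega>) \<partial>M)"
    and "integrable M (\<lambda>\<omega>. exp (real k * (\<xi> t \<omega> - \<xi> s \<omega>)) * exp (real b * \<xi> s \<omega>))"
proof -
  have t: "0 \<le> t" using st by simp
  note [measurable] = xi_measurable[OF st(1)] xi_measurable[OF t]
  have hm [measurable]: "h \<in> borel_measurable borel" using cont by (rule borel_measurable_continuous_onI)
  let ?D = "\<lambda>\<omega>. exp (real k * (\<xi> t \<omega> - \<xi> s \<omega>))"
  have xi0 [measurable]: "\<xi> 0 \<in> borel_measurable M" by (rule xi_measurable) simp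
  have [measurable]: "grid_functional b h' s n \<in> borel_measurable M"
    if [measurable]: "h' \<in> borel_measurable borel" for h' n
    using indep_increment_grid[OF st that, of k b n] by (rule indep_var_rv2)
  have E0: "AE \<omega> in M. exp (real b * (\<xi> s \<omega> - \<xi> 0 \<omega>)) = exp (real b * \<xi> s \<omega>)"
    using levy_processD(3)[OF levy] by eventually_elim simp
  have int0: "integrable M (\<lambda>\<omega>. exp (real b * (\<xi> s \<omega> - \<xi> 0 \<omega>)))"
    using moment_integrable[OF st(1), of b] by (subst integrable_cong_AE[OF _ _ E0]) measurable
  have bnd: "\<bar>grid_functional b h s n \<omega>\<bar> \<le> exp (real b * (\<xi> s \<omega> - \<xi> 0 \<omega>)) * C" for n \<omega>
    unfolding grid_functional_def abs_mult by (simp add: mult_left_mono bound)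
  have C: "0 \<le> C" using bound[of 0] by linarith
  have intg: "integrable M (grid_functional b h s n)" for n
    by (rule Bochner_Integration.integrable_bound[OF integrable_mult_left[OF int0, of C]])
      (use bnd C in \<open>simp_all add: abs_mult\<close>)
  have one: "grid_functional b (\<lambda>_. 1) s 0 = (\<lambda>\<omega>. exp (real b * (\<xi> s \<omega> - \<xi> 0 \<omega>)))"
    by (simp add: grid_functional_def fun_eq_iff)
  have "integrable M (\<lambda>\<omega>. ?D \<omega> * exp (real b * (\<xi> s \<omega> - \<xi> 0 \<omega>)))"
    using indep_var_integrable[OF indep_increment_grid[OF st, of "\<lambda>_. 1" k b 0] increment_moment(1)[OF st]]
    unfolding one using int0 by simp
  then show intp: "integrable M (\<lambda>\<omega>. ?D \<omega> * exp (real b * \<xi> s \<omega>))"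
    using E0 by (subst (asm) integrable_cong_AE[of _ _ "\<lambda>\<omega>. ?D \<omega> * exp (real b * \<xi> s \<omega>)"]) (auto elim: eventually_mono)
  have fac: "(\<integral>\<omega>. ?D \<omega> * grid_functional b h s n \<omega> \<partial>M) = exp (\<kappa> k * (t - s)) * (\<integral>\<omega>. grid_functional b h s n \<omega> \<partial>M)" for n
    using indep_var_lebesgue_integral[OF indep_increment_grid[OF st hm, of k b n] increment_moment(1)[OF st] intg]
    unfolding increment_moment(2)[OF st] .
  have "(\<lambda>n. \<integral>\<omega>. grid_functional b h s n \<omega> \<partial>M) \<longlonglongrightarrow> (\<integral>\<omega>. exp (real b * \<xi> s \<omega>) * h (A s \<omega>) \<partial>M)"
  proof (rule integral_dominated_convergence[where w = "\<lambda>\<omega>. exp (real b * (\<xi> s \<omega> - \<xi> 0 \<omega>)) * C"])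
    show "AE \<omega> in M. norm (grid_functional b h s n \<omega>) \<le> exp (real b * (\<xi> s \<omega> - \<xi> 0 \<omega>)) * C" for n
      using bnd by simp
  qed (use int0 grid_functional_AE[OF st(1) cont] in simp_all)
  then have lim1: "(\<lambda>n. exp (\<kappa> k * (t - s)) * (\<integral>\<omega>. grid_functional b h s n \<omega> \<partial>M)) \<longlonglongrightarrow>
      exp (\<kappa> k * (t - s)) * (\<integral>\<omega>. exp (real b * \<xi> s \<omega>) * h (A s \<omega>) \<partial>M)"
    by (intro tendsto_mult tendsto_const)
  have lim2: "(\<lambda>n. \<integral>\<omega>. ?D \<omega> * grid_functional b h s n \<omega> \<partial>M) \<longlonglongrightarrow>
      (\<integral>\<omega>. ?D \<omega> * (exp (real b * \<xi> s \<omega>) * h (A s \<omega>)) \<partial>M)"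
  proof (rule integral_dominated_convergence[where w = "\<lambda>\<omega>. ?D \<omega> * exp (real b * \<xi> s \<omega>) * C"])
    show "AE \<omega> in M. norm (?D \<omega> * grid_functional b h s n \<omega>) \<le> ?D \<omega> * exp (real b * \<xi> s \<omega>) * C" for n
      using E0
    proof eventually_elim
      case (elim \<omega>)
      have "\<bar>grid_functional b h s n \<omega>\<bar> \<le> exp (real b * \<xi> s \<omega>) * C" using bnd[of n \<omega>] unfolding elim .
      then show ?case by (simp add: abs_mult mult.assoc)
    qed
    show "AE \<omega> in M. (\<lambda>n. ?D \<omega> * grid_functional b h s n \<omega>) \<longlonglongrightarrow> ?D \<omega> * (exp (real b * \<xi> s \<omega>) * h (A s \<omega>))"
      using grid_functional_AE[OF st(1) cont, of b] by eventually_elim (intro tendsto_mult tendsto_const)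
  qed (use intp in simp_all)
  show "(\<integral>\<omega>. ?D \<omega> * (exp (real b * \<xi> s \<omega>) * h (A s \<omega>)) \<partial>M) =
     exp (\<kappa> k * (t - s)) * (\<integral>\<omega>. exp (real b * \<xi> s \<omega>) * h (A s \<omega>) \<partial>M)"
    using LIMSEQ_unique[OF lim2] lim1 unfolding fac by blast
qed

text \<open>The truncated power is a bounded pointwise limit of continuous functions on \<open>[0,\<infinity>)\<close>; for \<open>j = 0\<close> it is itself
discontinuous.\<close>

lemma increment_factor:
  assumes st: "0 \<le> s" "s \<le> t" and x: "0 \<le> x"
  shows "(\<integral>\<omega>. exp (real k * (\<xi> t \<omega> - \<xi> s \<omega>)) * (exp (real b * \<xi> s \<omega>) * truncated_power j x (A s \<omega>)) \<partial>M) =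
     exp (\<kappa> k * (t - s)) * (\<integral>\<omega>. exp (real b * \<xi> s \<omega>) * truncated_power j x (A s \<omega>) \<partial>M)"
    and "integrable M (\<lambda>\<omega>. exp (real k * (\<xi> t \<omega> - \<xi> s \<omega>)) * (exp (real b * \<xi> s \<omega>) * truncated_power j x (A s \<omega>)))"
proof -
  have t: "0 \<le> t" using st by simp
  note [measurable] = xi_measurable[OF st(1)] xi_measurable[OF t]
  let ?D = "\<lambda>\<omega>. exp (real k * (\<xi> t \<omega> - \<xi> s \<omega>))"
  let ?W = "truncated_power j x"
  \<comment> \<open>A ramp of slope \<open>- p\<close> to the right of \<open>x\<close> replaces the jump of the indicator.\<close>
  define h where "h p a = max 0 (1 - real p * max 0 (a - x)) * \<bar>max 0 (x - max 0 a)\<bar> ^ j" for p :: nat and a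
  have hc: "continuous_on UNIV (h p)" for p
    unfolding h_def by (intro continuous_intros)
  have hb: "\<bar>h p a\<bar> \<le> x ^ j" for p a
  proof -
    have "\<bar>max 0 (x - max 0 a)\<bar> ^ j \<le> x ^ j" using x by (intro power_mono) auto
    moreover have "max 0 (1 - real p * max 0 (a - x)) \<le> 1" by simp
    ultimately have "max 0 (1 - real p * max 0 (a - x)) * \<bar>max 0 (x - max 0 a)\<bar> ^ j \<le> 1 * x ^ j"
      by (intro mult_mono) auto
    then show ?thesis unfolding h_def by (simp add: abs_mult)
  qed
  have hl: "(\<lambda>p. h p a) \<longlonglongrightarrow> ?W a" if "0 \<le> a" for a
  proof (cases "a \<le> x")
    case True
    then show ?thesis using that by (simp add: h_def truncated_power_def)
  next
    case False
    then have "eventually (\<lambda>p. 1 / (a - x) \<le> real p) sequentially"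
      using filterlim_real_sequentially unfolding filterlim_at_top by blast
    then have "eventually (\<lambda>p. h p a = ?W a) sequentially"
      by eventually_elim (use False in \<open>simp add: h_def truncated_power_def max_def field_simps\<close>)
    then show ?thesis by (rule tendsto_eventually)
  qed
  note fac = increment_factor_continuous(1)[OF st hc hb, of k b]
  note intp = increment_factor_continuous(2)[OF st hc[of 0] hb[of 0], of k b]
  have [measurable]: "h p \<in> borel_measurable borel" for p using hc by (rule borel_measurable_continuous_onI)
  have lim1: "(\<lambda>p. \<integral>\<omega>. exp (real b * \<xi> s \<omega>) * h p (A s \<omega>) \<partial>M) \<longlonglongrightarrow> (\<integral>\<omega>. exp (real b * \<xi> s \<omega>) * ?W (A s \<omega>) \<partial>M)"
  proof (rule integral_dominated_convergence[where w = "\<lambda>\<omega>. exp (real b * \<xi> s \<omega>) * x ^ j"])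
    show "AE \<omega> in M. (\<lambda>p. exp (real b * \<xi> s \<omega>) * h p (A s \<omega>)) \<longlonglongrightarrow> exp (real b * \<xi> s \<omega>) * ?W (A s \<omega>)"
      using AE_space by eventually_elim (intro tendsto_mult tendsto_const hl A_nonneg st)
  qed (use moment_integrable[OF st(1), of b] hb in \<open>simp_all add: abs_mult mult_left_mono\<close>)
  have lim2: "(\<lambda>p. \<integral>\<omega>. ?D \<omega> * (exp (real b * \<xi> s \<omega>) * h p (A s \<omega>)) \<partial>M) \<longlonglongrightarrow>
      (\<integral>\<omega>. ?D \<omega> * (exp (real b * \<xi> s \<omega>) * ?W (A s \<omega>)) \<partial>M)"
  proof (rule integral_dominated_convergence[where w = "\<lambda>\<omega>. ?D \<omega> * exp (real b * \<xi> s \<omega>) * x ^ j"])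
    show "AE \<omega> in M. (\<lambda>p. ?D \<omega> * (exp (real b * \<xi> s \<omega>) * h p (A s \<omega>))) \<longlonglongrightarrow> ?D \<omega> * (exp (real b * \<xi> s \<omega>) * ?W (A s \<omega>))"
      using AE_space by eventually_elim (intro tendsto_mult tendsto_const hl A_nonneg st)
    show "AE \<omega> in M. norm (?D \<omega> * (exp (real b * \<xi> s \<omega>) * h p (A s \<omega>))) \<le> ?D \<omega> * exp (real b * \<xi> s \<omega>) * x ^ j" for p
      using hb by (intro AE_I2) (simp add: abs_mult mult.assoc)
  qed (use intp in simp_all)
  have lim1': "(\<lambda>p. exp (\<kappa> k * (t - s)) * (\<integral>\<omega>. exp (real b * \<xi> s \<omega>) * h p (A s \<omega>) \<partial>M)) \<longlonglongrightarrow>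
     exp (\<kappa> k * (t - s)) * (\<integral>\<omega>. exp (real b * \<xi> s \<omega>) * ?W (A s \<omega>) \<partial>M)"
    by (intro tendsto_mult tendsto_const lim1)
  show "(\<integral>\<omega>. ?D \<omega> * (exp (real b * \<xi> s \<omega>) * ?W (A s \<omega>)) \<partial>M) =
     exp (\<kappa> k * (t - s)) * (\<integral>\<omega>. exp (real b * \<xi> s \<omega>) * ?W (A s \<omega>) \<partial>M)"
    using LIMSEQ_unique[OF lim2] lim1' unfolding fac by blast
  show "integrable M (\<lambda>\<omega>. ?D \<omega> * (exp (real b * \<xi> s \<omega>) * ?W (A s \<omega>)))"
  proof (rule Bochner_Integration.integrable_bound[OF integrable_mult_left[OF intp, of "x ^ j"]])
    show "AE \<omega> in M. norm (?D \<omega> * (exp (real b * \<xi> s \<omega>) * ?W (A s \<omega>))) \<le> norm (?D \<omega> * exp (real b * \<xi> s \<omega>) * x ^ j)"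
      using AE_space
    proof eventually_elim
      case (elim \<omega>)
      have "0 \<le> ?W (A s \<omega>)" "?W (A s \<omega>) \<le> x ^ j"
        using truncated_power_nonneg truncated_power_le[OF A_nonneg[OF elim st(1)] x] by auto
      then show ?case using x by (simp add: abs_mult mult.assoc)
    qed
  qed measurable
qed

end

section \<open>The moment recursion\<close>

lemma exp_mult_le_exp_abs:
  fixes c s :: real
  assumes "0 \<le> s" "s \<le> 1"
  shows "exp (c * s) \<le> exp \<bar>c\<bar>"
proof -
  have "c * s \<le> \<bar>c\<bar> * 1" using assms by (intro mult_mono) auto
  then show ?thesis by simp
qed

lemma set_integrable_bounded_Icc:
  fixes f :: "real \<Rightarrow> real"
  assumes "f \<in> borel_measurable borel" "\<And>s. a \<le> s \<Longrightarrow> s \<le> b \<Longrightarrow> \<bar>f s\<bar> \<le> B"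
  shows "set_integrable lborel {a..b} f"
  unfolding set_integrable_def
  by (rule integrableI_bounded_set_indicator[where B = B]) (use assms in \<open>auto simp: emeasure_lborel_Icc_eq\<close>)

text \<open>Integration by parts for \<open>exp (c t)\<close> and the indefinite integral of a bounded measurable \<open>f\<close>, proved by Fubini on the triangle
\<open>0 \<le> s \<le> t \<le> 1\<close>.  This covers the discontinuous \<open>f\<close> that come from \<open>t \<mapsto> P(A(t) \<le> x)\<close>.\<close>

lemma triangle_integral:
  fixes f :: "real \<Rightarrow> real"
  assumes [measurable]: "f \<in> borel_measurable borel"
    and bound: "\<And>s. 0 \<le> s \<Longrightarrow> s \<le> 1 \<Longrightarrow> \<bar>f s\<bar> \<le> B"
  shows "c * (LINT t:{0..1}|lborel. exp (c * t) * (LINT s:{0..t}|lborel. f s)) =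
     exp c * (LINT s:{0..1}|lborel. f s) - (LINT s:{0..1}|lborel. exp (c * s) * f s)"
proof -
  define F where "F s t = (if 0 \<le> s \<and> s \<le> t \<and> t \<le> 1 then c * exp (c * t) * f s else 0)" for s t :: real
  have [measurable]: "case_prod F \<in> borel_measurable (lborel \<Otimes>\<^sub>M lborel)"
    unfolding F_def by measurable
  have Fb: "norm (F s t) \<le> \<bar>c\<bar> * exp \<bar>c\<bar> * B" if "s \<in> {0..1}" "t \<in> {0..1}" for s t
  proof (cases "0 \<le> s \<and> s \<le> t \<and> t \<le> 1")
    case True
    have B: "0 \<le> B" using bound[of 0] by simp
    have "exp (c * t) \<le> exp \<bar>c\<bar>" using that by (intro exp_mult_le_exp_abs) auto
    then have "\<bar>c\<bar> * exp (c * t) * \<bar>f s\<bar> \<le> \<bar>c\<bar> * exp \<bar>c\<bar> * B"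
      using bound[of s] that B by (intro mult_mono) auto
    then show ?thesis using True by (simp add: F_def abs_mult)
  next
    case False
    then have "F s t = 0" unfolding F_def by auto
    then show ?thesis using bound[of 0] by simp
  qed
  have "integrable (lborel \<Otimes>\<^sub>M lborel) (\<lambda>p. indicator ({0..1} \<times> {0..1}) p *\<^sub>R case_prod F p)"
  proof (rule integrableI_bounded_set_indicator)
    show "emeasure (lborel \<Otimes>\<^sub>M lborel) ({0..1::real} \<times> {0..1::real}) < \<infinity>"
      by (subst lborel.emeasure_pair_measure_Times) auto
    show "AE p\<in>{0..1} \<times> {0..1} in lborel \<Otimes>\<^sub>M lborel. norm (case_prod F p) \<le> \<bar>c\<bar> * exp \<bar>c\<bar> * B"
      using Fb by (intro AE_I2) auto
  qed auto
  moreover have "indicator ({0..1} \<times> {0..1}) p *\<^sub>R case_prod F p = case_prod F p" for p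
    by (auto simp: F_def indicator_def split: prod.split)
  ultimately have int: "integrable (lborel \<Otimes>\<^sub>M lborel) (case_prod F)" by (simp only:)
  have "(\<integral>t. \<integral>s. F s t \<partial>lborel \<partial>lborel) = (\<integral>s. \<integral>t. F s t \<partial>lborel \<partial>lborel)"
    using lborel_pair.Fubini_integral[OF int] .
  also have "(\<integral>t. \<integral>s. F s t \<partial>lborel \<partial>lborel) =
      c * (LINT t:{0..1}|lborel. exp (c * t) * (LINT s:{0..t}|lborel. f s))"
  proof -
    have "(\<integral>s. F s t \<partial>lborel) = c * (indicator {0..1} t *\<^sub>R (exp (c * t) * (LINT s:{0..t}|lborel. f s)))" for t
    proof (cases "t \<in> {0..1}")
      case True
      have "(\<integral>s. F s t \<partial>lborel) = (\<integral>s. c * exp (c * t) * (indicator {0..t} s *\<^sub>R f s) \<partial>lborel)"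
        by (rule Bochner_Integration.integral_cong) (use True in \<open>auto simp: F_def indicator_def\<close>)
      then show ?thesis using True by (simp add: set_lebesgue_integral_def)
    next
      case False
      then have "F s t = 0" for s by (auto simp: F_def)
      then show ?thesis using False by simp
    qed
    then show ?thesis by (simp add: set_lebesgue_integral_def)
  qed
  also have "(\<integral>s. \<integral>t. F s t \<partial>lborel \<partial>lborel) =
      (\<integral>s. exp c * (indicator {0..1} s *\<^sub>R f s) - indicator {0..1} s *\<^sub>R (exp (c * s) * f s) \<partial>lborel)"
  proof (rule Bochner_Integration.integral_cong[OF refl])
    fix s :: real
    show "(\<integral>t. F s t \<partial>lborel) = exp c * (indicator {0..1} s *\<^sub>R f s) - indicator {0..1} s *\<^sub>R (exp (c * s) * f s)"
    proof (cases "s \<in> {0..1}")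
      case True
      have "(\<integral>t. F s t \<partial>lborel) = (\<integral>t. f s * (c * exp (c * t) * indicator {s..1} t) \<partial>lborel)"
        by (rule Bochner_Integration.integral_cong) (use True in \<open>auto simp: F_def indicator_def\<close>)
      also have "\<dots> = f s * (\<integral>t. c * exp (c * t) * indicator {s..1} t \<partial>lborel)" by simp
      also have "(\<integral>t. c * exp (c * t) * indicator {s..1} t \<partial>lborel) = exp (c * 1) - exp (c * s)"
        by (rule integral_FTC_Icc_real)
          (use True in \<open>auto intro!: derivative_eq_intros continuous_intros\<close>)
      finally show ?thesis using True by (simp add: algebra_simps)
    next
      case False
      then have "F s t = 0" for t by (auto simp: F_def)
      then show ?thesis using False by simp
    qed
  qed
  also have "\<dots> = exp c * (LINT s:{0..1}|lborel. f s) - (LINT s:{0..1}|lborel. exp (c * s) * f s)"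
  proof -
    have i1: "set_integrable lborel {0..1} f"
      by (rule set_integrable_bounded_Icc[OF assms])
    have i2: "set_integrable lborel {0..1} (\<lambda>s. exp (c * s) * f s)"
    proof (rule set_integrable_bounded_Icc)
      show "\<bar>exp (c * s) * f s\<bar> \<le> exp \<bar>c\<bar> * B" if "0 \<le> s" "s \<le> 1" for s
        unfolding abs_mult using bound[OF that] exp_mult_le_exp_abs[OF that] by (intro mult_mono) auto
    qed measurable
    show ?thesis using i1 i2 unfolding set_lebesgue_integral_def set_integrable_def
      by (subst Bochner_Integration.integral_diff) auto
  qed
  finally show ?thesis .
qed

context levy_exp_moments begin

text \<open>The expectation \<open>E[exp (k \<xi>(t)) ((x - A(t))\<^sub>+)\<^sup>k]\<close>, the \<open>k\<close>-th moment of the positive part of the generalised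
Ornstein-Uhlenbeck process \<open>exp (\<xi>(t)) (x - A(t))\<close>.\<close>

definition truncated_moment :: "nat \<Rightarrow> real \<Rightarrow> real \<Rightarrow> real" where
  "truncated_moment k x t = (\<integral>\<omega>. exp (real k * \<xi> (max 0 t) \<omega>) * truncated_power k x (A (max 0 t) \<omega>) \<partial>M)"

lemma xi_jointly_measurable [measurable]:
  "(\<lambda>p. \<xi> (max 0 (fst p)) (snd p)) \<in> borel_measurable (borel \<Otimes>\<^sub>M M)"
  by (rule cadlag_joint_measurable[OF xi_measurable xi_cadlag])

lemma A_clamped_measurable [measurable]:
  "(\<lambda>p. A (max 0 (fst p)) (snd p)) \<in> borel_measurable (borel \<Otimes>\<^sub>M M)"
  using measurable_compose[OF _ A_jointly_measurable, of "\<lambda>p. (max 0 (fst p), snd p)" "borel \<Otimes>\<^sub>M M"]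
  by simp

lemma truncated_moment_measurable [measurable]: "truncated_moment k x \<in> borel_measurable borel"
  unfolding truncated_moment_def[abs_def]
  by (intro borel_measurable_lebesgue_integral) (simp add: split_beta')

lemma truncated_moment_eq:
  "0 \<le> t \<Longrightarrow> truncated_moment k x t = (\<integral>\<omega>. exp (real k * \<xi> t \<omega>) * truncated_power k x (A t \<omega>) \<partial>M)"
  by (simp add: truncated_moment_def max_def)

lemma truncated_moment_integrable:
  assumes "0 \<le> t" "0 \<le> x"
  shows "integrable M (\<lambda>\<omega>. exp (real k * \<xi> t \<omega>) * truncated_power k x (A t \<omega>))"
proof (rule Bochner_Integration.integrable_bound[OF integrable_mult_left[OF moment_integrable[OF assms(1), of k], of "x ^ k"]])
  note [measurable] = xi_measurable[OF assms(1)]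
  show "(\<lambda>\<omega>. exp (real k * \<xi> t \<omega>) * truncated_power k x (A t \<omega>)) \<in> borel_measurable M" by measurable
  show "AE \<omega> in M. norm (exp (real k * \<xi> t \<omega>) * truncated_power k x (A t \<omega>)) \<le> norm (exp (real k * \<xi> t \<omega>) * x ^ k)"
    using AE_space
  proof eventually_elim
    case (elim \<omega>)
    show ?case using truncated_power_nonneg[of k x "A t \<omega>"] truncated_power_le[OF A_nonneg[OF elim assms(1)] assms(2), of k] assms
      by (simp add: abs_mult)
  qed
qed

lemma truncated_moment_nonneg: "0 \<le> truncated_moment k x t"
  unfolding truncated_moment_def by (intro integral_nonneg_AE AE_I2) (simp add: truncated_power_nonneg)

lemma truncated_moment_le:
  assumes "0 \<le> t" "0 \<le> x"
  shows "truncated_moment k x t \<le> x ^ k * exp (\<kappa> k * t)"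
proof -
  have "truncated_moment k x t \<le> (\<integral>\<omega>. exp (real k * \<xi> t \<omega>) * x ^ k \<partial>M)"
    unfolding truncated_moment_eq[OF assms(1)]
  proof (rule integral_mono_AE[OF truncated_moment_integrable[OF assms] integrable_mult_left[OF moment_integrable[OF assms(1)]]])
    show "AE \<omega> in M. exp (real k * \<xi> t \<omega>) * truncated_power k x (A t \<omega>) \<le> exp (real k * \<xi> t \<omega>) * x ^ k"
      using AE_space by eventually_elim (intro mult_left_mono truncated_power_le A_nonneg assms exp_ge_zero)
  qed
  then show ?thesis by (simp add: moment[OF assms(1)] mult.commute)
qed

lemma truncated_moment_bound_unit:
  assumes "0 \<le> s" "s \<le> 1" "0 \<le> x"
  shows "truncated_moment k x s \<le> x ^ k * exp \<bar>\<kappa> k\<bar>"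
proof -
  have "x ^ k * exp (\<kappa> k * s) \<le> x ^ k * exp \<bar>\<kappa> k\<bar>"
    using assms by (intro mult_left_mono exp_mult_le_exp_abs) auto
  then show ?thesis using truncated_moment_le[OF assms(1,3), of k] by linarith
qed

lemma killed_integrand_bound:
  assumes "0 \<le> t" "t \<le> 1" "0 \<le> x"
  shows "\<bar>exp (- q * t) * truncated_moment k x t\<bar> \<le> exp \<bar>q\<bar> * (x ^ k * exp \<bar>\<kappa> k\<bar>)"
  unfolding abs_mult
  using exp_mult_le_exp_abs[OF assms(1,2), of "- q"] truncated_moment_bound_unit[OF assms] truncated_moment_nonneg[of k x t]
  by (intro mult_mono) auto

lemma killed_integrand_integrable:
  "0 \<le> x \<Longrightarrow> set_integrable lborel {0..1} (\<lambda>t. exp (- q * t) * truncated_moment k x t)"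
  by (rule set_integrable_bounded_Icc[OF _ killed_integrand_bound]) measurable

text \<open>With \<open>n\<^sub>k = truncated_moment k x\<close>, the integrated form of \<open>n\<^sub>k\<^sub>+\<^sub>1' = \<kappa>(k+1) n\<^sub>k\<^sub>+\<^sub>1 - (k+1) n\<^sub>k\<close>.  Multiply the pathwise identity
\<open>x\<^sup>k\<^sup>+\<^sup>1 - ((x - A(t))\<^sub>+)\<^sup>k\<^sup>+\<^sup>1 = (k+1) \<integral>\<^sub>0\<^sup>t ((x - A(s))\<^sub>+)\<^sup>k exp (- \<xi>(s)) ds\<close> by
\<open>exp ((k+1) \<xi>(t))\<close>, take expectations, and split off the increment \<open>\<xi>(t) - \<xi>(s)\<close>: the remaining exponent
\<open>(k+1) \<xi>(s) - \<xi>(s)\<close> is again \<open>k \<xi>(s)\<close>, which closes the system.\<close>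

lemma truncated_moment_Duhamel:
  assumes t: "0 \<le> t" and x: "0 \<le> x"
  shows "truncated_moment (Suc k) x t = x ^ Suc k * exp (\<kappa> (Suc k) * t) -
     real (Suc k) * (LINT s:{0..t}|lborel. exp (\<kappa> (Suc k) * (t - s)) * truncated_moment k x s)"
proof -
  note [measurable] = xi_measurable[OF t]
  let ?K = "real (Suc k)"
  \<comment> \<open>On \<open>[0,t]\<close> this is \<open>exp ((k+1) \<xi>(t))\<close> times the integrand of the pathwise identity, arranged for the product formula.\<close>
  define g where "g s \<omega> = exp (?K * (\<xi> t \<omega> - \<xi> (max 0 s) \<omega>)) *
     (exp (real k * \<xi> (max 0 s) \<omega>) * truncated_power k x (A (max 0 s) \<omega>))" for s \<omega>
  have [measurable]: "(\<lambda>p. \<xi> t (snd p)) \<in> borel_measurable (lborel \<Otimes>\<^sub>M M)" by measurable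
  have gm [measurable]: "(\<lambda>p. g (fst p) (snd p)) \<in> borel_measurable (lborel \<Otimes>\<^sub>M M)"
    unfolding g_def by measurable
  interpret P: pair_sigma_finite lborel M ..
  have g0: "0 \<le> g s \<omega>" for s \<omega> unfolding g_def by (simp add: truncated_power_nonneg)
  have path: "(\<integral>\<^sup>+s. ennreal (g s \<omega>) * indicator {0..t} s \<partial>lborel) =
     ennreal (exp (?K * \<xi> t \<omega>) * ((x ^ Suc k - truncated_power (Suc k) x (A t \<omega>)) / ?K))"
    if \<omega>: "\<omega> \<in> space M" for \<omega>
  proof -
    note [measurable] = cadlag_measurable[OF xi_cadlag[OF \<omega>]]
    have "(\<integral>\<^sup>+s. ennreal (g s \<omega>) * indicator {0..t} s \<partial>lborel) =
        (\<integral>\<^sup>+s. ennreal (exp (?K * \<xi> t \<omega>)) *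
          (ennreal (truncated_power k x (A (max 0 s) \<omega>) * exp (- \<xi> (max 0 s) \<omega>)) * indicator {0..t} s) \<partial>lborel)"
    proof (rule nn_integral_cong)
      fix s :: real
      have "exp (?K * (\<xi> t \<omega> - \<xi> (max 0 s) \<omega>)) * exp (real k * \<xi> (max 0 s) \<omega>) =
          exp (?K * \<xi> t \<omega>) * exp (- \<xi> (max 0 s) \<omega>)"
        by (simp add: exp_add[symmetric] algebra_simps)
      then have "g s \<omega> = exp (?K * \<xi> t \<omega>) * (truncated_power k x (A (max 0 s) \<omega>) * exp (- \<xi> (max 0 s) \<omega>))"
        unfolding g_def by (simp add: mult_ac)
      then show "ennreal (g s \<omega>) * indicator {0..t} s = ennreal (exp (?K * \<xi> t \<omega>)) *
          (ennreal (truncated_power k x (A (max 0 s) \<omega>) * exp (- \<xi> (max 0 s) \<omega>)) * indicator {0..t} s)"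
        by (simp add: ennreal_mult truncated_power_nonneg mult.assoc)
    qed
    also have "\<dots> = ennreal (exp (?K * \<xi> t \<omega>)) *
        (\<integral>\<^sup>+s. ennreal (truncated_power k x (A (max 0 s) \<omega>) * exp (- \<xi> (max 0 s) \<omega>)) * indicator {0..t} s \<partial>lborel)"
    proof (rule nn_integral_cmult)
      have "(\<lambda>s. A (max 0 s) \<omega>) \<in> borel_measurable borel"
        using measurable_compose[OF _ A_clamped_measurable, of "\<lambda>s. (s, \<omega>)" borel] \<omega> by simp
      then show "(\<lambda>s. ennreal (truncated_power k x (A (max 0 s) \<omega>) * exp (- \<xi> (max 0 s) \<omega>)) * indicator {0..t} s)
         \<in> borel_measurable lborel" by measurable
    qed
    also have "(\<integral>\<^sup>+s. ennreal (truncated_power k x (A (max 0 s) \<omega>) * exp (- \<xi> (max 0 s) \<omega>)) * indicator {0..t} s \<partial>lborel) =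
       (\<integral>\<^sup>+s. ennreal (truncated_power k x (A s \<omega>) * exp (- \<xi> s \<omega>)) * indicator {0..t} s \<partial>lborel)"
      by (intro nn_integral_cong) (auto simp: indicator_def max_def)
    also have "\<dots> = ennreal ((x ^ Suc k - truncated_power (Suc k) x (A t \<omega>)) / ?K)"
      by (rule truncated_power_path_integral[OF xi_cadlag[OF \<omega>] t x])
    also have "ennreal (exp (?K * \<xi> t \<omega>)) * ennreal ((x ^ Suc k - truncated_power (Suc k) x (A t \<omega>)) / ?K) =
       ennreal (exp (?K * \<xi> t \<omega>) * ((x ^ Suc k - truncated_power (Suc k) x (A t \<omega>)) / ?K))"
      using truncated_power_le[OF A_nonneg[OF \<omega> t] x, of "Suc k"]
      by (intro ennreal_mult[symmetric] divide_nonneg_nonneg) auto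
    finally show ?thesis .
  qed
  have Eg: "(\<integral>\<^sup>+\<omega>. ennreal (g s \<omega>) \<partial>M) = ennreal (exp (\<kappa> (Suc k) * (t - s)) * truncated_moment k x s)"
    if "0 \<le> s" "s \<le> t" for s
  proof -
    have gs: "g s = (\<lambda>\<omega>. exp (?K * (\<xi> t \<omega> - \<xi> s \<omega>)) *
        (exp (real k * \<xi> s \<omega>) * truncated_power k x (A s \<omega>)))"
      using that by (simp add: g_def fun_eq_iff max_def)
    have "(\<integral>\<^sup>+\<omega>. ennreal (g s \<omega>) \<partial>M) = ennreal (\<integral>\<omega>. g s \<omega> \<partial>M)"
    proof (rule nn_integral_eq_integral)
      show "integrable M (g s)" unfolding gs by (rule increment_factor(2)[OF that x])
    qed (simp add: g0)
    also have "(\<integral>\<omega>. g s \<omega> \<partial>M) = exp (\<kappa> (Suc k) * (t - s)) * truncated_moment k x s"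
      unfolding gs truncated_moment_eq[OF that(1)] by (rule increment_factor(1)[OF that x])
    finally show ?thesis .
  qed
  have int1: "integrable M (\<lambda>\<omega>. exp (?K * \<xi> t \<omega>) * ((x ^ Suc k - truncated_power (Suc k) x (A t \<omega>)) / ?K))"
  proof -
    have "integrable M (\<lambda>\<omega>. (exp (?K * \<xi> t \<omega>) * x ^ Suc k - exp (?K * \<xi> t \<omega>) * truncated_power (Suc k) x (A t \<omega>)) / ?K)"
      by (intro integrable_divide Bochner_Integration.integrable_diff integrable_mult_left
         moment_integrable truncated_moment_integrable t x)
    then show ?thesis by (simp only: right_diff_distrib times_divide_eq_right)
  qed
  have val1: "(\<integral>\<omega>. exp (?K * \<xi> t \<omega>) * ((x ^ Suc k - truncated_power (Suc k) x (A t \<omega>)) / ?K) \<partial>M) =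
     (x ^ Suc k * exp (\<kappa> (Suc k) * t) - truncated_moment (Suc k) x t) / ?K"
  proof -
    have "(\<integral>\<omega>. exp (?K * \<xi> t \<omega>) * ((x ^ Suc k - truncated_power (Suc k) x (A t \<omega>)) / ?K) \<partial>M) =
      (\<integral>\<omega>. (exp (?K * \<xi> t \<omega>) * x ^ Suc k - exp (?K * \<xi> t \<omega>) * truncated_power (Suc k) x (A t \<omega>)) / ?K \<partial>M)"
      by (simp only: right_diff_distrib times_divide_eq_right)
    also have "\<dots> = ((\<integral>\<omega>. exp (?K * \<xi> t \<omega>) * x ^ Suc k \<partial>M) - truncated_moment (Suc k) x t) / ?K"
      unfolding truncated_moment_eq[OF t]
      by (subst integral_divide_zero, subst Bochner_Integration.integral_diff)
        (intro integrable_mult_left moment_integrable truncated_moment_integrable t x refl)+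
    also have "(\<integral>\<omega>. exp (?K * \<xi> t \<omega>) * x ^ Suc k \<partial>M) = x ^ Suc k * exp (\<kappa> (Suc k) * t)"
      unfolding integral_mult_left_zero moment[OF t] by (rule mult.commute)
    finally show ?thesis .
  qed
  have "ennreal ((x ^ Suc k * exp (\<kappa> (Suc k) * t) - truncated_moment (Suc k) x t) / ?K) =
      (\<integral>\<^sup>+\<omega>. ennreal (exp (?K * \<xi> t \<omega>) * ((x ^ Suc k - truncated_power (Suc k) x (A t \<omega>)) / ?K)) \<partial>M)"
    unfolding val1[symmetric]
  proof (rule nn_integral_eq_integral[symmetric, OF int1])
    show "AE \<omega> in M. 0 \<le> exp (?K * \<xi> t \<omega>) * ((x ^ Suc k - truncated_power (Suc k) x (A t \<omega>)) / ?K)"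
      using AE_space
    proof eventually_elim
      case (elim \<omega>)
      show ?case using truncated_power_le[OF A_nonneg[OF elim t] x, of "Suc k"]
        by (intro mult_nonneg_nonneg divide_nonneg_nonneg) auto
    qed
  qed
  also have "\<dots> = (\<integral>\<^sup>+\<omega>. \<integral>\<^sup>+s. ennreal (g s \<omega>) * indicator {0..t} s \<partial>lborel \<partial>M)"
    by (intro nn_integral_cong) (simp only: path)
  also have "\<dots> = (\<integral>\<^sup>+s. \<integral>\<^sup>+\<omega>. ennreal (g s \<omega>) * indicator {0..t} s \<partial>M \<partial>lborel)"
    by (rule P.Fubini') (simp add: split_beta')
  also have "\<dots> = (\<integral>\<^sup>+s. ennreal (indicator {0..t} s *\<^sub>R (exp (\<kappa> (Suc k) * (t - s)) * truncated_moment k x s)) \<partial>lborel)"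
  proof (rule nn_integral_cong)
    fix s :: real
    show "(\<integral>\<^sup>+\<omega>. ennreal (g s \<omega>) * indicator {0..t} s \<partial>M) =
       ennreal (indicator {0..t} s *\<^sub>R (exp (\<kappa> (Suc k) * (t - s)) * truncated_moment k x s))"
      by (cases "s \<in> {0..t}") (simp_all add: Eg)
  qed
  also have "\<dots> = ennreal (LINT s:{0..t}|lborel. exp (\<kappa> (Suc k) * (t - s)) * truncated_moment k x s)"
    unfolding set_lebesgue_integral_def
  proof (rule nn_integral_eq_integral)
    have "set_integrable lborel {0..t} (\<lambda>s. exp (\<kappa> (Suc k) * (t - s)) * truncated_moment k x s)"
    proof (rule set_integrable_bounded_Icc)
      fix s assume s: "0 \<le> s" "s \<le> t"
      have "\<kappa> (Suc k) * (t - s) \<le> \<bar>\<kappa> (Suc k)\<bar> * t" "\<kappa> k * s \<le> \<bar>\<kappa> k\<bar> * t"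
        using s by (intro mult_mono; auto)+
      moreover have "truncated_moment k x s \<le> x ^ k * exp (\<kappa> k * s)" by (rule truncated_moment_le[OF s(1) x])
      ultimately show "\<bar>exp (\<kappa> (Suc k) * (t - s)) * truncated_moment k x s\<bar>
          \<le> exp (\<bar>\<kappa> (Suc k)\<bar> * t) * (x ^ k * exp (\<bar>\<kappa> k\<bar> * t))"
        unfolding abs_mult using truncated_moment_nonneg[of k x s] x
        by (intro mult_mono) (auto elim: order_trans intro!: mult_left_mono)
    qed measurable
    then show "integrable lborel (\<lambda>s. indicator {0..t} s *\<^sub>R (exp (\<kappa> (Suc k) * (t - s)) * truncated_moment k x s))"
      unfolding set_integrable_def .
  qed (auto simp: indicator_def truncated_moment_nonneg)
  finally have "ennreal ((x ^ Suc k * exp (\<kappa> (Suc k) * t) - truncated_moment (Suc k) x t) / ?K) =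
     ennreal (LINT s:{0..t}|lborel. exp (\<kappa> (Suc k) * (t - s)) * truncated_moment k x s)" .
  moreover have "0 \<le> (x ^ Suc k * exp (\<kappa> (Suc k) * t) - truncated_moment (Suc k) x t) / ?K"
    using truncated_moment_le[OF t x, of "Suc k"] by simp
  moreover have "0 \<le> (LINT s:{0..t}|lborel. exp (\<kappa> (Suc k) * (t - s)) * truncated_moment k x s)"
    unfolding set_lebesgue_integral_def by (intro integral_nonneg_AE AE_I2) (simp add: truncated_moment_nonneg)
  ultimately have "(x ^ Suc k * exp (\<kappa> (Suc k) * t) - truncated_moment (Suc k) x t) / ?K =
     (LINT s:{0..t}|lborel. exp (\<kappa> (Suc k) * (t - s)) * truncated_moment k x s)"
    by (simp only: ennreal_inj)
  then show ?thesis by (simp add: field_simps del: of_nat_Suc)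
qed

text \<open>Killing at rate \<open>q\<close> multiplies the moments by \<open>exp (- q t)\<close>; only times in the unit interval are taken into
account.\<close>

definition killed_moment :: "real \<Rightarrow> nat \<Rightarrow> real \<Rightarrow> real" where
  "killed_moment q k x = (LINT t:{0..1}|lborel. exp (- q * t) * truncated_moment k x t)"

text \<open>The Duhamel formula, multiplied by \<open>exp (- q t)\<close> and integrated over the unit interval; \<open>\<kappa>(k+1) - q\<close> takes the
place of \<open>\<Psi>(k+1)\<close>.\<close>

lemma killed_moment_recursion:
  assumes x: "0 \<le> x"
  shows "real (Suc k) * killed_moment q k x = x ^ Suc k - exp (- q) * truncated_moment (Suc k) x 1
     + (\<kappa> (Suc k) - q) * killed_moment q (Suc k) x"
proof -
  define c where "c = \<kappa> (Suc k) - q"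
  \<comment> \<open>With this \<open>f\<close>, the Duhamel formula reads \<open>exp (c t) (x\<^sup>k\<^sup>+\<^sup>1 - (k+1) \<integral>\<^sub>0\<^sup>t f)\<close>, which is integrated by parts below.\<close>
  define f where "f s = exp (- \<kappa> (Suc k) * s) * truncated_moment k x s" for s
  let ?K = "real (Suc k)"
  have [measurable]: "f \<in> borel_measurable borel" unfolding f_def by measurable
  have fb: "\<bar>f s\<bar> \<le> exp \<bar>- \<kappa> (Suc k)\<bar> * (x ^ k * exp \<bar>\<kappa> k\<bar>)" if "0 \<le> s" "s \<le> 1" for s
    unfolding f_def abs_mult
    using truncated_moment_bound_unit[OF that x, of k] truncated_moment_nonneg[of k x s] exp_mult_le_exp_abs[OF that, of "- \<kappa> (Suc k)"]
    by (intro mult_mono) auto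
  have duh: "exp (- q * t) * truncated_moment (Suc k) x t = x ^ Suc k * exp (c * t) - ?K * (exp (c * t) * (LINT s:{0..t}|lborel. f s))"
    if "0 \<le> t" for t
  proof -
    have "exp (\<kappa> (Suc k) * (t - s)) * truncated_moment k x s = exp (\<kappa> (Suc k) * t) * f s" for s
      unfolding f_def by (simp add: mult.assoc[symmetric] exp_add[symmetric] right_diff_distrib)
    then have "(LINT s:{0..t}|lborel. exp (\<kappa> (Suc k) * (t - s)) * truncated_moment k x s) =
        (LINT s:{0..t}|lborel. exp (\<kappa> (Suc k) * t) * f s)" by (simp only:)
    also have "\<dots> = exp (\<kappa> (Suc k) * t) * (LINT s:{0..t}|lborel. f s)" by simp
    finally have "exp (- q * t) * truncated_moment (Suc k) x t =
       exp (- q * t) * (x ^ Suc k * exp (\<kappa> (Suc k) * t) - ?K * (exp (\<kappa> (Suc k) * t) * (LINT s:{0..t}|lborel. f s)))"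
      using truncated_moment_Duhamel[OF that x, of k] by (simp only:)
    also have "\<dots> = x ^ Suc k * (exp (- q * t) * exp (\<kappa> (Suc k) * t)) -
       ?K * ((exp (- q * t) * exp (\<kappa> (Suc k) * t)) * (LINT s:{0..t}|lborel. f s))"
      by (simp only: right_diff_distrib mult_ac)
    also have "exp (- q * t) * exp (\<kappa> (Suc k) * t) = exp (c * t)"
      by (simp add: c_def exp_add[symmetric] left_diff_distrib)
    finally show ?thesis .
  qed
  have int: "set_integrable lborel {0..1} (\<lambda>t. exp (c * t) * (LINT s:{0..t}|lborel. f s))"
  proof -
    have "set_integrable lborel {0..1} (\<lambda>t. (x ^ Suc k * exp (c * t) - exp (- q * t) * truncated_moment (Suc k) x t) / ?K)"
    proof -
      have 1: "set_integrable lborel {0..1} (\<lambda>t. x ^ Suc k * exp (c * t))"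
        by (intro borel_integrable_compact[unfolded set_integrable_def[symmetric]] continuous_intros) auto
      show ?thesis by (rule set_integrable_divide) (rule set_integral_diff(1)[OF 1 killed_integrand_integrable[OF x]])
    qed
    moreover have "(x ^ Suc k * exp (c * t) - exp (- q * t) * truncated_moment (Suc k) x t) / ?K =
       exp (c * t) * (LINT s:{0..t}|lborel. f s)" if "t \<in> {0..1}" for t
    proof -
      have "?K \<noteq> 0" by simp
      then show ?thesis using duh[of t] that by (simp del: of_nat_Suc)
    qed
    ultimately show ?thesis by (subst (asm) set_integrable_cong) auto
  qed
  have "killed_moment q (Suc k) x =
      (LINT t:{0..1}|lborel. x ^ Suc k * exp (c * t) - ?K * (exp (c * t) * (LINT s:{0..t}|lborel. f s)))"
    unfolding killed_moment_def by (rule set_lebesgue_integral_cong) (use duh in auto)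
  also have "\<dots> = (LINT t:{0..1}|lborel. x ^ Suc k * exp (c * t)) -
      (LINT t:{0..1}|lborel. ?K * (exp (c * t) * (LINT s:{0..t}|lborel. f s)))"
    by (intro set_integral_diff(2) set_integrable_mult_right int
       borel_integrable_compact[unfolded set_integrable_def[symmetric]] continuous_intros) auto
  also have "(LINT t:{0..1}|lborel. ?K * (exp (c * t) * (LINT s:{0..t}|lborel. f s))) =
      ?K * (LINT t:{0..1}|lborel. exp (c * t) * (LINT s:{0..t}|lborel. f s))"
    by (rule set_integral_mult_right)
  also have "(LINT t:{0..1}|lborel. x ^ Suc k * exp (c * t)) = x ^ Suc k * (LINT t:{0..1}|lborel. exp (c * t))"
    by (rule set_integral_mult_right)
  finally have "c * killed_moment q (Suc k) x = x ^ Suc k * (c * (LINT t:{0..1}|lborel. exp (c * t))) -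
      ?K * (c * (LINT t:{0..1}|lborel. exp (c * t) * (LINT s:{0..t}|lborel. f s)))"
    by (simp add: right_diff_distrib mult.left_commute[of c] del: of_nat_Suc power_Suc)
  also have "c * (LINT t:{0..1}|lborel. exp (c * t)) = exp c - 1"
  proof -
    have "(\<integral>t. c * exp (c * t) * indicator {0..1} t \<partial>lborel) = exp (c * 1) - exp (c * 0)"
      by (rule integral_FTC_Icc_real) (auto intro!: derivative_eq_intros continuous_intros)
    then show ?thesis by (simp add: set_lebesgue_integral_def mult_ac)
  qed
  also have "c * (LINT t:{0..1}|lborel. exp (c * t) * (LINT s:{0..t}|lborel. f s)) =
      exp c * (LINT s:{0..1}|lborel. f s) - (LINT s:{0..1}|lborel. exp (c * s) * f s)"
    by (rule triangle_integral) (use fb in auto)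
  also have "(LINT s:{0..1}|lborel. exp (c * s) * f s) = killed_moment q k x"
  proof -
    have "exp (c * s) * f s = exp (- q * s) * truncated_moment k x s" for s
      unfolding f_def c_def by (simp add: mult.assoc[symmetric] exp_add[symmetric] left_diff_distrib)
    then show ?thesis unfolding killed_moment_def by (simp only:)
  qed
  finally have "c * killed_moment q (Suc k) x =
     (x ^ Suc k * exp c - ?K * (exp c * (LINT s:{0..1}|lborel. f s))) - x ^ Suc k + ?K * killed_moment q k x"
    by (simp add: algebra_simps del: of_nat_Suc)
  then show ?thesis using duh[of 1] by (simp add: c_def del: of_nat_Suc)
qed

lemma killed_moment_expansion:
  assumes x: "0 \<le> x"
  shows "killed_moment q 0 x =
     (\<Sum>i=1..N. (\<Prod>j\<in>{1..<i}. \<kappa> j - q) / fact i * (x ^ i - exp (- q) * truncated_moment i x 1))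
     + (\<Prod>j\<in>{1..<Suc N}. \<kappa> j - q) / fact N * killed_moment q N x"
proof (induction N)
  case 0
  then show ?case by simp
next
  case (Suc N)
  let ?p = "\<Prod>j\<in>{1..<Suc N}. \<kappa> j - q"
  have "killed_moment q N x = (x ^ Suc N - exp (- q) * truncated_moment (Suc N) x 1
     + (\<kappa> (Suc N) - q) * killed_moment q (Suc N) x) / real (Suc N)"
    unfolding killed_moment_recursion[OF x, of N q, symmetric] by (simp del: of_nat_Suc)
  moreover have "P / F * ((a + c * m) / n) = P / (n * F) * a + P * c / (n * F) * m" for P F a c m n :: real
    by (simp add: add_divide_distrib distrib_left mult_ac)
  ultimately have "?p / fact N * killed_moment q N x =
     ?p / (real (Suc N) * fact N) * (x ^ Suc N - exp (- q) * truncated_moment (Suc N) x 1)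
      + ?p * (\<kappa> (Suc N) - q) / (real (Suc N) * fact N) * killed_moment q (Suc N) x"
    by (simp only:)
  moreover have "real (Suc N) * fact N = fact (Suc N)" by simp
  moreover have "{1..<Suc (Suc N)} = insert (Suc N) {1..<Suc N}" by auto
  then have "(\<Prod>j\<in>{1..<Suc (Suc N)}. \<kappa> j - q) = ?p * (\<kappa> (Suc N) - q)" by (simp add: mult.commute)
  moreover have "{1..Suc N} = insert (Suc N) {1..N}" by auto
  then have "(\<Sum>i=1..Suc N. (\<Prod>j\<in>{1..<i}. \<kappa> j - q) / fact i * (x ^ i - exp (- q) * truncated_moment i x 1)) =
     (\<Sum>i=1..N. (\<Prod>j\<in>{1..<i}. \<kappa> j - q) / fact i * (x ^ i - exp (- q) * truncated_moment i x 1))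
     + ?p / fact (Suc N) * (x ^ Suc N - exp (- q) * truncated_moment (Suc N) x 1)" by simp
  ultimately show ?case using Suc.IH by (simp only: add.assoc)
qed

end

section \<open>Bounds of arbitrary polynomial order\<close>

lemma cadlag_cmult:
  assumes "cadlag f"
  shows "cadlag (\<lambda>t. c * f t)"
  unfolding cadlag_def
proof (intro conjI allI impI)
  fix t :: real assume "0 \<le> t"
  then show "continuous (at_right t) (\<lambda>t. c * f t)"
    using assms unfolding cadlag_def by (intro continuous_intros) blast
next
  fix t :: real assume "0 < t"
  then obtain l where "(f \<longlongrightarrow> l) (at_left t)" using assms unfolding cadlag_def by blast
  then show "\<exists>l. ((\<lambda>t. c * f t) \<longlongrightarrow> l) (at_left t)" by (intro exI[of _ "c * l"] tendsto_intros)
qed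

text \<open>With \<open>p = x exp y\<close> this is \<open>1 + j - j / p \<le> p\<^sup>j\<close>, the tangent of the convex function \<open>u \<mapsto> u\<^sup>-\<^sup>j\<close> at
\<open>u = 1\<close>, evaluated at \<open>u = 1 / p\<close>.\<close>

lemma convex_power_tangent:
  fixes x y :: real
  assumes x: "0 < x"
  shows "1 + real j - real j / x * exp (- y) \<le> x ^ j * exp (real j * y)"
proof -
  define p where "p = x * exp y"
  have p: "0 < p" using x by (simp add: p_def)
  have "1 + real j * (p - 1) \<le> (1 + (p - 1)) ^ j"
    by (rule Bernoulli_inequality) (use p in simp)
  also have "\<dots> = x ^ j * exp (real j * y)" by (simp add: p_def power_mult_distrib exp_of_nat_mult)
  finally have 1: "1 + real j * (p - 1) \<le> x ^ j * exp (real j * y)" .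
  have "0 \<le> (p - 1)\<^sup>2 / p" using p by simp
  also have "(p - 1)\<^sup>2 / p = (p - 1) - (1 - 1 / p)" using p by (simp add: power2_eq_square field_simps)
  finally have "real j * (1 - 1 / p) \<le> real j * (p - 1)" by (intro mult_left_mono) auto
  moreover have "real j / x * exp (- y) = real j * (1 / p)" by (simp add: p_def exp_minus field_simps)
  ultimately show ?thesis using 1 by (simp add: right_diff_distrib)
qed

text \<open>Jensen's inequality in disguise: integrating the tangent inequality over \<open>[0,1]\<close> shows that
\<open>A(1) \<le> x\<close> forces \<open>x\<^sup>j \<integral>\<^sub>0\<^sup>1 exp (j f(s)) ds \<ge> 1\<close>.\<close>

lemma exp_integral_small_ball:
  assumes f: "cadlag f" and x: "0 < x"
  shows "ennreal (truncated_power 0 x (exp_integral f 1)) \<le>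
     (\<integral>\<^sup>+s. ennreal (x ^ j * exp (real j * f (max 0 s))) * indicator {0..1} s \<partial>lborel)"
proof (cases "exp_integral f 1 \<le> x")
  case False
  then show ?thesis by (simp add: truncated_power_def)
next
  case True
  have i1: "set_integrable lborel {0..1} (\<lambda>s. exp (- f (max 0 s)))"
    by (rule cadlag_exp_set_integrable[OF f])
  have i2: "set_integrable lborel {0..1} (\<lambda>s. x ^ j * exp (real j * f (max 0 s)))"
    using set_integrable_mult_right[OF cadlag_exp_set_integrable[OF cadlag_cmult[OF f, of "- real j"], of 0 1]] by simp
  have i3: "set_integrable lborel {0..1::real} (\<lambda>s. 1 + real j)"
    by (simp add: set_integrable_def integrable_indicator_iff emeasure_lborel_Icc_eq)
  have A: "(LINT s:{0..1}|lborel. exp (- f (max 0 s))) = exp_integral f 1"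
    unfolding exp_integral_clamp set_lebesgue_integral_def by simp
  have "1 \<le> 1 + real j - real j / x * exp_integral f 1"
    using True x mult_left_mono[OF True, of "real j / x"] by simp
  also have "\<dots> = (LINT s:{0..1}|lborel. 1 + real j - real j / x * exp (- f (max 0 s)))"
    using set_integral_diff(2)[OF i3 set_integrable_mult_right[OF i1], of "real j / x"]
    by (simp add: A set_integral_mult_right) (simp add: set_lebesgue_integral_def)
  also have "\<dots> \<le> (LINT s:{0..1}|lborel. x ^ j * exp (real j * f (max 0 s)))"
    by (rule set_integral_mono[OF set_integral_diff(1)[OF i3 set_integrable_mult_right[OF i1]] i2])
      (rule convex_power_tangent[OF x])
  finally have "ennreal 1 \<le> ennreal (LINT s:{0..1}|lborel. x ^ j * exp (real j * f (max 0 s)))"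
    by (rule ennreal_leI)
  also have "\<dots> = (\<integral>\<^sup>+s. ennreal (indicator {0..1} s *\<^sub>R (x ^ j * exp (real j * f (max 0 s)))) \<partial>lborel)"
    unfolding set_lebesgue_integral_def
    using i2 x unfolding set_integrable_def by (intro nn_integral_eq_integral[symmetric]) auto
  also have "\<dots> = (\<integral>\<^sup>+s. ennreal (x ^ j * exp (real j * f (max 0 s))) * indicator {0..1} s \<partial>lborel)"
    by (intro nn_integral_cong) (simp add: indicator_def)
  finally show ?thesis using True by (simp add: truncated_power_def)
qed

context levy_exp_moments begin

lemma truncated_moment_0_prob:
  assumes "0 \<le> t"
  shows "truncated_moment 0 x t = prob {\<omega> \<in> space M. A t \<omega> \<le> x}"
proof -
  have "truncated_moment 0 x t = (\<integral>\<omega>. indicator {\<omega> \<in> space M. A t \<omega> \<le> x} \<omega> \<partial>M)"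
    unfolding truncated_moment_eq[OF assms]
    by (intro Bochner_Integration.integral_cong) (auto simp: truncated_power_def)
  also have "\<dots> = prob ({\<omega> \<in> space M. A t \<omega> \<le> x} \<inter> space M)" by (rule Bochner_Integration.integral_indicator)
  finally show ?thesis by (simp add: Int_def conj_commute cong: conj_cong)
qed

lemma small_ball_probability:
  assumes x: "0 < x"
  shows "truncated_moment 0 x 1 \<le> x ^ j * exp \<bar>\<kappa> j\<bar>"
proof -
  interpret P: pair_sigma_finite lborel M ..
  have "ennreal (truncated_moment 0 x 1) = (\<integral>\<^sup>+\<omega>. ennreal (truncated_power 0 x (A 1 \<omega>)) \<partial>M)"
    using truncated_moment_integrable[of 1 x 0] x unfolding truncated_moment_eq[OF zero_le_one]
    by (subst nn_integral_eq_integral) (auto simp: truncated_power_nonneg)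
  also have "\<dots> \<le> (\<integral>\<^sup>+\<omega>. \<integral>\<^sup>+s. ennreal (x ^ j * exp (real j * \<xi> (max 0 s) \<omega>)) * indicator {0..1} s \<partial>lborel \<partial>M)"
    by (intro nn_integral_mono exp_integral_small_ball[OF xi_cadlag x])
  also have "\<dots> = (\<integral>\<^sup>+s. \<integral>\<^sup>+\<omega>. ennreal (x ^ j * exp (real j * \<xi> (max 0 s) \<omega>)) * indicator {0..1} s \<partial>M \<partial>lborel)"
    by (rule P.Fubini') (simp add: split_beta')
  also have "\<dots> \<le> (\<integral>\<^sup>+s. ennreal (x ^ j * exp \<bar>\<kappa> j\<bar>) * indicator {0..1::real} s \<partial>lborel)"
  proof (rule nn_integral_mono)
    fix s :: real
    show "(\<integral>\<^sup>+\<omega>. ennreal (x ^ j * exp (real j * \<xi> (max 0 s) \<omega>)) * indicator {0..1} s \<partial>M) \<le>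
        ennreal (x ^ j * exp \<bar>\<kappa> j\<bar>) * indicator {0..1} s"
    proof (cases "s \<in> {0..1}")
      case True
      then have s: "0 \<le> s" "max 0 s = s" by auto
      have "(\<integral>\<^sup>+\<omega>. ennreal (x ^ j * exp (real j * \<xi> s \<omega>)) \<partial>M) = ennreal (x ^ j * exp (\<kappa> j * s))"
        using moment_integrable[OF s(1), of j] x
        by (subst nn_integral_eq_integral) (auto simp: moment[OF s(1)])
      also have "\<dots> \<le> ennreal (x ^ j * exp \<bar>\<kappa> j\<bar>)"
        using True x by (intro ennreal_leI mult_left_mono exp_mult_le_exp_abs) auto
      finally show ?thesis using True s by simp
    qed simp
  qed
  also have "\<dots> = ennreal (x ^ j * exp \<bar>\<kappa> j\<bar>)" by (simp add: nn_integral_cmult)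
  finally show ?thesis using x by simp
qed

text \<open>By the inequality of arithmetic and geometric means, \<open>exp (k \<xi>)\<close> times the indicator of \<open>A(1) \<le> x\<close> is at most half
of \<open>x\<^sup>j exp (2 k \<xi>)\<close> plus \<open>x\<^sup>-\<^sup>j\<close> times the indicator, and that event has probability \<open>O(x\<^sup>2\<^sup>j)\<close>.\<close>

lemma truncated_moment_1_small:
  assumes x: "0 < x" "x \<le> 1"
  shows "truncated_moment k x 1 \<le> (exp (\<kappa> (2 * k)) + exp \<bar>\<kappa> (2 * j)\<bar>) / 2 * x ^ j"
proof -
  have "truncated_moment k x 1 \<le> (\<integral>\<omega>. (x ^ j * exp (real (2 * k) * \<xi> 1 \<omega>) +
      1 / x ^ j * (exp (real 0 * \<xi> 1 \<omega>) * truncated_power 0 x (A 1 \<omega>))) / 2 \<partial>M)"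
    unfolding truncated_moment_eq[OF zero_le_one]
  proof (rule integral_mono_AE)
    show "integrable M (\<lambda>\<omega>. (x ^ j * exp (real (2 * k) * \<xi> 1 \<omega>) +
      1 / x ^ j * (exp (real 0 * \<xi> 1 \<omega>) * truncated_power 0 x (A 1 \<omega>))) / 2)"
      by (intro integrable_divide Bochner_Integration.integrable_add integrable_mult_right
          moment_integrable truncated_moment_integrable zero_le_one less_imp_le[OF x(1)])
    show "AE \<omega> in M. exp (real k * \<xi> 1 \<omega>) * truncated_power k x (A 1 \<omega>) \<le>
       (x ^ j * exp (real (2 * k) * \<xi> 1 \<omega>) + 1 / x ^ j * (exp (real 0 * \<xi> 1 \<omega>) * truncated_power 0 x (A 1 \<omega>))) / 2"
      using AE_space
    proof eventually_elim
      case (elim \<omega>)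
      define u where "u = exp (real k * \<xi> 1 \<omega>)"
      have u2: "exp (real (2 * k) * \<xi> 1 \<omega>) = u\<^sup>2"
        by (simp add: u_def exp_of_nat_mult[symmetric] power2_eq_square exp_add[symmetric])
      show ?case
      proof (cases "A 1 \<omega> \<le> x")
        case True
        have "truncated_power k x (A 1 \<omega>) \<le> x ^ k"
          using x by (intro truncated_power_le A_nonneg[OF elim]) auto
        also have "\<dots> \<le> 1" using x by (intro power_le_one) auto
        finally have "u * truncated_power k x (A 1 \<omega>) \<le> u * 1" by (intro mult_left_mono) (simp_all add: u_def)
        also have "u * 1 \<le> (x ^ j * u\<^sup>2 + 1 / x ^ j) / 2"
        proof -
          have "0 \<le> (x ^ j * u - 1)\<^sup>2 / x ^ j" using x by simp
          also have "\<dots> = x ^ j * u\<^sup>2 + 1 / x ^ j - 2 * u" using x by (simp add: power2_eq_square field_simps)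
          finally show ?thesis by simp
        qed
        finally have "u * truncated_power k x (A 1 \<omega>) \<le> (x ^ j * u\<^sup>2 + 1 / x ^ j) / 2" .
        moreover have "exp (real 0 * \<xi> 1 \<omega>) * truncated_power 0 x (A 1 \<omega>) = 1"
          using True by (simp add: truncated_power_def)
        ultimately show ?thesis by (simp only: u2 u_def[symmetric] mult_1_right)
      next
        case False
        then show ?thesis using x by (simp add: truncated_power_def)
      qed
    qed
  qed (use truncated_moment_integrable x in auto)
  also have "\<dots> = (x ^ j * exp (\<kappa> (2 * k)) + 1 / x ^ j * truncated_moment 0 x 1) / 2"
  proof -
    have "(\<integral>\<omega>. x ^ j * exp (real (2 * k) * \<xi> 1 \<omega>) +
       1 / x ^ j * (exp (real 0 * \<xi> 1 \<omega>) * truncated_power 0 x (A 1 \<omega>)) \<partial>M) =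
       (\<integral>\<omega>. x ^ j * exp (real (2 * k) * \<xi> 1 \<omega>) \<partial>M) +
       (\<integral>\<omega>. 1 / x ^ j * (exp (real 0 * \<xi> 1 \<omega>) * truncated_power 0 x (A 1 \<omega>)) \<partial>M)"
      by (intro Bochner_Integration.integral_add integrable_mult_right
          moment_integrable truncated_moment_integrable zero_le_one less_imp_le[OF x(1)])
    then show ?thesis
      unfolding integral_divide_zero integral_mult_right_zero truncated_moment_eq[OF zero_le_one] moment[OF zero_le_one]
      by (simp only: mult_1_right)
  qed
  also have "\<dots> \<le> (x ^ j * exp (\<kappa> (2 * k)) + x ^ j * exp \<bar>\<kappa> (2 * j)\<bar>) / 2"
  proof -
    have "1 / x ^ j * truncated_moment 0 x 1 \<le> 1 / x ^ j * (x ^ (2 * j) * exp \<bar>\<kappa> (2 * j)\<bar>)"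
      using small_ball_probability[OF x(1), of "2 * j"] x by (intro mult_left_mono) auto
    also have "\<dots> = x ^ j * exp \<bar>\<kappa> (2 * j)\<bar>" using x by (simp add: mult_2 power_add)
    finally show ?thesis by (intro divide_right_mono add_left_mono) auto
  qed
  finally show ?thesis by (simp add: algebra_simps)
qed

lemma truncated_moment_bigo: "(\<lambda>x. truncated_moment k x 1) \<in> O[at_right 0](\<lambda>x. x ^ j)"
proof (rule bigoI)
  have "eventually (\<lambda>x. x \<in> {0<..1::real}) (at_right 0)"
    unfolding eventually_at_right[OF zero_less_one] by (auto intro!: exI[of _ 1])
  then show "\<forall>\<^sub>F x in at_right 0. norm (truncated_moment k x 1) \<le> (exp (\<kappa> (2 * k)) + exp \<bar>\<kappa> (2 * j)\<bar>) / 2 * norm (x ^ j)"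
    by eventually_elim (use truncated_moment_1_small truncated_moment_nonneg in \<open>auto simp: abs_of_nonneg\<close>)
qed

lemma killed_moment_bigo: "(\<lambda>x. killed_moment q k x) \<in> O[at_right 0](\<lambda>x. x ^ k)"
proof (rule bigoI)
  show "\<forall>\<^sub>F x in at_right 0. norm (killed_moment q k x) \<le> exp \<bar>q\<bar> * exp \<bar>\<kappa> k\<bar> * norm (x ^ k)"
    using eventually_at_right_less[of "0::real"]
  proof eventually_elim
    case (elim x)
    have "norm (killed_moment q k x) \<le> (\<integral>t. indicator {0..1::real} t * (exp \<bar>q\<bar> * (x ^ k * exp \<bar>\<kappa> k\<bar>)) \<partial>lborel)"
      unfolding killed_moment_def set_lebesgue_integral_def
    proof (rule Bochner_Integration.integral_norm_bound_integral)
      show "integrable lborel (\<lambda>t. indicator {0..1} t *\<^sub>R (exp (- q * t) * truncated_moment k x t))"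
        using killed_integrand_integrable[of x] elim unfolding set_integrable_def by simp
      show "norm (indicator {0..1} t *\<^sub>R (exp (- q * t) * truncated_moment k x t)) \<le>
          indicator {0..1::real} t * (exp \<bar>q\<bar> * (x ^ k * exp \<bar>\<kappa> k\<bar>))" for t
        using killed_integrand_bound[of t x q k] elim by (cases "t \<in> {0..1}") auto
    qed (simp add: integrable_indicator_iff emeasure_lborel_Icc_eq)
    then show ?case using elim by (simp add: mult_ac)
  qed
qed

text \<open>The recursion is run up to \<open>N + 1\<close>: the remainder \<open>M\<^sub>N\<^sub>+\<^sub>1\<close> and the term of index \<open>N + 1\<close> are then both
\<open>O(x\<^sup>N\<^sup>+\<^sup>1)\<close>.\<close>

lemma killed_moment_asymptotics:
  "(\<lambda>x. killed_moment q 0 x - (\<Sum>i=1..N. (\<Prod>j\<in>{1..<i}. \<kappa> j - q) / fact i * x ^ i))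
     \<in> O[at_right 0](\<lambda>x. x ^ Suc N)"
proof -
  let ?c = "\<lambda>i. (\<Prod>j\<in>{1..<i}. \<kappa> j - q) / fact i"
  let ?R = "\<lambda>x. ?c (Suc N) * x ^ Suc N - (\<Sum>i=1..Suc N. ?c i * exp (- q) * truncated_moment i x 1)
     + (\<Prod>j\<in>{1..<Suc (Suc N)}. \<kappa> j - q) / fact (Suc N) * killed_moment q (Suc N) x"
  have R: "?R \<in> O[at_right 0](\<lambda>x. x ^ Suc N)"
  proof -
    have cm: "(\<lambda>x. c * f x) \<in> O[at_right 0](\<lambda>x. x ^ Suc N)" if "f \<in> O[at_right 0](\<lambda>x. x ^ Suc N)"
      for c :: real and f :: "real \<Rightarrow> real"
      using landau_o.big.mult[of "\<lambda>_. c" "at_right 0" "\<lambda>_. 1" f "\<lambda>x. x ^ Suc N", OF _ that] by simp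
    show ?thesis
      by (intro sum_in_bigo(1) sum_in_bigo(2) big_sum_in_bigo cm truncated_moment_bigo killed_moment_bigo landau_o.big_refl)
  qed
  have "eventually (\<lambda>x::real. x > 0) (at_right 0)" by (rule eventually_at_right_less)
  then have "\<forall>\<^sub>F x in at_right 0. killed_moment q 0 x - (\<Sum>i=1..N. ?c i * x ^ i) = ?R x"
  proof eventually_elim
    case (elim x)
    have "{1..Suc N} = insert (Suc N) {1..N}" by auto
    then have "(\<Sum>i=1..Suc N. ?c i * x ^ i) = ?c (Suc N) * x ^ Suc N + (\<Sum>i=1..N. ?c i * x ^ i)" by simp
    moreover have "(\<Sum>i=1..Suc N. ?c i * (x ^ i - exp (- q) * truncated_moment i x 1)) =
        (\<Sum>i=1..Suc N. ?c i * x ^ i) - (\<Sum>i=1..Suc N. ?c i * exp (- q) * truncated_moment i x 1)"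
      by (simp only: right_diff_distrib sum_subtractf mult.assoc)
    ultimately show ?case using killed_moment_expansion[of x q "Suc N"] elim by linarith
  qed
  then show ?thesis using R by (subst landau_o.big.in_cong) 
qed

end

section \<open>Independent killing\<close>

text \<open>Independence of path and killing time as a product structure, which is what Fubini needs: the pair of
the sample point, observed through the path only, and the killing time has a product law.\<close>

lemma (in prob_space) path_time_indep:
  fixes \<xi> :: "real \<Rightarrow> 'a \<Rightarrow> real"
  defines "N \<equiv> vimage_algebra (space M) (\<lambda>\<omega>. \<lambda>t\<in>{0..}. \<xi> t \<omega>) (Pi\<^sub>M {0..} (\<lambda>_. borel))"
  assumes T: "T \<in> borel_measurable M"
    and ind: "indep_set (sets N) (sets (vimage_algebra (space M) T borel))"
  shows "0 \<le> t \<Longrightarrow> \<xi> t \<in> borel_measurable N" and "space N = space M"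
    and "(\<lambda>\<omega>. \<omega>) \<in> measurable M N"
    and "distr M N (\<lambda>\<omega>. \<omega>) \<Otimes>\<^sub>M distr M borel T = distr M (N \<Otimes>\<^sub>M borel) (\<lambda>\<omega>. (\<omega>, T \<omega>))"
    and "X \<in> measurable N S \<Longrightarrow> h \<in> measurable borel S' \<Longrightarrow> indep_var S X S' (\<lambda>\<omega>. h (T \<omega>))"
proof -
  show sp: "space N = space M" by (simp add: N_def)
  have sub: "sets N \<subseteq> events" using ind unfolding indep_sets2_eq by blast
  have inter: "A \<inter> space M = A" if "A \<in> sets N" for A
    using sets.sets_into_space[OF that] unfolding sp by (rule Int_absorb2)
  show id: "(\<lambda>\<omega>. \<omega>) \<in> measurable M N"
    by (rule measurableI) (use sp sub inter in auto)
  have TV: "T -` B \<inter> space M \<in> sets (vimage_algebra (space M) T borel)" if "B \<in> sets borel" for B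
    using that by (rule in_vimage_algebra)
  show "\<xi> t \<in> borel_measurable N" if t: "0 \<le> t"
  proof -
    have "(\<lambda>\<omega>. \<lambda>t\<in>{0..}. \<xi> t \<omega>) \<in> measurable N (Pi\<^sub>M {0..} (\<lambda>_. borel))"
      unfolding N_def by (rule measurable_vimage_algebra1) (auto simp: space_PiM)
    then have "(\<lambda>\<omega>. (\<lambda>t\<in>{0..}. \<xi> t \<omega>) t) \<in> borel_measurable N"
      by (rule measurable_compose[OF _ measurable_component_singleton]) (use t in simp)
    then show ?thesis using t by simp
  qed
  show "distr M N (\<lambda>\<omega>. \<omega>) \<Otimes>\<^sub>M distr M borel T = distr M (N \<Otimes>\<^sub>M borel) (\<lambda>\<omega>. (\<omega>, T \<omega>))"
  proof (rule pair_measure_eqI)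
    show "sigma_finite_measure (distr M N (\<lambda>\<omega>. \<omega>))" "sigma_finite_measure (distr M borel T)"
      using id T by (auto intro!: prob_space_imp_sigma_finite prob_space_distr)
    show "sets (distr M N (\<lambda>\<omega>. \<omega>) \<Otimes>\<^sub>M distr M borel T) = sets (distr M (N \<Otimes>\<^sub>M borel) (\<lambda>\<omega>. (\<omega>, T \<omega>)))"
      by (simp cong: sets_pair_measure_cong)
    fix A B assume "A \<in> sets (distr M N (\<lambda>\<omega>. \<omega>))" "B \<in> sets (distr M borel T)"
    then have AB: "A \<in> sets N" "B \<in> sets borel" by auto
    have pm: "(\<lambda>\<omega>. (\<omega>, T \<omega>)) \<in> measurable M (N \<Otimes>\<^sub>M borel)" by (intro measurable_Pair id T)
    have "emeasure (distr M (N \<Otimes>\<^sub>M borel) (\<lambda>\<omega>. (\<omega>, T \<omega>))) (A \<times> B) = emeasure M (A \<inter> (T -` B \<inter> space M))"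
      using AB inter[OF AB(1)]
      by (subst emeasure_distr[OF pm]) (auto intro!: arg_cong[where f = "emeasure M"])
    also have "\<dots> = ennreal (prob A * prob (T -` B \<inter> space M))"
      using ind AB(1) TV[OF AB(2)] unfolding indep_sets2_eq by (simp add: emeasure_eq_measure)
    also have "\<dots> = emeasure (distr M N (\<lambda>\<omega>. \<omega>)) A * emeasure (distr M borel T) B"
      using AB inter[OF AB(1)] by (simp add: emeasure_distr[OF id] emeasure_distr[OF T] emeasure_eq_measure ennreal_mult)
    finally show "emeasure (distr M N (\<lambda>\<omega>. \<omega>)) A * emeasure (distr M borel T) B =
        emeasure (distr M (N \<Otimes>\<^sub>M borel) (\<lambda>\<omega>. (\<omega>, T \<omega>))) (A \<times> B)" by (rule sym)
  qed
  assume X: "X \<in> measurable N S" and h: "h \<in> measurable borel S'"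
  have XM: "X \<in> measurable M S" using measurable_compose[OF id X] by simp
  have "sigma_sets (space M) {X -` A \<inter> space M | A. A \<in> sets S} \<subseteq> sets N"
    using measurable_sets[OF X] unfolding sp[symmetric] by (intro sets.sigma_sets_subset) auto
  moreover have "sigma_sets (space M) {(\<lambda>\<omega>. h (T \<omega>)) -` A \<inter> space M | A. A \<in> sets S'}
      \<subseteq> sets (vimage_algebra (space M) T borel)"
  proof -
    have "(\<lambda>\<omega>. h (T \<omega>)) -` A \<inter> space M \<in> sets (vimage_algebra (space M) T borel)" if "A \<in> sets S'" for A
      using TV[OF measurable_sets_borel[OF h that]] by (simp add: vimage_def)
    then have "{(\<lambda>\<omega>. h (T \<omega>)) -` A \<inter> space M | A. A \<in> sets S'} \<subseteq> sets (vimage_algebra (space M) T borel)"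
      by blast
    then show ?thesis using sets.sigma_sets_subset[of _ "vimage_algebra (space M) T borel"] by simp
  qed
  ultimately show "indep_var S X S' (\<lambda>\<omega>. h (T \<omega>))"
    using ind XM measurable_compose[OF T h] unfolding indep_var_eq indep_sets2_eq by blast
qed

lemma killed_levy_processD:
  assumes "killed_levy_process M \<xi> T \<Psi>"
  shows "levy_process M \<xi>" "distributed M lborel T (\<lambda>t. ennreal (exponential_density (- Re (\<Psi> 0)) t))"
    "prob_space.indep_set M
       (sets (vimage_algebra (space M) (\<lambda>\<omega>. \<lambda>t\<in>{0..}. \<xi> t \<omega>) (Pi\<^sub>M {0..} (\<lambda>_. borel))))
       (sets (vimage_algebra (space M) T borel))"
    "\<And>t z. 0 \<le> t \<Longrightarrow> Re z = 0 \<Longrightarrow>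
        (\<integral>\<omega>. (if t < T \<omega> then exp (z * complex_of_real (\<xi> t \<omega>)) else 0) \<partial>M) = exp (\<Psi> z * complex_of_real t)"
    "T \<in> borel_measurable M"
  using assms unfolding killed_levy_process_def distributed_def by auto

text \<open>By independence the killed transform is \<open>P(t < T)\<close> times the transform of \<open>\<xi>(t)\<close>, and
\<open>P(t < T) = exp (Re (\<Psi> 0) t)\<close>.\<close>

lemma unkilled_characteristic_function:
  assumes "killed_levy_process M \<xi> T \<Psi>" and q: "- Re (\<Psi> 0) > 0"
    and t: "0 \<le> t" and z: "Re z = 0"
  shows "(\<integral>\<omega>. exp (z * complex_of_real (\<xi> t \<omega>)) \<partial>M) = exp ((\<Psi> z - Re (\<Psi> 0)) * complex_of_real t)"
proof -
  note K = killed_levy_processD[OF assms(1)]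
  interpret prob_space M by (rule levy_processD(1)[OF K(1)])
  note I = path_time_indep[OF K(5,3)]
  let ?N = "vimage_algebra (space M) (\<lambda>\<omega>. \<lambda>t\<in>{0..}. \<xi> t \<omega>) (Pi\<^sub>M {0..} (\<lambda>_. borel))"
  have [measurable]: "\<xi> t \<in> borel_measurable M" by (rule levy_processD(2)[OF K(1) t])
  have [measurable]: "\<xi> t \<in> borel_measurable ?N" by (rule I(1)[OF t])
  note [measurable] = K(5)
  have ind: "indep_var borel (\<lambda>\<omega>. exp (z * complex_of_real (\<xi> t \<omega>))) borel (\<lambda>\<omega>. indicator {t<..} (T \<omega>) :: complex)"
    by (rule I(5)) measurable
  have i1: "integrable M (\<lambda>\<omega>. indicator {t<..} (T \<omega>) :: complex)"
    by (rule integrable_const_bound[where B = 1]) (auto simp: indicator_def)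
  have i2: "integrable M (\<lambda>\<omega>. exp (z * complex_of_real (\<xi> t \<omega>)))"
    by (rule integrable_const_bound[where B = 1]) (use z in \<open>auto simp: norm_exp_eq_Re\<close>)
  have "exp (\<Psi> z * complex_of_real t) = (\<integral>\<omega>. exp (z * complex_of_real (\<xi> t \<omega>)) * indicator {t<..} (T \<omega>) \<partial>M)"
    unfolding K(4)[OF t z, symmetric] by (intro Bochner_Integration.integral_cong) (auto simp: indicator_def)
  also have "\<dots> = (\<integral>\<omega>. exp (z * complex_of_real (\<xi> t \<omega>)) \<partial>M) * (\<integral>\<omega>. indicator {t<..} (T \<omega>) \<partial>M)"
    by (rule indep_var_lebesgue_integral[OF ind i2 i1])
  also have "(\<integral>\<omega>. indicator {t<..} (T \<omega>) \<partial>M) = complex_of_real (\<integral>\<omega>. indicator {\<omega> \<in> space M. t < T \<omega>} \<omega> \<partial>M)"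
    unfolding integral_complex_of_real[symmetric]
    by (intro Bochner_Integration.integral_cong) (auto simp: indicator_def)
  also have "(\<integral>\<omega>. indicator {\<omega> \<in> space M. t < T \<omega>} \<omega> \<partial>M) = prob {\<omega> \<in> space M. t < T \<omega>}"
    by (simp add: Int_def conj_commute cong: conj_cong)
  also have "prob {\<omega> \<in> space M. t < T \<omega>} = exp (- t * - Re (\<Psi> 0))"
    by (rule exponential_distributedD_gt[OF K(2) t q])
  finally have "(\<integral>\<omega>. exp (z * complex_of_real (\<xi> t \<omega>)) \<partial>M) =
      exp (\<Psi> z * complex_of_real t) * exp (- complex_of_real (t * Re (\<Psi> 0)))"
    by (simp add: exp_of_real[symmetric] exp_minus field_simps)
  then show ?thesis by (simp add: exp_add[symmetric] algebra_simps)
qed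

text \<open>The event \<open>T \<le> 1\<close> and \<open>A(T) \<le> x\<close> has probability \<open>q M\<^sub>0\<close>, by integration over the law of \<open>T\<close>.  On the event
\<open>T > 1\<close> monotonicity gives \<open>A(1) \<le> A(T)\<close>, so neglecting it costs at most \<open>P(A(1) \<le> x)\<close>.\<close>

lemma killed_cdf_approximation:
  assumes "killed_levy_process M \<xi> T \<Psi>" and q: "- Re (\<Psi> 0) > 0"
    and L: "levy_exp_moments M \<xi> \<kappa>" and x: "0 < x"
  shows "\<bar>exp_functional_cdf M \<xi> T x - (- Re (\<Psi> 0)) * levy_exp_moments.killed_moment M \<xi> (- Re (\<Psi> 0)) 0 x\<bar>
     \<le> levy_exp_moments.truncated_moment M \<xi> 0 x 1"
proof -
  note K = killed_levy_processD[OF assms(1)]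
  interpret levy_exp_moments M \<xi> \<kappa> by (rule L)
  define q where "q = - Re (\<Psi> 0)"
  have q0: "q > 0" using q by (simp add: q_def)
  define N where "N = vimage_algebra (space M) (\<lambda>\<omega>. \<lambda>t\<in>{0..}. \<xi> t \<omega>) (Pi\<^sub>M {0..} (\<lambda>_. borel :: real measure))"
  note I = path_time_indep[OF K(5,3), folded N_def]
  note [measurable] = K(5)
  have AN: "(\<lambda>p. A (fst p) (snd p)) \<in> borel_measurable (borel \<Otimes>\<^sub>M N)"
    by (rule exp_integral_jointly_measurable[OF I(1)]) (auto simp: I(2) xi_cadlag)
  have [measurable]: "(\<lambda>p. A (snd p) (fst p)) \<in> borel_measurable (N \<Otimes>\<^sub>M borel)"
    using measurable_compose[OF _ AN, of "\<lambda>p. (snd p, fst p)" "N \<Otimes>\<^sub>M borel"] by simp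
  have AT [measurable]: "(\<lambda>\<omega>. A (T \<omega>) \<omega>) \<in> borel_measurable M"
    using measurable_compose[OF _ A_jointly_measurable, of "\<lambda>\<omega>. (T \<omega>, \<omega>)" M] by simp
  define B where "B = {p \<in> space (N \<Otimes>\<^sub>M borel). 0 \<le> snd p \<and> snd p \<le> 1 \<and> A (snd p) (fst p) \<le> x}"
  have B: "B \<in> sets (N \<Otimes>\<^sub>M borel)" unfolding B_def by measurable
  let ?MN = "distr M N (\<lambda>\<omega>. \<omega>)" and ?MT = "distr M borel T"
  note idN = I(3)
  interpret MN: prob_space ?MN using idN by (rule prob_space_distr)
  interpret MT: prob_space ?MT using K(5) by (rule prob_space_distr)
  interpret MNT: pair_sigma_finite ?MN ?MT ..
  note J = I(4)[symmetric]
  have MT: "?MT = density lborel (\<lambda>t. ennreal (exponential_density q t))"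
  proof -
    have "?MT = distr M lborel T" by (intro distr_cong) auto
    then show ?thesis using distributed_distr_eq_density[OF K(2)] by (simp add: q_def)
  qed
  have pB: "emeasure M {\<omega> \<in> space M. 0 \<le> T \<omega> \<and> T \<omega> \<le> 1 \<and> A (T \<omega>) \<omega> \<le> x} = ennreal (q * killed_moment q 0 x)"
  proof -
    have pm: "(\<lambda>\<omega>. (\<omega>, T \<omega>)) \<in> measurable M (N \<Otimes>\<^sub>M borel)"
      by (intro measurable_Pair idN K(5))
    have "emeasure M {\<omega> \<in> space M. 0 \<le> T \<omega> \<and> T \<omega> \<le> 1 \<and> A (T \<omega>) \<omega> \<le> x} = emeasure (?MN \<Otimes>\<^sub>M ?MT) B"
      unfolding J[symmetric] emeasure_distr[OF pm B]
      by (intro arg_cong[where f = "emeasure M"]) (auto simp: B_def space_pair_measure I(2))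
    also have "\<dots> = (\<integral>\<^sup>+t. emeasure ?MN ((\<lambda>\<omega>. (\<omega>, t)) -` B) \<partial>?MT)"
    proof (rule MNT.emeasure_pair_measure_alt2)
      have "sets (?MN \<Otimes>\<^sub>M ?MT) = sets (N \<Otimes>\<^sub>M borel)" by (intro sets_pair_measure_cong sets_distr)
      with B show "B \<in> sets (?MN \<Otimes>\<^sub>M ?MT)" by (simp only:)
    qed
    also have "\<dots> = (\<integral>\<^sup>+t. ennreal (indicator {0..1} t * truncated_moment 0 x t) \<partial>?MT)"
    proof (rule nn_integral_cong)
      fix t :: real
      let ?V = "(\<lambda>\<omega>. (\<omega>, t)) -` B"
      have mem: "\<omega> \<in> ?V \<longleftrightarrow> \<omega> \<in> space M \<and> 0 \<le> t \<and> t \<le> 1 \<and> A t \<omega> \<le> x" for \<omega>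
        by (simp add: B_def space_pair_measure I(2))
      have "?V \<inter> space N \<in> sets N" by (rule measurable_sets[OF _ B]) simp
      moreover have "?V \<inter> space N = ?V" unfolding I(2) using mem by blast
      ultimately have "?V \<in> sets N" by simp
      then have "emeasure ?MN ?V = emeasure M ((\<lambda>\<omega>. \<omega>) -` ?V \<inter> space M)"
        by (rule emeasure_distr[OF idN])
      also have "(\<lambda>\<omega>. \<omega>) -` ?V \<inter> space M = {\<omega> \<in> space M. 0 \<le> t \<and> t \<le> 1 \<and> A t \<omega> \<le> x}"
        using mem by blast
      also have "emeasure M {\<omega> \<in> space M. 0 \<le> t \<and> t \<le> 1 \<and> A t \<omega> \<le> x} = ennreal (indicator {0..1} t * truncated_moment 0 x t)"
      proof (cases "t \<in> {0..1}")
        case True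
        then show ?thesis by (simp add: truncated_moment_0_prob emeasure_eq_measure)
      next
        case False
        then have empty: "{\<omega> \<in> space M. 0 \<le> t \<and> t \<le> 1 \<and> A t \<omega> \<le> x} = {}" by auto
        show ?thesis unfolding empty using False by simp
      qed
      finally show "emeasure ?MN ((\<lambda>\<omega>. (\<omega>, t)) -` B) = ennreal (indicator {0..1} t * truncated_moment 0 x t)" .
    qed
    also have "\<dots> = (\<integral>\<^sup>+t. ennreal (exponential_density q t) * ennreal (indicator {0..1} t * truncated_moment 0 x t) \<partial>lborel)"
      unfolding MT by (rule nn_integral_density) measurable
    also have "\<dots> = (\<integral>\<^sup>+t. ennreal (q * (indicator {0..1} t *\<^sub>R (exp (- q * t) * truncated_moment 0 x t))) \<partial>lborel)"
    proof (rule nn_integral_cong)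
      fix t :: real
      show "ennreal (exponential_density q t) * ennreal (indicator {0..1} t * truncated_moment 0 x t) =
         ennreal (q * (indicator {0..1} t *\<^sub>R (exp (- q * t) * truncated_moment 0 x t)))"
      proof (cases "t \<in> {0..1}")
        case True
        then have "exponential_density q t = q * exp (- q * t)" by (simp add: exponential_density_def mult.commute)
        then show ?thesis using True q0 by (simp add: ennreal_mult[symmetric] truncated_moment_nonneg mult.assoc)
      qed simp
    qed
    also have "\<dots> = ennreal (\<integral>t. q * (indicator {0..1} t *\<^sub>R (exp (- q * t) * truncated_moment 0 x t)) \<partial>lborel)"
    proof (rule nn_integral_eq_integral)
      have "integrable lborel (\<lambda>t. indicator {0..1} t *\<^sub>R (exp (- q * t) * truncated_moment 0 x t))"
        using killed_integrand_integrable[of x] x unfolding set_integrable_def by simp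
      then show "integrable lborel (\<lambda>t. q * (indicator {0..1} t *\<^sub>R (exp (- q * t) * truncated_moment 0 x t)))" by simp
    qed (use q0 in \<open>simp add: truncated_moment_nonneg\<close>)
    also have "\<dots> = ennreal (q * killed_moment q 0 x)"
      by (simp add: killed_moment_def set_lebesgue_integral_def)
    finally show ?thesis .
  qed
  have km0: "0 \<le> killed_moment q 0 x"
    unfolding killed_moment_def set_lebesgue_integral_def
    by (intro integral_nonneg_AE AE_I2) (simp add: truncated_moment_nonneg)
  let ?B = "{\<omega> \<in> space M. 0 \<le> T \<omega> \<and> T \<omega> \<le> 1 \<and> A (T \<omega>) \<omega> \<le> x}"
  let ?E = "{\<omega> \<in> space M. A (T \<omega>) \<omega> \<le> x}" and ?S = "{\<omega> \<in> space M. A 1 \<omega> \<le> x}"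
  have B': "prob ?B = q * killed_moment q 0 x"
    using pB km0 q0 by (simp add: emeasure_eq_measure)
  have "emeasure M (T -` {..<0} \<inter> space M) = 0"
  proof -
    have "(\<integral>\<^sup>+t. ennreal (exponential_density (- Re (\<Psi> 0)) t) * indicator {..<0} t \<partial>lborel) = (\<integral>\<^sup>+t. 0 \<partial>(lborel :: real measure))"
      by (intro nn_integral_cong) (simp add: exponential_density_def indicator_def)
    then show ?thesis using distributed_emeasure[OF K(2), of "{..<0}"] by simp
  qed
  then have T0: "prob (T -` {..<0} \<inter> space M) = 0" by (simp add: measure_def)
  have cdf: "exp_functional_cdf M \<xi> T x = prob ?E"
  proof -
    have ef: "exp_functional \<xi> T = (\<lambda>\<omega>. A (T \<omega>) \<omega>)"
      by (simp add: fun_eq_iff exp_functional_def exp_integral_def)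
    show ?thesis
      unfolding exp_functional_cdf_def cdf_def ef
      by (subst measure_distr) (auto intro!: arg_cong[where f = prob])
  qed
  have "?E \<subseteq> (?B \<union> ?S) \<union> (T -` {..<0} \<inter> space M)"
  proof
    fix \<omega> assume \<omega>: "\<omega> \<in> ?E"
    show "\<omega> \<in> (?B \<union> ?S) \<union> (T -` {..<0} \<inter> space M)"
    proof (cases "1 < T \<omega>")
      case True
      then have "A 1 \<omega> \<le> A (T \<omega>) \<omega>" using \<omega> by (intro exp_integral_mono xi_cadlag) auto
      then show ?thesis using \<omega> by auto
    qed (use \<omega> in auto)
  qed
  then have "prob ?E \<le> prob ((?B \<union> ?S) \<union> (T -` {..<0} \<inter> space M))"
    by (intro finite_measure_mono) measurable
  also have "\<dots> \<le> prob (?B \<union> ?S) + prob (T -` {..<0} \<inter> space M)"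
    by (intro measure_Un_le) measurable
  also have "prob (?B \<union> ?S) \<le> prob ?B + prob ?S" by (intro measure_Un_le) measurable
  finally have up: "prob ?E \<le> q * killed_moment q 0 x + truncated_moment 0 x 1"
    using T0 B' by (simp add: truncated_moment_0_prob)
  have "prob ?B \<le> prob ?E" by (intro finite_measure_mono) auto
  then show ?thesis using up B' truncated_moment_nonneg[of 0 x 1] unfolding cdf q_def[symmetric] by linarith
qed

context killed_factors begin

lemma exponent_ext_of_nat_real:
  "exponent_ext \<phi>p \<phi>m (of_nat j) = complex_of_real (Re (exponent_ext \<phi>p \<phi>m (of_nat j)))"
proof -
  have "bernstein_ext \<phi>p (- of_nat j) \<in> \<real>"
    using bernstein_ext_neg(2)[OF rep_p entire, of "real j"] Reals_of_real by (metis of_nat_0_le_iff of_real_of_nat_eq)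
  moreover have "\<phi>m (of_nat j) \<in> \<real>"
    using bernstein_of_real(1)[OF rep_m, of "real j"] Reals_of_real by (metis of_nat_0_le_iff of_real_of_nat_eq)
  ultimately have "exponent_ext \<phi>p \<phi>m (of_nat j) \<in> \<real>"
    unfolding exponent_ext_def by (intro Reals_mult Reals_minus)
  then show ?thesis by (simp add: complex_is_Real_iff complex_eq_iff)
qed

lemma exponent_ext_regular:
  "exponent_ext \<phi>p \<phi>m holomorphic_on {z. Re z > 0}"
  "continuous_on {z. Re z \<ge> 0} (exponent_ext \<phi>p \<phi>m)"
proof -
  have "bernstein_ext \<phi>p \<circ> (\<lambda>z. - z) holomorphic_on UNIV"
    by (rule holomorphic_on_compose_gen[OF holomorphic_on_minus[OF holomorphic_on_ident] bernstein_ext_entire(1)[OF entire]]) simp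
  then have E: "(\<lambda>z. bernstein_ext \<phi>p (- z)) holomorphic_on A" for A
    unfolding comp_def by (rule holomorphic_on_subset) simp
  show "exponent_ext \<phi>p \<phi>m holomorphic_on {z. Re z > 0}"
    unfolding exponent_ext_def[abs_def] by (intro holomorphic_intros E bernstein_holomorphic_on[OF rep_m])
  show "continuous_on {z. Re z \<ge> 0} (exponent_ext \<phi>p \<phi>m)"
    unfolding exponent_ext_def[abs_def]
    by (intro continuous_intros holomorphic_on_imp_continuous_on[OF E] bernstein_continuous_on[OF rep_m])
qed

text \<open>The extension of \<open>\<Psi>\<close> by the Wiener-Hopf factors supplies the regular extension of the characteristic function of
\<open>\<xi>(t)\<close> that the moment theorem requires.\<close>

lemma levy_exp_moments_of_killed:
  assumes K: "killed_levy_process M \<xi> T \<Psi>" and q: "- Re (\<Psi> 0) > 0"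
    and fac: "\<And>z. Re z = 0 \<Longrightarrow> \<Psi> z = - \<phi>p (- z) * \<phi>m z"
  shows "levy_exp_moments M \<xi> (\<lambda>k. Re (exponent_ext \<phi>p \<phi>m (of_nat k)) - Re (\<Psi> 0))"
proof -
  note levy = killed_levy_processD(1)[OF K]
  interpret prob_space M by (rule levy_processD(1)[OF levy])
  have M: "integrable M (\<lambda>\<omega>. exp (real k * \<xi> t \<omega>)) \<and>
      (\<integral>\<omega>. exp (real k * \<xi> t \<omega>) \<partial>M) = exp ((Re (exponent_ext \<phi>p \<phi>m (of_nat k)) - Re (\<Psi> 0)) * t)"
    if t: "0 \<le> t" for k t
  proof -
    note [measurable] = levy_processD(2)[OF levy t]
    define \<rho> where "\<rho> = distr M borel (\<xi> t)"
    interpret \<rho>: prob_space \<rho> unfolding \<rho>_def by (rule prob_space_distr) measurable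
    define G where "G z = exp ((exponent_ext \<phi>p \<phi>m z - Re (\<Psi> 0)) * complex_of_real t)" for z
    have int: "(\<integral>x. exp (z * complex_of_real x) \<partial>\<rho>) = (\<integral>\<omega>. exp (z * complex_of_real (\<xi> t \<omega>)) \<partial>M)" for z
      unfolding \<rho>_def by (rule integral_distr) measurable
    have G0: "(\<integral>x. exp (z * complex_of_real x) \<partial>\<rho>) = G z" if z: "Re z = 0" for z
    proof -
      have "bernstein_ext \<phi>p (- z) = \<phi>p (- z)" using z by (simp add: bernstein_ext_def)
      then have "\<Psi> z = exponent_ext \<phi>p \<phi>m z" unfolding fac[OF z] exponent_ext_def by simp
      then show ?thesis unfolding int unkilled_characteristic_function[OF K q t z] G_def by simp
    qed
    have hol: "G holomorphic_on {z. Re z > 0}"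
      unfolding G_def by (intro holomorphic_intros exponent_ext_regular(1))
    have cont: "continuous_on {z. Re z \<ge> 0} G"
      unfolding G_def by (intro continuous_intros exponent_ext_regular(2))
    have k: "Re (of_nat k) \<ge> 0" by simp
    have sets: "sets \<rho> = sets borel" by (simp add: \<rho>_def)
    have E: "integrable \<rho> (\<lambda>x. exp (of_nat k * complex_of_real x))"
      "(\<integral>x. exp (of_nat k * complex_of_real x) \<partial>\<rho>) = G (of_nat k)"
      by (rule exponential_moments_of_analytic_extension[OF \<rho>.finite_measure_axioms sets hol cont _ k], erule G0)+
    have e: "exp (of_nat k * complex_of_real y) = complex_of_real (exp (real k * y))" for y
      by (simp add: exp_of_real[symmetric])
    have "integrable M (\<lambda>\<omega>. exp (of_nat k * complex_of_real (\<xi> t \<omega>)))"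
      using E(1) unfolding \<rho>_def by (subst (asm) integrable_distr_eq) measurable
    then have i: "integrable M (\<lambda>\<omega>. exp (real k * \<xi> t \<omega>))"
      unfolding e complex_of_real_integrable_eq .
    have "complex_of_real (\<integral>\<omega>. exp (real k * \<xi> t \<omega>) \<partial>M) = G (of_nat k)"
      using E(2) unfolding int[of "of_nat k"] unfolding e integral_complex_of_real .
    also have "\<dots> = complex_of_real (exp ((Re (exponent_ext \<phi>p \<phi>m (of_nat k)) - Re (\<Psi> 0)) * t))"
      unfolding G_def
      by (subst exponent_ext_of_nat_real) (simp only: exp_of_real[symmetric] of_real_mult of_real_diff)
    finally show ?thesis using i by (simp only: of_real_eq_iff)
  qed
  show ?thesis
    by unfold_locales (use levy M in blast)+
qed

end

section \<open>The asymptotic expansion\<close>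

theorem corollary2p9:
  fixes \<Psi> \<phi>p \<phi>m :: "complex \<Rightarrow> complex"
    and dp dm :: real and \<mu>p \<mu>m :: "real measure"
    and M :: "'a measure" and \<xi> :: "real \<Rightarrow> 'a \<Rightarrow> real" and T :: "'a \<Rightarrow> real"
  assumes "\<Psi> \<in> killed_levy_exponents"
    and "wiener_hopf \<Psi> \<phi>p \<phi>m"
    and "bernstein_repr \<phi>p dp \<mu>p"
    and "bernstein_repr \<phi>m dm \<mu>m"
    and "killed_levy_process M \<xi> T \<Psi>"
    and "\<bar>holo_abscissa \<phi>p\<bar> = \<infinity>"
    and "- bernstein_zero \<phi>p \<notin> range (\<lambda>n::nat. ereal (real n))"
  shows "Im (\<Psi> 0) = 0 \<and> - Re (\<Psi> 0) > 0 \<and>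
    (\<forall>N::nat. (\<lambda>x::real. complex_of_real (exp_functional_cdf M \<xi> T x)
          + \<Psi> 0 * (\<Sum>k=1..N. expansion_coeff \<phi>p \<phi>m k * complex_of_real x ^ k))
        \<in> o[at_right 0](\<lambda>x. complex_of_real x ^ N)) \<and>
    ((\<exists>x>0. expansion_converges \<Psi> \<phi>p \<phi>m x) \<longrightarrow>
       bernstein_constant \<phi>p \<or>
       (bernstein_affine \<phi>p dp \<and> bernstein_at_infinity \<phi>m < \<infinity>)) \<and>
    (bernstein_constant \<phi>p \<longrightarrow>
       (\<forall>x>0. (ereal x < 1 / (bernstein_at_infinity \<phi>p * ereal dm) \<longrightarrow>
                 expansion_converges \<Psi> \<phi>p \<phi>m x) \<and>
              (ereal x > 1 / (bernstein_at_infinity \<phi>p * ereal dm) \<longrightarrow>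
                 \<not> expansion_converges \<Psi> \<phi>p \<phi>m x))) \<and>
    (bernstein_affine \<phi>p dp \<and> bernstein_at_infinity \<phi>m < \<infinity> \<longrightarrow>
       (\<forall>x>0. (ereal x < 1 / (bernstein_at_infinity \<phi>m * ereal dp) \<longrightarrow>
                 expansion_converges \<Psi> \<phi>p \<phi>m x) \<and>
              (ereal x > 1 / (bernstein_at_infinity \<phi>m * ereal dp) \<longrightarrow>
                 \<not> expansion_converges \<Psi> \<phi>p \<phi>m x)))"
proof -
  have im: "Im (\<Psi> 0) = 0" and re: "Re (\<Psi> 0) < 0"
    using assms(1) unfolding killed_levy_exponents_def levy_exponents_def by blast+
  define q where "q = - Re (\<Psi> 0)"
  have q: "q > 0" and q': "- Re (\<Psi> 0) > 0" using re by (simp_all add: q_def)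
  have Psi0: "\<Psi> 0 = - complex_of_real q" using im by (simp add: q_def complex_eq_iff)
  have Psi_nz: "\<Psi> 0 \<noteq> 0" using Psi0 q by simp
  have fac: "\<Psi> z = - \<phi>p (- z) * \<phi>m z" if "Re z = 0" for z
    using assms(2) that unfolding wiener_hopf_def by blast
  have prod: "q = Re (\<phi>p 0) * Re (\<phi>m 0)"
  proof -
    have "complex_of_real q = \<phi>p 0 * \<phi>m 0" using fac[of 0] Psi0 by simp
    also have "\<dots> = complex_of_real (Re (\<phi>p 0)) * complex_of_real (Re (\<phi>m 0))"
      using bernstein_reprD(7)[OF assms(3)] bernstein_reprD(7)[OF assms(4)] by (simp only:)
    finally show ?thesis by (simp only: of_real_mult[symmetric] of_real_eq_iff)
  qed
  have pos: "Re (\<phi>p 0) > 0" "Re (\<phi>m 0) > 0"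
    using prod q bernstein_reprD(2)[OF assms(3)] bernstein_reprD(2)[OF assms(4)]
    by (auto simp: zero_less_mult_iff)
  interpret F: killed_factors \<phi>p \<phi>m dp dm \<mu>p \<mu>m
    by unfold_locales (use assms(3,4,6) pos in auto)
  define \<kappa> where "\<kappa> k = Re (exponent_ext \<phi>p \<phi>m (of_nat k)) - Re (\<Psi> 0)" for k :: nat
  have L: "levy_exp_moments M \<xi> \<kappa>"
    unfolding \<kappa>_def[abs_def] by (rule F.levy_exp_moments_of_killed[OF assms(5) q' fac])
  interpret L: levy_exp_moments M \<xi> \<kappa> by (rule L)
  define c where "c i = (\<Prod>j\<in>{1..<i}. \<kappa> j - q) / fact i" for i
  have coeff: "expansion_coeff \<phi>p \<phi>m i = complex_of_real (c i)" for i
  proof -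
    have "exponent_ext \<phi>p \<phi>m (of_nat j) = complex_of_real (\<kappa> j - q)" for j
      using F.exponent_ext_of_nat_real[of j] by (simp add: \<kappa>_def q_def)
    then show ?thesis unfolding expansion_coeff_def c_def by (simp only: of_real_divide of_real_prod of_real_fact)
  qed
  have asymp: "(\<lambda>x. complex_of_real (exp_functional_cdf M \<xi> T x)
          + \<Psi> 0 * (\<Sum>k=1..N. expansion_coeff \<phi>p \<phi>m k * complex_of_real x ^ k))
        \<in> o[at_right 0](\<lambda>x. complex_of_real x ^ N)" for N
  proof -
    let ?f = "\<lambda>x. exp_functional_cdf M \<xi> T x - q * (\<Sum>i=1..N. c i * x ^ i)"
    have "(\<lambda>x. exp_functional_cdf M \<xi> T x - q * L.killed_moment q 0 x) \<in> O[at_right 0](\<lambda>x. L.truncated_moment 0 x 1)"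
    proof (rule bigoI)
      show "\<forall>\<^sub>F x in at_right 0. norm (exp_functional_cdf M \<xi> T x - q * L.killed_moment q 0 x) \<le> 1 * norm (L.truncated_moment 0 x 1)"
        using eventually_at_right_less[of "0::real"]
        by eventually_elim
          (use killed_cdf_approximation[OF assms(5) q' L] L.truncated_moment_nonneg in \<open>simp add: q_def\<close>)
    qed
    then have "(\<lambda>x. exp_functional_cdf M \<xi> T x - q * L.killed_moment q 0 x) \<in> O[at_right 0](\<lambda>x. x ^ Suc N)"
      using L.truncated_moment_bigo by (rule landau_o.big_trans)
    moreover have "(\<lambda>x. q * (L.killed_moment q 0 x - (\<Sum>i=1..N. c i * x ^ i))) \<in> O[at_right 0](\<lambda>x. x ^ Suc N)"
      using landau_o.big.mult[of "\<lambda>_. q" "at_right 0" "\<lambda>_. 1", OF _ L.killed_moment_asymptotics[of q N]]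
      by (simp add: c_def)
    ultimately have "(\<lambda>x. (exp_functional_cdf M \<xi> T x - q * L.killed_moment q 0 x) +
        q * (L.killed_moment q 0 x - (\<Sum>i=1..N. c i * x ^ i))) \<in> O[at_right 0](\<lambda>x. x ^ Suc N)"
      by (rule sum_in_bigo(1))
    then have "?f \<in> O[at_right 0](\<lambda>x. x ^ Suc N)" by (simp add: algebra_simps)
    moreover have "(\<lambda>x::real. x ^ Suc N) \<in> o[at_right 0](\<lambda>x. x ^ N)" by real_asymp
    ultimately have small: "?f \<in> o[at_right 0](\<lambda>x. x ^ N)" by (rule landau_o.big_small_trans)
    have eq: "complex_of_real (exp_functional_cdf M \<xi> T x)
          + \<Psi> 0 * (\<Sum>k=1..N. expansion_coeff \<phi>p \<phi>m k * complex_of_real x ^ k) = complex_of_real (?f x)" for x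
      by (simp add: coeff Psi0)
    show ?thesis
    proof (rule landau_o.smallI)
      fix e :: real assume "e > 0"
      from landau_o.smallD[OF small this]
      show "\<forall>\<^sub>F x in at_right 0. norm (complex_of_real (exp_functional_cdf M \<xi> T x)
          + \<Psi> 0 * (\<Sum>k=1..N. expansion_coeff \<phi>p \<phi>m k * complex_of_real x ^ k)) \<le> e * norm (complex_of_real x ^ N)"
        unfolding eq by eventually_elim (simp only: norm_of_real norm_power real_norm_def power_abs)
    qed
  qed
  show ?thesis
    using im q' asymp F.convergent_imp_constant_or_affine[where \<Psi> = \<Psi>, OF _ _ Psi_nz assms(7)]
      F.constant_factor_radius[where \<Psi> = \<Psi>, OF _ _ Psi_nz]
      F.affine_factor_radius[where \<Psi> = \<Psi>, OF _ _ _ Psi_nz assms(7)]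
    by blast
qed

end
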